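(* Let $\psi:E_A\to\mathbb R$ be a Hölder continuous summable potential and let $\mu$ be a shift-invariant Borel probability measure on $E_A$, with canonical conditional measures $\bar\mu^\omega$, $\omega\in E_A^+$. Then $\mu=\mu_\psi$, the unique Gibbs state of $\psi$, if and only if there exists $D\ge1$ such that $$D^{-1}\le\frac{\bar\mu^\omega([\tau\omega|_{-n}^{\infty}])}{\exp(S_n\psi(\rho)-\mathrm P(\psi)n)}\le D$$ for every $n\ge1$, for $\mu\circ\pi_0^{-1}$-a.e. $\omega\in E_A^+$, for $\bar\mu^\omega$-a.e. $\tau\omega\in E_A(-n,\infty)$ with $A_{\tau_{-1}\omega_0}=1$ (i.e. for every $\tau\in E_A(-n,-1)$ with $A_{\tau_{-1}\omega_0}=1$ and $\bar\mu^\omega([\tau\omega|_{-n}^\infty])>0$), and every $\rho\in[\tau\omega|_0^\infty]$. Moreover, there exist $D\ge1$ and a global system $\{\bar\mu_\psi^\omega:\omega\in E_A^+\}$ of conditional measures of $\mu_\psi$ such that $$D^{-1}\le\frac{\bar\mu_\psi^\omega([\tau\omega|_{-n}^{\infty}])}{\exp(S_n\psi(\rho)-\mathrm P(\psi)n)}\le D$$ for every $\omega\in E_A^+$, every $n\ge1$, every $\tau\in E_A(-n,-1)$ with $A_{\tau_{-1}\omega_0}=1$, and every $\rho\in[\tau\omega|_0^\infty]$.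
   Context: $E$ is a countable (finite or infinite) set and $A:E\times E\to\{0,1\}$ is a matrix. A word over $E$ is admissible if $A_{ab}=1$ for any two consecutive letters $a,b$. $A$ is assumed finitely irreducible: there is a finite set $\Phi$ of finite admissible words such that for all $a,b\in E$ there is $\gamma\in\Phi$ with $a\gamma b$ admissible. $E_A\subset E^{\mathbb Z}$ and $E_A^+\subset E^{\{0,1,2,\dots\}}$ are the spaces of two-sided, resp. one-sided, admissible sequences, with left shift $\sigma$; $\pi_0:E_A\to E_A^+$, $\pi_0(\tau)=(\tau_0,\tau_1,\dots)$. For $\beta>0$, $d_\beta$ is the metric on $E_A$ given by $d_\beta(\omega,\tau)=e^{-\beta n}$, where $n\ge 0$ is maximal with $\omega_k=\tau_k$ for all $|k|\le n$ ($n=-1$ if $\omega_0\ne\tau_0$; $d_\beta(\omega,\tau)=0$ if $\omega=\tau$). A function $g:E_A\to\mathbb R$ is Hölder continuous if it is Hölder continuous with respect to one, equivalently all, of the metrics $d_\beta$ on $E_A$; then there is $\beta>0$ such that $g$ is Lipschitz continuous with respect to $d_\beta$. For an admissible word $\omega_0\dots\omega_{n-1}$, $[\omega_0\dots\omega_{n-1}]=\{\tau\in E_A:\tau_j=\omega_j,\ 0\le j\le n-1\}$. $\psi$ is summable if $\sum_{e\in E}\exp(\sup(\psi|_{[e]}))<\infty$. $S_n\psi=\sum_{j=0}^{n-1}\psi\circ\sigma^j$, and $\mathrm P(\psi)=\lim_{n}\frac1n\log\sum_{|\omega|=n}\exp(\sup(S_n\psi|_{[\omega]}))$, the sum being over admissible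 words of length $n$. A shift-invariant Borel probability measure $\mu$ on $E_A$ is a Gibbs state of $\psi$ if there are $C\ge1$, $P\in\mathbb R$ with $C^{-1}\le\mu([\omega_0\dots\omega_{n-1}])/\exp(S_n\psi(\omega)-Pn)\le C$ for all $n\ge1,\omega\in E_A$; a Hölder continuous summable $\psi$ has a unique Gibbs state $\mu_\psi$. $E_A(-n,-1)$ is the set of admissible words $\tau=\tau_{-n}\dots\tau_{-1}$ and $E_A(-n,\infty)$ the set of admissible sequences indexed by $\{-n,-n+1,\dots\}$; for $\tau\in E_A(-n,-1)$ and $\omega\in E_A^+$ with $A_{\tau_{-1}\omega_0}=1$, $\tau\omega\in E_A(-n,\infty)$ is the concatenation. $[\tau\omega|_{-n}^\infty]=\{\gamma\in E_A:\gamma_k=(\tau\omega)_k\ \forall k\ge-n\}$, and $[\tau\omega|_0^\infty]=\sigma^{-n}([\tau\omega|_{-n}^\infty])=\{\rho\in E_A:\rho_j=(\tau\omega)_{j-n}\ \forall j\ge0\}$. For $\omega\in E_A^+$, $[\omega]=\{\gamma\in E_A:\gamma_j=\omega_j\ \forall j\ge0\}$. Given a Borel probability $\mu$ on $E_A$, $\{\bar\mu^\omega\}_{\omega\in E_A^+}$ is the (Rokhlin) canonical system of conditional measures for the partition $\{[\omega]:\omega\in E_A^+\}$: each $\bar\mu^\omega$ is a Borel probability on $[\omega]$, and $\int g\,d\mu=\int_{E_A^+}\int_{[\omega]}g\,d\bar\mu^\omega\,d(\mu\circ\pi_0^{-1})(\omega)$ for all $g\in L^1(\mu)$; it is unique up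 to $\mu\circ\pi_0^{-1}$-null sets. A global system of conditional measures is such a system with $\bar\mu^\omega$ defined for every $\omega\in E_A^+$. *)

theory Defs
  imports "HOL-Probability.Probability"
begin

section \<open>Countable-alphabet subshifts of finite type\<close>

text \<open>
  The alphabet is the type \<open>'e :: countable\<close>, finite or infinite. The 0-1 matrix is a
  predicate: \<open>A a b\<close> stands for the entry at \<open>(a, b)\<close> being 1.
\<close>

definition admissible :: "('e \<Rightarrow> 'e \<Rightarrow> bool) \<Rightarrow> 'e list \<Rightarrow> bool" where
  "admissible A w \<longleftrightarrow> successively A w"

text \<open>The connecting words may be empty; requiring them to be nonempty gives the same condition.\<close>

definition finitely_irreducible :: "('e \<Rightarrow> 'e \<Rightarrow> bool) \<Rightarrow> bool" where
  "finitely_irreducible A \<longleftrightarrow>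
     (\<exists>\<Phi>. finite \<Phi> \<and> (\<forall>\<gamma>\<in>\<Phi>. admissible A \<gamma>) \<and>
          (\<forall>a b. \<exists>\<gamma>\<in>\<Phi>. admissible A (a # \<gamma> @ [b])))"

definition two_sided :: "('e \<Rightarrow> 'e \<Rightarrow> bool) \<Rightarrow> (int \<Rightarrow> 'e) set" where
  "two_sided A = {\<omega>. \<forall>k. A (\<omega> k) (\<omega> (k + 1))}"

definition one_sided :: "('e \<Rightarrow> 'e \<Rightarrow> bool) \<Rightarrow> (nat \<Rightarrow> 'e) set" where
  "one_sided A = {\<omega>. \<forall>k. A (\<omega> k) (\<omega> (Suc k))}"

definition shift :: "(int \<Rightarrow> 'e) \<Rightarrow> int \<Rightarrow> 'e" where
  "shift \<omega> = (\<lambda>k. \<omega> (k + 1))"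

definition proj0 :: "(int \<Rightarrow> 'e) \<Rightarrow> nat \<Rightarrow> 'e" where
  "proj0 \<omega> = (\<lambda>j. \<omega> (int j))"

definition cylinder :: "('e \<Rightarrow> 'e \<Rightarrow> bool) \<Rightarrow> 'e list \<Rightarrow> (int \<Rightarrow> 'e) set" where
  "cylinder A w = {\<tau> \<in> two_sided A. \<forall>j<length w. \<tau> (int j) = w ! j}"

section \<open>Topology and Borel sets\<close>

definition seq_topology :: "('i \<Rightarrow> 'e) set \<Rightarrow> ('i \<Rightarrow> 'e) topology" where
  "seq_topology X = subtopology (product_topology (\<lambda>_. discrete_topology UNIV) UNIV) X"

definition seq_borel :: "('i \<Rightarrow> 'e) set \<Rightarrow> ('i \<Rightarrow> 'e) measure" where
  "seq_borel X = sigma X {U. openin (seq_topology X) U}"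

text \<open>
  The metrics \<open>d\<^sub>\<beta>\<close>. The range \<open>n \<ge> -1\<close> builds in the convention that \<open>n = -1\<close> if the
  sequences differ at \<open>0\<close>. That the metrics induce the topology used for the Borel sets is
  \<open>mtopology_shift_dist\<close> below.
\<close>

definition agreement :: "(int \<Rightarrow> 'e) \<Rightarrow> (int \<Rightarrow> 'e) \<Rightarrow> int" where
  "agreement \<omega> \<tau> = (GREATEST n. -1 \<le> n \<and> (\<forall>k. \<bar>k\<bar> \<le> n \<longrightarrow> \<omega> k = \<tau> k))"

definition shift_dist :: "real \<Rightarrow> (int \<Rightarrow> 'e) \<Rightarrow> (int \<Rightarrow> 'e) \<Rightarrow> real" where
  "shift_dist \<beta> \<omega> \<tau> = (if \<omega> = \<tau> then 0 else exp (- \<beta> * of_int (agreement \<omega> \<tau>)))"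

lemma agreement_exists:
  fixes \<omega> \<tau> :: "int \<Rightarrow> 'e"
  assumes "\<omega> \<noteq> \<tau>"
  shows "\<exists>n. -1 \<le> n \<and> (\<forall>k. \<bar>k\<bar> \<le> n \<longrightarrow> \<omega> k = \<tau> k) \<and>
              (\<forall>m. -1 \<le> m \<and> (\<forall>k. \<bar>k\<bar> \<le> m \<longrightarrow> \<omega> k = \<tau> k) \<longrightarrow> m \<le> n)"
proof -
  let ?S = "{n::int. -1 \<le> n \<and> (\<forall>k. \<bar>k\<bar> \<le> n \<longrightarrow> \<omega> k = \<tau> k)}"
  obtain k where k: "\<omega> k \<noteq> \<tau> k"
    using assms by (auto simp: fun_eq_iff)
  have "?S \<subseteq> {-1..\<bar>k\<bar>}"
    using k by (metis (mono_tags, lifting) atLeastAtMost_iff linorder_le_cases mem_Collect_eq subsetI)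
  then have fin: "finite ?S"
    using finite_subset by blast
  have ne: "-1 \<in> ?S"
    by auto
  have "Max ?S \<in> ?S"
    using fin ne by (intro Max_in) auto
  moreover have "\<forall>m\<in>?S. m \<le> Max ?S"
    using fin by (intro ballI Max_ge) auto
  ultimately show ?thesis
    by blast
qed

lemma agreement_props:
  fixes \<omega> \<tau> :: "int \<Rightarrow> 'e"
  assumes "\<omega> \<noteq> \<tau>"
  shows "-1 \<le> agreement \<omega> \<tau>"
    and "\<bar>k\<bar> \<le> agreement \<omega> \<tau> \<Longrightarrow> \<omega> k = \<tau> k"
    and "-1 \<le> m \<Longrightarrow> (\<And>k. \<bar>k\<bar> \<le> m \<Longrightarrow> \<omega> k = \<tau> k) \<Longrightarrow> m \<le> agreement \<omega> \<tau>"
proof -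
  obtain n where n: "-1 \<le> n" "\<forall>k. \<bar>k\<bar> \<le> n \<longrightarrow> \<omega> k = \<tau> k"
    "\<forall>m. -1 \<le> m \<and> (\<forall>k. \<bar>k\<bar> \<le> m \<longrightarrow> \<omega> k = \<tau> k) \<longrightarrow> m \<le> n"
    using agreement_exists[OF assms] by blast
  have "agreement \<omega> \<tau> = n"
    unfolding agreement_def by (rule Greatest_equality) (use n in blast)+
  with n show "-1 \<le> agreement \<omega> \<tau>"
    and "\<bar>k\<bar> \<le> agreement \<omega> \<tau> \<Longrightarrow> \<omega> k = \<tau> k"
    and "-1 \<le> m \<Longrightarrow> (\<And>k. \<bar>k\<bar> \<le> m \<Longrightarrow> \<omega> k = \<tau> k) \<Longrightarrow> m \<le> agreement \<omega> \<tau>"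
    by blast+
qed

lemma agreement_commute: "agreement \<omega> \<tau> = agreement \<tau> \<omega>"
  unfolding agreement_def by (simp add: eq_commute)

lemma shift_dist_less_iff:
  assumes "0 < \<beta>"  "-1 \<le> n"
  shows "shift_dist \<beta> \<omega> \<tau> < exp (- \<beta> * of_int n) \<longleftrightarrow> (\<forall>k. \<bar>k\<bar> \<le> n + 1 \<longrightarrow> \<omega> k = \<tau> k)"
proof (cases "\<omega> = \<tau>")
  case False
  have "shift_dist \<beta> \<omega> \<tau> < exp (- \<beta> * of_int n) \<longleftrightarrow> n + 1 \<le> agreement \<omega> \<tau>"
    using False assms by (simp add: shift_dist_def) linarith
  also have "\<dots> \<longleftrightarrow> (\<forall>k. \<bar>k\<bar> \<le> n + 1 \<longrightarrow> \<omega> k = \<tau> k)"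
    using agreement_props[OF False] assms
    by (meson add_increasing2 order_trans zero_le_one)
  finally show ?thesis .
qed (auto simp: shift_dist_def)

lemma Metric_space_shift_dist:
  assumes "0 < \<beta>"
  shows "Metric_space (two_sided A) (shift_dist \<beta>)"
proof
  fix x y z :: "int \<Rightarrow> 'a"
  show "shift_dist \<beta> x z \<le> shift_dist \<beta> x y + shift_dist \<beta> y z"
  proof (cases "x = y \<or> y = z \<or> x = z")
    case True
    then show ?thesis
      by (auto simp: shift_dist_def)
  next
    case False
    then have ne: "x \<noteq> y" "y \<noteq> z" "x \<noteq> z"
      by auto
    have "min (agreement x y) (agreement y z) \<le> agreement x z"
    proof (rule agreement_props(3)[OF ne(3)])
      show "-1 \<le> min (agreement x y) (agreement y z)"
        using agreement_props(1)[OF ne(1)] agreement_props(1)[OF ne(2)] by simp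
      fix k assume "\<bar>k\<bar> \<le> min (agreement x y) (agreement y z)"
      then show "x k = z k"
        using agreement_props(2)[OF ne(1), of k] agreement_props(2)[OF ne(2), of k] by simp
    qed
    then have "agreement x y \<le> agreement x z \<or> agreement y z \<le> agreement x z"
      by auto
    then have "exp (- \<beta> * of_int (agreement x z)) \<le> exp (- \<beta> * of_int (agreement x y))
      \<or> exp (- \<beta> * of_int (agreement x z)) \<le> exp (- \<beta> * of_int (agreement y z))"
      using assms by auto
    with False show ?thesis
      by (auto simp: shift_dist_def intro: add_increasing add_increasing2)
  qed
qed (auto simp: shift_dist_def agreement_commute)

lemma mtopology_shift_dist:
  assumes "0 < \<beta>"
  shows "Metric_space.mtopology (two_sided A) (shift_dist \<beta>) = seq_topology (two_sided A)"
proof -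
  interpret M: Metric_space "two_sided A" "shift_dist \<beta>"
    using assms by (rule Metric_space_shift_dist)
  have "openin M.mtopology U \<longleftrightarrow> openin (seq_topology (two_sided A)) U" for U
  proof
    assume U: "openin M.mtopology U"
    show "openin (seq_topology (two_sided A)) U"
    proof (subst openin_subopen, intro ballI)
      fix x assume x: "x \<in> U"
      with U obtain r where r: "r > 0" "M.mball x r \<subseteq> U"
        by (auto simp: M.openin_mtopology)
      have xA: "x \<in> two_sided A"
        using U x by (auto simp: M.openin_mtopology)
      obtain n :: nat where n: "- ln r / \<beta> < real n"
        using reals_Archimedean2 by blast
      have "- \<beta> * real n < ln r"
        using n assms by (simp add: field_simps)
      then have n': "exp (- \<beta> * of_int (int n)) < r"
        using r by (metis exp_less_cancel_iff exp_ln of_int_of_nat_eq)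
      let ?F = "\<lambda>k::int. if \<bar>k\<bar> \<le> int n + 1 then {x k} else UNIV"
      have "finite {k::int. \<bar>k\<bar> \<le> int n + 1}"
        by (rule finite_subset[of _ "{- (int n + 1)..int n + 1}"]) auto
      then have "openin (product_topology (\<lambda>_. discrete_topology UNIV) UNIV) (PiE UNIV ?F)"
        by (intro product_topology_basis) (auto elim: rev_finite_subset)
      then have "openin (seq_topology (two_sided A)) (two_sided A \<inter> PiE UNIV ?F)"
        unfolding seq_topology_def by (auto simp: openin_subtopology)
      moreover have "x \<in> two_sided A \<inter> PiE UNIV ?F"
        using xA by auto
      moreover have "two_sided A \<inter> PiE UNIV ?F \<subseteq> M.mball x r"
      proof
        fix y assume y: "y \<in> two_sided A \<inter> PiE UNIV ?F"
        have "x k = y k" if "\<bar>k\<bar> \<le> int n + 1" for k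
          using y that by (auto simp: PiE_iff) (metis singletonD)
        then have "shift_dist \<beta> x y < exp (- \<beta> * of_int (int n))"
          using assms by (subst shift_dist_less_iff) auto
        then show "y \<in> M.mball x r"
          using n' xA y by auto
      qed
      ultimately show "\<exists>T. openin (seq_topology (two_sided A)) T \<and> x \<in> T \<and> T \<subseteq> U"
        using r by blast
    qed
  next
    assume "openin (seq_topology (two_sided A)) U"
    then obtain T where T: "openin (product_topology (\<lambda>_. discrete_topology UNIV) UNIV) T"
      and U: "U = T \<inter> two_sided A"
      unfolding seq_topology_def by (auto simp: openin_subtopology)
    show "openin M.mtopology U"
      unfolding M.openin_mtopology
    proof (intro conjI allI impI)
      fix x assume x: "x \<in> U"
      then obtain F where F: "finite {i. F i \<noteq> UNIV}" "x \<in> PiE UNIV F" "PiE UNIV F \<subseteq> T"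
        using T U by (auto simp: openin_product_topology_alt)
      obtain n :: nat where n: "\<And>i. F i \<noteq> UNIV \<Longrightarrow> \<bar>i\<bar> \<le> int n"
      proof -
        have "finite ((\<lambda>i. nat \<bar>i\<bar>) ` {i. F i \<noteq> UNIV})"
          using F by auto
        then obtain n where "\<forall>m\<in>(\<lambda>i. nat \<bar>i\<bar>) ` {i. F i \<noteq> UNIV}. m \<le> n"
          using finite_nat_set_iff_bounded_le by auto
        then show ?thesis
          by (intro that[of n]) (auto simp: nat_le_iff)
      qed
      have "M.mball x (exp (- \<beta> * of_int (int n))) \<subseteq> U"
      proof
        fix y assume "y \<in> M.mball x (exp (- \<beta> * of_int (int n)))"
        then have y: "y \<in> two_sided A" "shift_dist \<beta> x y < exp (- \<beta> * of_int (int n))"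
          by auto
        have eq: "x k = y k" if "\<bar>k\<bar> \<le> int n + 1" for k
          using y(2) assms that by (subst (asm) shift_dist_less_iff) auto
        have "y i \<in> F i" for i
        proof (cases "F i = UNIV")
          case False
          with n[of i] have "x i = y i"
            by (intro eq) auto
          moreover have "x i \<in> F i"
            using F(2) by auto
          ultimately show ?thesis
            by simp
        qed auto
        then have "y \<in> PiE UNIV F"
          by auto
        with F y U show "y \<in> U"
          by auto
      qed
      then show "\<exists>r>0. M.mball x r \<subseteq> U"
        by (meson exp_gt_zero)
    qed (use U in auto)
  qed
  then show ?thesis
    by (simp add: topology_eq)
qed

section \<open>Potentials, pressure, Gibbs states\<close>

text \<open>
  As usual for countable alphabets, the Hoelder inequality is imposed on pairs of points with the
  same zeroth letter. Imposing it also on pairs with different zeroth letters, whose distance is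
  \<open>exp \<beta>\<close>, would force the potential to be bounded, and no bounded potential over an infinite
  alphabet is summable. A function that is Hoelder continuous on all pairs is Hoelder continuous
  in the present sense, see \<open>hoelder_potentialI\<close>.
\<close>

definition hoelder_potential :: "('e \<Rightarrow> 'e \<Rightarrow> bool) \<Rightarrow> ((int \<Rightarrow> 'e) \<Rightarrow> real) \<Rightarrow> bool" where
  "hoelder_potential A g \<longleftrightarrow>
     (\<exists>\<beta>>0. \<exists>\<alpha>. 0 < \<alpha> \<and> \<alpha> \<le> 1 \<and> (\<exists>L\<ge>0. \<forall>\<omega>\<in>two_sided A. \<forall>\<tau>\<in>two_sided A.
        \<omega> 0 = \<tau> 0 \<longrightarrow> \<bar>g \<omega> - g \<tau>\<bar> \<le> L * shift_dist \<beta> \<omega> \<tau> powr \<alpha>))"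

lemma hoelder_potentialI:
  assumes "0 < \<beta>" "0 < \<alpha>" "\<alpha> \<le> 1" "0 \<le> L"
    and "\<And>\<omega> \<tau>. \<omega> \<in> two_sided A \<Longrightarrow> \<tau> \<in> two_sided A \<Longrightarrow>
           \<bar>g \<omega> - g \<tau>\<bar> \<le> L * shift_dist \<beta> \<omega> \<tau> powr \<alpha>"
  shows "hoelder_potential A g"
  using assms unfolding hoelder_potential_def by blast

text \<open>The boundedness clause says that each supremum over \<open>[e]\<close> is finite.\<close>

definition summable_potential :: "('e \<Rightarrow> 'e \<Rightarrow> bool) \<Rightarrow> ((int \<Rightarrow> 'e) \<Rightarrow> real) \<Rightarrow> bool" where
  "summable_potential A \<psi> \<longleftrightarrow>
     (\<forall>e. bdd_above (\<psi> ` cylinder A [e])) \<and>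
     (\<lambda>e. exp (SUP \<omega>\<in>cylinder A [e]. \<psi> \<omega>)) summable_on UNIV"

definition birkhoff_sum :: "((int \<Rightarrow> 'e) \<Rightarrow> real) \<Rightarrow> nat \<Rightarrow> (int \<Rightarrow> 'e) \<Rightarrow> real" where
  "birkhoff_sum \<psi> n \<omega> = (\<Sum>j<n. \<psi> ((shift ^^ j) \<omega>))"

definition pressure :: "('e \<Rightarrow> 'e \<Rightarrow> bool) \<Rightarrow> ((int \<Rightarrow> 'e) \<Rightarrow> real) \<Rightarrow> real" where
  "pressure A \<psi> = lim (\<lambda>n. 1 / real n *
     ln (\<Sum>\<^sub>\<infinity>w\<in>{w. admissible A w \<and> length w = n}.
           exp (SUP \<omega>\<in>cylinder A w. birkhoff_sum \<psi> n \<omega>)))"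

definition invariant_prob :: "('e \<Rightarrow> 'e \<Rightarrow> bool) \<Rightarrow> (int \<Rightarrow> 'e) measure \<Rightarrow> bool" where
  "invariant_prob A \<mu> \<longleftrightarrow>
     prob_space \<mu> \<and> sets \<mu> = sets (seq_borel (two_sided A)) \<and>
     distr \<mu> (seq_borel (two_sided A)) shift = \<mu>"

definition gibbs_state ::
  "('e \<Rightarrow> 'e \<Rightarrow> bool) \<Rightarrow> ((int \<Rightarrow> 'e) \<Rightarrow> real) \<Rightarrow> (int \<Rightarrow> 'e) measure \<Rightarrow> bool" where
  "gibbs_state A \<psi> \<mu> \<longleftrightarrow> invariant_prob A \<mu> \<and>
     (\<exists>C\<ge>1. \<exists>P. \<forall>n\<ge>1. \<forall>\<omega>\<in>two_sided A.
        inverse C \<le> measure \<mu> (cylinder A (map (\<lambda>j. \<omega> (int j)) [0..<n]))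
                      / exp (birkhoff_sum \<psi> n \<omega> - P * real n) \<and>
        measure \<mu> (cylinder A (map (\<lambda>j. \<omega> (int j)) [0..<n]))
                      / exp (birkhoff_sum \<psi> n \<omega> - P * real n) \<le> C)"

text \<open>Meaningful where the Gibbs state exists and is unique, e.g. for summable Hoelder potentials.\<close>

definition the_gibbs_state ::
  "('e \<Rightarrow> 'e \<Rightarrow> bool) \<Rightarrow> ((int \<Rightarrow> 'e) \<Rightarrow> real) \<Rightarrow> (int \<Rightarrow> 'e) measure" where
  "the_gibbs_state A \<psi> = (THE \<mu>. gibbs_state A \<psi> \<mu>)"

section \<open>Conditional measures on the pasts of one-sided sequences\<close>

definition fibre :: "('e \<Rightarrow> 'e \<Rightarrow> bool) \<Rightarrow> (nat \<Rightarrow> 'e) \<Rightarrow> (int \<Rightarrow> 'e) set" where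
  "fibre A \<omega> = {\<gamma> \<in> two_sided A. \<forall>j. \<gamma> (int j) = \<omega> j}"

text \<open>
  A word \<open>\<tau>\<close> with indices \<open>-n, \<dots>, -1\<close> is the list with \<open>\<tau> ! i\<close> at index \<open>i - n\<close>, where
  \<open>n = length \<tau>\<close>. Only the values of \<open>concat_past \<tau> \<omega>\<close> at indices \<open>\<ge> -n\<close> matter.
\<close>

definition concat_past :: "'e list \<Rightarrow> (nat \<Rightarrow> 'e) \<Rightarrow> int \<Rightarrow> 'e" where
  "concat_past \<tau> \<omega> k = (if k < 0 then \<tau> ! nat (k + int (length \<tau>)) else \<omega> (nat k))"

text \<open>The words \<open>\<tau>\<close> of length \<open>n\<close> for which \<open>\<tau>\<omega>\<close> is admissible (used for \<open>n \<ge> 1\<close>).\<close>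

definition pasts :: "('e \<Rightarrow> 'e \<Rightarrow> bool) \<Rightarrow> nat \<Rightarrow> (nat \<Rightarrow> 'e) \<Rightarrow> 'e list set" where
  "pasts A n \<omega> = {\<tau>. admissible A \<tau> \<and> length \<tau> = n \<and> A (last \<tau>) (\<omega> 0)}"

definition past_cylinder ::
  "('e \<Rightarrow> 'e \<Rightarrow> bool) \<Rightarrow> 'e list \<Rightarrow> (nat \<Rightarrow> 'e) \<Rightarrow> (int \<Rightarrow> 'e) set" where
  "past_cylinder A \<tau> \<omega> =
     {\<gamma> \<in> two_sided A. \<forall>k\<ge>- int (length \<tau>). \<gamma> k = concat_past \<tau> \<omega> k}"

definition shifted_past_cylinder ::
  "('e \<Rightarrow> 'e \<Rightarrow> bool) \<Rightarrow> 'e list \<Rightarrow> (nat \<Rightarrow> 'e) \<Rightarrow> (int \<Rightarrow> 'e) set" where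
  "shifted_past_cylinder A \<tau> \<omega> =
     {\<rho> \<in> two_sided A. \<forall>j\<ge>0. \<rho> j = concat_past \<tau> \<omega> (j - int (length \<tau>))}"

definition future_marginal ::
  "('e \<Rightarrow> 'e \<Rightarrow> bool) \<Rightarrow> (int \<Rightarrow> 'e) measure \<Rightarrow> (nat \<Rightarrow> 'e) measure" where
  "future_marginal A \<mu> = distr \<mu> (seq_borel (one_sided A)) proj0"

definition borel_prob_on_fibre ::
  "('e \<Rightarrow> 'e \<Rightarrow> bool) \<Rightarrow> (nat \<Rightarrow> 'e) \<Rightarrow> (int \<Rightarrow> 'e) measure \<Rightarrow> bool" where
  "borel_prob_on_fibre A \<omega> M \<longleftrightarrow>
     prob_space M \<and> sets M = sets (seq_borel (two_sided A)) \<and> measure M (fibre A \<omega>) = 1"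

text \<open>
  The integral identity over all of \<open>L\<^sup>1(\<mu>)\<close>. The predicate \<open>has_bochner_integral\<close> includes
  measurability and integrability of the inner integral as a function of \<open>\<omega>\<close>. Measures in the
  fibres over an exceptional null set are unconstrained in \<open>conditional_system\<close>.
\<close>

definition disintegrates ::
  "('e \<Rightarrow> 'e \<Rightarrow> bool) \<Rightarrow> (int \<Rightarrow> 'e) measure \<Rightarrow> ((nat \<Rightarrow> 'e) \<Rightarrow> (int \<Rightarrow> 'e) measure) \<Rightarrow> bool" where
  "disintegrates A \<mu> m \<longleftrightarrow>
     (\<forall>g :: (int \<Rightarrow> 'e) \<Rightarrow> real. integrable \<mu> g \<longrightarrow>
        has_bochner_integral (future_marginal A \<mu>) (\<lambda>\<omega>. \<integral>\<gamma>. g \<gamma> \<partial>m \<omega>) (\<integral>\<gamma>. g \<gamma> \<partial>\<mu>))"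

definition conditional_system ::
  "('e \<Rightarrow> 'e \<Rightarrow> bool) \<Rightarrow> (int \<Rightarrow> 'e) measure \<Rightarrow> ((nat \<Rightarrow> 'e) \<Rightarrow> (int \<Rightarrow> 'e) measure) \<Rightarrow> bool" where
  "conditional_system A \<mu> m \<longleftrightarrow>
     (AE \<omega> in future_marginal A \<mu>. borel_prob_on_fibre A \<omega> (m \<omega>)) \<and> disintegrates A \<mu> m"

definition global_conditional_system ::
  "('e \<Rightarrow> 'e \<Rightarrow> bool) \<Rightarrow> (int \<Rightarrow> 'e) measure \<Rightarrow> ((nat \<Rightarrow> 'e) \<Rightarrow> (int \<Rightarrow> 'e) measure) \<Rightarrow> bool" where
  "global_conditional_system A \<mu> m \<longleftrightarrow>
     (\<forall>\<omega>\<in>one_sided A. borel_prob_on_fibre A \<omega> (m \<omega>)) \<and> disintegrates A \<mu> m"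

end

theory Submission
  imports Defs
begin

text \<open>
  By bounded distortion, the weights \<open>exp (sup (S\<^sub>n \<psi>))\<close> of admissible words are multiplicative under
  concatenation up to a constant, and finite irreducibility makes the partition sums comparable to
  \<open>exp (n P)\<close>. A Gibbs state is a limit of laws of periodic sequences built from random weighted words;
  summability supplies tightness, hence consistency of the limiting cylinder masses. Long words can
  be joined through finitely many connecting words, which makes the Gibbs state ergodic; so an invariant
  measure whose cylinder masses are at most a constant times the weights has an invariant density, and
  equals the Gibbs state. Integrating the upper conditional bound over the futures gives such masses.

  Conversely, the masses of \<open>\<tau>w\<close> and of \<open>\<tau>\<close> and \<open>w\<close> separately are comparable, so that the joint law of a
  past \<open>\<tau>\<close> and the future is comparable to the weight of \<open>\<tau>\<close> times the law of the future, and the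
  conditional probabilities, being its density, satisfy the bounds.
\<close>

text \<open>The potential may depend on past coordinates as well as future ones. It is not replaced
  by a cohomologous function of the future: all estimates concern suprema of Birkhoff sums over
  words, where only distortion at both ends of a word matters. Since A may be periodic, mixing at
  one fixed gap can fail; each comparison of words therefore either trades letters to restore a
  length or sums over all connecting words. Over an infinite alphabet limits of laws can lose mass,
  so sums over words are taken in \<open>ennreal\<close> until finiteness is known.

  \<open>the_gibbs_state\<close> is a definite description, so existence and uniqueness belong to
  the proof. The final constant is \<open>G ^ 2 * K ^ 2\<close>: \<open>G ^ 2\<close> for the Gibbs
  inequalities of \<tau>w and of w, one K for cutting \<tau>w, and one K for passing from the
  supremum to the Birkhoff sum at \<rho>. Bounds over every future cannot come from an arbitrary
  version of the conditional measures; the null set where a version misbehaves has to be repaired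
  measurably and without spoiling the bounds.\<close>

lemma algebra_approximation:
  assumes alg: "algebra \<Omega> \<A>" and sM: "sets M = sigma_sets \<Omega> \<A>" and sN: "sets N = sets M"
    and fM: "finite_measure M" and fN: "finite_measure N"
    and B: "B \<in> sets M" and e: "0 < (e::real)"
  shows "\<exists>G\<in>\<A>. measure M (sym_diff B G) < e \<and> measure N (sym_diff B G) < e"
proof -
  interpret algebra \<Omega> \<A> by fact
  interpret M: finite_measure M by fact
  interpret N: finite_measure N by fact
  have sA: "G \<in> sets M" if "G \<in> \<A>" for G
    using that by (simp add: sM sigma_sets.Basic)
  have "B \<in> sigma_sets \<Omega> \<A>" using B sM by simp
  then show ?thesis using e
  proof (induction arbitrary: e rule: sigma_sets.induct)
    case (Basic a)
    then show ?case by (intro bexI[of _ a]) auto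
  next
    case Empty
    then show ?case by (intro bexI[of _ "{}"]) auto
  next
    case (Compl a)
    then obtain G where G: "G \<in> \<A>" "measure M (sym_diff a G) < e" "measure N (sym_diff a G) < e"
      by blast
    have "a \<subseteq> \<Omega>" using Compl(1) sigma_sets_into_sp[OF space_closed] by blast
    then have "sym_diff (\<Omega> - a) (\<Omega> - G) = sym_diff a G"
      using sets_into_space[OF G(1)] by auto
    with G show ?case by (intro bexI[of _ "\<Omega> - G"]) auto
  next
    case (Union a)
    have a: "a i \<in> sets M" for i using Union(1) by (simp add: sM)
    \<comment> \<open>The algebra is closed under finite unions only, so the union is first cut off;
      the larger of two cutoffs serves both measures.\<close>
    have tails: "\<exists>k. \<forall>n\<ge>k. measure L ((\<Union>i. a i) - (\<Union>i<n. a i)) < e / 2"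
      if "finite_measure L" "sets L = sets M" for L
    proof -
      interpret L: finite_measure L by fact
      have "(\<lambda>n. measure L ((\<Union>i. a i) - (\<Union>i<n. a i)))
        \<longlonglongrightarrow> measure L (\<Inter>n. (\<Union>i. a i) - (\<Union>i<n. a i))"
      proof (rule L.finite_Lim_measure_decseq)
        show "range (\<lambda>n. (\<Union>i. a i) - (\<Union>i<n. a i)) \<subseteq> sets L"
          using a that(2) by auto
        show "decseq (\<lambda>n. (\<Union>i. a i) - (\<Union>i<n. a i))"
          unfolding decseq_def using less_le_trans by blast
      qed
      also have "(\<Inter>n. (\<Union>i. a i) - (\<Union>i<n. a i)) = {}" by auto
      finally have "(\<lambda>n. measure L ((\<Union>i. a i) - (\<Union>i<n. a i))) \<longlonglongrightarrow> 0" by simp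
      then have "\<forall>\<^sub>F n in sequentially. measure L ((\<Union>i. a i) - (\<Union>i<n. a i)) < e / 2"
        using Union(3) by (intro order_tendstoD(2)) auto
      then show ?thesis by (simp add: eventually_sequentially)
    qed
    obtain k1 k2 where k: "\<forall>n\<ge>k1. measure M ((\<Union>i. a i) - (\<Union>i<n. a i)) < e / 2"
        "\<forall>n\<ge>k2. measure N ((\<Union>i. a i) - (\<Union>i<n. a i)) < e / 2"
      using tails[OF fM] tails[OF fN sN] by blast
    define k where "k = max k1 k2"
    \<comment> \<open>The tail takes e / 2, and the k approximation errors share the other half; the
      \<open>+ 1\<close> covers k = 0.\<close>
    define \<epsilon> where "\<epsilon> = e / (2 * (real k + 1))"
    have "\<epsilon> > 0" using Union(3) by (simp add: \<epsilon>_def)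
    then have "\<forall>i. \<exists>G\<in>\<A>. measure M (sym_diff (a i) G) < \<epsilon> \<and> measure N (sym_diff (a i) G) < \<epsilon>"
      using Union(2) by blast
    then obtain G where G: "\<And>i. G i \<in> \<A>"
      "\<And>i. measure M (sym_diff (a i) (G i)) < \<epsilon>" "\<And>i. measure N (sym_diff (a i) (G i)) < \<epsilon>"
      by metis
    let ?G = "\<Union>i<k. G i"
    have sub: "sym_diff (\<Union>i. a i) ?G \<subseteq>
        ((\<Union>i. a i) - (\<Union>i<k. a i)) \<union> (\<Union>i<k. sym_diff (a i) (G i))" by auto
    have bound: "measure L (sym_diff (\<Union>i. a i) ?G) < e"
      if L: "finite_measure L" "sets L = sets M" "measure L ((\<Union>i. a i) - (\<Union>i<k. a i)) < e / 2"
        "\<And>i. measure L (sym_diff (a i) (G i)) < \<epsilon>" for L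
    proof -
      interpret L: finite_measure L by fact
      have m: "a i \<in> sets L" "G i \<in> sets L" for i using a sA[OF G(1)] L(2) by auto
      have "measure L (sym_diff (\<Union>i. a i) ?G)
        \<le> measure L (((\<Union>i. a i) - (\<Union>i<k. a i)) \<union> (\<Union>i<k. sym_diff (a i) (G i)))"
        using sub m by (intro L.finite_measure_mono) auto
      also have "\<dots> \<le> measure L ((\<Union>i. a i) - (\<Union>i<k. a i)) + measure L (\<Union>i<k. sym_diff (a i) (G i))"
        using m by (intro measure_Un_le) auto
      also have "measure L (\<Union>i<k. sym_diff (a i) (G i)) \<le> (\<Sum>i<k. measure L (sym_diff (a i) (G i)))"
        using m by (intro measure_UNION_le) auto
      also have "\<dots> \<le> (\<Sum>i<k. \<epsilon>)" by (intro sum_mono less_imp_le L(4))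
      also have "\<dots> \<le> e / 2" using Union(3) by (simp add: \<epsilon>_def field_simps)
      finally show ?thesis using L(3) by simp
    qed
    have "?G \<in> \<A>" using G(1) by auto
    moreover have "measure M (sym_diff (\<Union>i. a i) ?G) < e"
      by (rule bound[OF fM refl _ G(2)]) (use k in \<open>simp add: k_def\<close>)
    moreover have "measure N (sym_diff (\<Union>i. a i) ?G) < e"
      by (rule bound[OF fN sN _ G(3)]) (use k in \<open>simp add: k_def\<close>)
    ultimately show ?case by blast
  qed
qed

section \<open>Windows of coordinates\<close>

text \<open>Leaving the enumeration of the coordinates open lets one comparison argument serve
  two-sided sequences, futures and arbitrary countable index sets.\<close>

definition covering :: "(nat \<Rightarrow> 'i list) \<Rightarrow> bool" where
  "covering win \<longleftrightarrow> (\<forall>I. finite I \<longrightarrow> (\<exists>m. I \<subseteq> set (win m)))"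

text \<open>\<open>S\<close> may be any set of words, even an infinite one. This makes the family an
  algebra over an infinite alphabet, where the complement of a single cylinder is an infinite union
  of cylinders.\<close>

definition window_sets :: "('i \<Rightarrow> 'e) set \<Rightarrow> (nat \<Rightarrow> 'i list) \<Rightarrow> ('i \<Rightarrow> 'e) set set" where
  "window_sets X win = {{x \<in> X. map x (win m) \<in> S} | m S. True}"

text \<open>The word at \<open>is\<close> is a function of the word at \<open>js\<close>, so
  membership can be tested by the words at \<open>js\<close> that the points of the set
  realise.\<close>

lemma window_sets_refine:
  assumes "set is \<subseteq> set js"
  shows "\<exists>T. {x \<in> X. map x is \<in> S} = {x \<in> X. map x js \<in> T}"
proof
  show "{x \<in> X. map x is \<in> S} = {x \<in> X. map x js \<in> (\<lambda>x. map x js) ` {x \<in> X. map x is \<in> S}}"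
  proof (intro set_eqI iffI)
    fix x assume "x \<in> {x \<in> X. map x js \<in> (\<lambda>x. map x js) ` {x \<in> X. map x is \<in> S}}"
    then obtain y where y: "x \<in> X" "map x js = map y js" "map y is \<in> S" by blast
    then have "map x is = map y is" using assms by auto
    then show "x \<in> {x \<in> X. map x is \<in> S}" using y by (metis mem_Collect_eq)
  qed auto
qed

lemma algebra_window_sets:
  assumes "covering win"
  shows "algebra X (window_sets X win)"
  unfolding algebra_iff_Un
proof (intro conjI ballI)
  show "window_sets X win \<subseteq> Pow X" by (auto simp: window_sets_def)
  show "{} \<in> window_sets X win"
    unfolding window_sets_def by (auto intro!: exI[of _ "{}"])
  fix a assume "a \<in> window_sets X win"
  then obtain m S where a: "a = {x \<in> X. map x (win m) \<in> S}" by (auto simp: window_sets_def)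
  have "X - a = {x \<in> X. map x (win m) \<in> - S}" by (auto simp: a)
  then show "X - a \<in> window_sets X win" unfolding window_sets_def by blast
  fix b assume "b \<in> window_sets X win"
  then obtain n T where b: "b = {x \<in> X. map x (win n) \<in> T}" by (auto simp: window_sets_def)
  obtain l where l: "set (win m) \<union> set (win n) \<subseteq> set (win l)"
    using assms unfolding covering_def by (metis List.finite_set finite_UnI)
  obtain S' T' where "a = {x \<in> X. map x (win l) \<in> S'}" "b = {x \<in> X. map x (win l) \<in> T'}"
    using window_sets_refine[of "win m" "win l" X S] window_sets_refine[of "win n" "win l" X T] l a b
    by auto
  then have "a \<union> b = {x \<in> X. map x (win l) \<in> S' \<union> T'}" by auto
  then show "a \<union> b \<in> window_sets X win" unfolding window_sets_def by blast
qed

lemma seq_open_subset: "openin (seq_topology X) U \<Longrightarrow> U \<subseteq> X"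
  by (auto simp: seq_topology_def openin_subtopology)

lemma space_seq_borel [simp]: "space (seq_borel X) = X"
  unfolding seq_borel_def by (rule space_measure_of) (use seq_open_subset in auto)

lemma sets_seq_borel: "sets (seq_borel X) = sigma_sets X {U. openin (seq_topology X) U}"
  unfolding seq_borel_def by (rule sets_measure_of) (use seq_open_subset in auto)

lemma coordinate_measurable [measurable]:
  "(\<lambda>x. x i) \<in> measurable (seq_borel X) (count_space UNIV)"
proof (rule measurableI)
  fix S :: "'b set"
  let ?F = "\<lambda>j. if j = i then S else UNIV"
  have "openin (product_topology (\<lambda>_. discrete_topology UNIV) UNIV) (PiE UNIV ?F)"
    by (intro product_topology_basis) (auto elim: rev_finite_subset)
  then have "openin (seq_topology X) (X \<inter> PiE UNIV ?F)"
    unfolding seq_topology_def by (auto simp: openin_subtopology)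
  moreover have "(\<lambda>x. x i) -` S \<inter> space (seq_borel X) = X \<inter> PiE UNIV ?F"
    by (auto simp: PiE_iff split: if_splits)
  ultimately show "(\<lambda>x. x i) -` S \<inter> space (seq_borel X) \<in> sets (seq_borel X)"
    by (auto simp: sets_seq_borel intro: sigma_sets.Basic)
qed auto

lemma word_measurable [measurable]:
  "(\<lambda>x::'i \<Rightarrow> 'e::countable. map x is) \<in> measurable (seq_borel X) (count_space UNIV)"
proof (subst measurable_count_space_eq_countable, simp, intro conjI ballI)
  fix w :: "'e list"
  have "(\<lambda>x. map x is) -` {w} \<inter> space (seq_borel X) =
    {x \<in> space (seq_borel X). length is = length w \<and> (\<forall>j<length w. x (is ! j) = w ! j)}"
    by (auto simp: list_eq_iff_nth_eq)
  also have "\<dots> \<in> sets (seq_borel X)"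
    by measurable
  finally show "(\<lambda>x. map x is) -` {w} \<inter> space (seq_borel X) \<in> sets (seq_borel X)" .
qed simp

lemma window_measurable: "{x \<in> X. P (map x (is :: 'i list) :: 'e::countable list)} \<in> sets (seq_borel X)"
proof -
  have "(\<lambda>x. map x is) -` {w. P w} \<inter> space (seq_borel X) \<in> sets (seq_borel X)"
    by (rule measurable_sets[OF word_measurable]) simp
  moreover have "(\<lambda>x. map x is) -` {w. P w} \<inter> space (seq_borel X) = {x \<in> X. P (map x is)}"
    by auto
  ultimately show ?thesis by simp
qed

lemma sets_seq_borel_window:
  fixes X :: "('i \<Rightarrow> 'e::countable) set"
  assumes win: "covering win"
  shows "sets (seq_borel X) = sigma_sets X (window_sets X win)"
proof (rule antisym)
  show "sigma_sets X (window_sets X win) \<subseteq> sets (seq_borel X)"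
  proof -
    have "window_sets X win \<subseteq> sets (seq_borel X)"
      by (auto simp: window_sets_def intro!: window_measurable)
    then show ?thesis
      using sets.sigma_sets_subset[of "window_sets X win" "seq_borel X"] by simp
  qed
  have "U \<in> sigma_sets X (window_sets X win)" if U: "openin (seq_topology X) U" for U
  proof -
    obtain T where T: "openin (product_topology (\<lambda>_. discrete_topology UNIV) UNIV) T" "U = T \<inter> X"
      using U unfolding seq_topology_def by (auto simp: openin_subtopology)
    \<comment> \<open>An open set is the union of the window cylinders inside it. Pairs of a window
      number and a word over a countable alphabet are countable, so this union stays in the
      sigma-algebra.\<close>
    define C where "C = {(m, w). {x \<in> X. map x (win m) = w} \<subseteq> U}"
    have "U = (\<Union>(m, w)\<in>C. {x \<in> X. map x (win m) = w})"
    proof (intro antisym subsetI)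
      fix x assume x: "x \<in> U"
      then obtain F where F: "finite {i. F i \<noteq> UNIV}" "x \<in> PiE UNIV F" "PiE UNIV F \<subseteq> T"
        using T by (auto simp: openin_product_topology_alt)
      obtain m where m: "{i. F i \<noteq> UNIV} \<subseteq> set (win m)"
        using win F(1) unfolding covering_def by blast
      have "{y \<in> X. map y (win m) = map x (win m)} \<subseteq> U"
      proof
        fix y assume y: "y \<in> {y \<in> X. map y (win m) = map x (win m)}"
        have "y i \<in> F i" for i
        proof (cases "F i = UNIV")
          case False
          then have "y i = x i" using m y by (auto simp: map_eq_conv)
          then show ?thesis using F(2) by auto
        qed auto
        then have "y \<in> PiE UNIV F" by auto
        then show "y \<in> U" using F(3) T(2) y by auto
      qed
      then have "(m, map x (win m)) \<in> C" by (simp add: C_def)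
      then show "x \<in> (\<Union>(m, w)\<in>C. {x \<in> X. map x (win m) = w})" using x T by force
    qed (auto simp: C_def)
    also have "\<dots> \<in> sigma_sets X (window_sets X win)"
    proof -
      have "{x \<in> X. map x (win m) = w} \<in> window_sets X win" for m w
        unfolding window_sets_def by (auto intro!: exI[of _ m] exI[of _ "{w}"])
      then show ?thesis
        by (intro sigma_sets_UNION) (auto intro!: sigma_sets.Basic)
    qed
    finally show ?thesis .
  qed
  then show "sets (seq_borel X) \<subseteq> sigma_sets X (window_sets X win)"
    unfolding sets_seq_borel by (intro sigma_sets_mono) auto
qed

lemma measurable_seq_borel:
  fixes f :: "'a \<Rightarrow> ('i::countable \<Rightarrow> 'e::countable)"
  assumes "\<And>x. x \<in> space M \<Longrightarrow> f x \<in> X"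
    and f [measurable]: "\<And>i. (\<lambda>x. f x i) \<in> measurable M (count_space UNIV)"
  shows "f \<in> measurable M (seq_borel X)"
proof -
  \<comment> \<open>For an index type that is merely countable, the windows are the initial segments
    of an enumeration.\<close>
  define win :: "nat \<Rightarrow> 'i list" where "win m = map from_nat [0..<m]" for m
  have win: "covering win"
    unfolding covering_def
  proof (intro allI impI)
    fix I :: "'i set" assume "finite I"
    then obtain m where "\<forall>i\<in>to_nat ` I. i < m" using finite_nat_set_iff_bounded by blast
    then have "I \<subseteq> set (win m)"
      by (force simp: win_def image_iff intro!: bexI[of _ "to_nat _"])
    then show "\<exists>m. I \<subseteq> set (win m)" ..
  qed
  show ?thesis
  proof (rule measurable_sigma_sets[OF sets_seq_borel_window[OF win]])
    show "window_sets X win \<subseteq> Pow X" by (auto simp: window_sets_def)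
    show "f \<in> space M \<rightarrow> X" using assms(1) by auto
    fix W assume "W \<in> window_sets X win"
    then obtain m S where W: "W = {x \<in> X. map x (win m) \<in> S}" by (auto simp: window_sets_def)
    have eq: "map (f x) (win m) = w \<longleftrightarrow> length (win m) = length w \<and> (\<forall>j<length w. f x (win m ! j) = w ! j)"
      for x w by (auto simp: list_eq_iff_nth_eq)
    have "f -` W \<inter> space M = {x \<in> space M. \<exists>w\<in>S. length (win m) = length w \<and> (\<forall>j<length w. f x (win m ! j) = w ! j)}"
      using assms(1) unfolding W eq[symmetric] by auto
    also have "\<dots> \<in> sets M" by measurable
    finally show "f -` W \<inter> space M \<in> sets M" .
  qed
qed

text \<open>Summation over words carries the inequality from cylinders to
  \<open>window_sets\<close>. An inequality, unlike an equality, does not pass through a pi-system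
  argument; instead, one window set approximates \<open>B\<close> for both measures at once, which
  is why \<open>algebra_approximation\<close> treats two measures.\<close>

lemma measure_le_of_windows:
  fixes X :: "('i \<Rightarrow> 'e::countable) set"
  assumes win: "covering win" and "finite_measure M" "finite_measure N"
    and sM: "sets M = sets (seq_borel X)" and sN: "sets N = sets (seq_borel X)"
    and le: "\<And>m w. measure M {x \<in> X. map x (win m) = w} \<le> measure N {x \<in> X. map x (win m) = w}"
    and B: "B \<in> sets M"
  shows "measure M B \<le> measure N B"
proof -
  interpret M: finite_measure M by fact
  interpret N: finite_measure N by fact
  have fd: "measure M G \<le> measure N G" if G: "G \<in> window_sets X win" for G
  proof -
    obtain m S where G: "G = {x \<in> X. map x (win m) \<in> S}" using G by (auto simp: window_sets_def)
    have eq: "emeasure L G = (\<integral>\<^sup>+w. ennreal (measure L {x \<in> X. map x (win m) = w}) \<partial>count_space S)"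
      if "finite_measure L" "sets L = sets (seq_borel X)" for L
    proof -
      interpret L: finite_measure L by fact
      have "G = (\<Union>w\<in>S. {x \<in> X. map x (win m) = w})" by (auto simp: G)
      also have "emeasure L \<dots> = (\<integral>\<^sup>+w. emeasure L {x \<in> X. map x (win m) = w} \<partial>count_space S)"
        using that(2) by (intro emeasure_UN_countable)
          (auto simp: disjoint_family_on_def intro!: window_measurable)
      finally show ?thesis by (simp add: L.emeasure_eq_measure)
    qed
    have "emeasure M G \<le> emeasure N G"
      unfolding eq[OF assms(2) sM] eq[OF assms(3) sN]
      by (intro nn_integral_mono ennreal_leI le)
    then show ?thesis by (simp add: M.emeasure_eq_measure N.emeasure_eq_measure)
  qed
  show ?thesis
  proof (rule field_le_epsilon)
    fix e :: real assume "0 < e"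
    then obtain G where G: "G \<in> window_sets X win" "measure M (sym_diff B G) < e / 2"
      "measure N (sym_diff B G) < e / 2"
      using algebra_approximation[OF algebra_window_sets[OF win, of X], of M N B "e/2"] assms
        sets_seq_borel_window[OF win, of X] by auto
    have s: "B \<in> sets M" "G \<in> sets M" "B \<in> sets N" "G \<in> sets N"
      using B sM sN G(1) by (auto simp: window_sets_def intro!: window_measurable)
    have "measure M B \<le> measure M (G \<union> sym_diff B G)" using s by (intro M.finite_measure_mono) auto
    also have "\<dots> \<le> measure M G + measure M (sym_diff B G)" using s by (intro measure_Un_le) auto
    also have "measure M G \<le> measure N G" by (rule fd[OF G(1)])
    also have "measure N G \<le> measure N (B \<union> sym_diff B G)" using s by (intro N.finite_measure_mono) auto
    also have "\<dots> \<le> measure N B + measure N (sym_diff B G)" using s by (intro measure_Un_le) auto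
    finally show "measure M B \<le> measure N B + e" using G by simp
  qed
qed

lemma measure_eq_of_windows:
  fixes X :: "('i \<Rightarrow> 'e::countable) set"
  assumes win: "covering win" and "finite_measure M" "finite_measure N"
    and sM: "sets M = sets (seq_borel X)" and sN: "sets N = sets (seq_borel X)"
    and eq: "\<And>m w. measure M {x \<in> X. map x (win m) = w} = measure N {x \<in> X. map x (win m) = w}"
  shows "M = N"
proof (rule measure_eqI)
  show "sets M = sets N" using sM sN by simp
  fix B assume "B \<in> sets M"
  then have B: "B \<in> sets M" "B \<in> sets N" using sM sN by auto
  have "measure M B = measure N B"
    using measure_le_of_windows[OF win assms(2,3) sM sN eq_refl[OF eq] B(1)]
      measure_le_of_windows[OF win assms(3,2) sN sM eq_refl[OF eq[symmetric]] B(2)] by simp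
  then show "emeasure M B = emeasure N B"
    using assms(2,3) by (simp add: finite_measure.emeasure_eq_measure)
qed

text \<open>Ionescu-Tulcea with the conditional probabilities \<open>q (w @ [e]) / q w\<close> as transition kernels.\<close>

lemma word_measure_exists:
  fixes q :: "'a::countable list \<Rightarrow> real"
  assumes q0: "q [] = 1" and nonneg: "\<And>w. 0 \<le> q w"
    and step: "\<And>w. (\<integral>\<^sup>+e. ennreal (q (w @ [e])) \<partial>count_space UNIV) = ennreal (q w)"
  shows "\<exists>M. prob_space M \<and> sets M = sets (seq_borel (UNIV :: (nat \<Rightarrow> 'a) set)) \<and>
    (\<forall>w. measure M {x. map x [0..<length w] = w} = q w)"
proof -
  \<comment> \<open>Words of mass 0 are almost surely never reached; an arbitrary law is put there
    to keep the kernel a probability.\<close>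
  define K where "K w = (if q w > 0 then embed_pmf (\<lambda>e. q (w @ [e]) / q w) else return_pmf undefined)" for w
  define P where "P n x = measure_pmf (K (map x [0..<n]))" for n and x :: "nat \<Rightarrow> 'a"
  let ?M = "\<lambda>_::nat. count_space (UNIV :: 'a set)"
  have pmf_K: "pmf (K w) e = q (w @ [e]) / q w" if "q w > 0" for w e
  proof -
    have "(\<integral>\<^sup>+e. ennreal (q (w @ [e]) / q w) \<partial>count_space UNIV)
      = (\<integral>\<^sup>+e. ennreal (1 / q w) * ennreal (q (w @ [e])) \<partial>count_space UNIV)"
      using that nonneg by (intro nn_integral_cong) (simp add: ennreal_mult'[symmetric])
    also have "\<dots> = ennreal (1 / q w) * ennreal (q w)"
      by (subst nn_integral_cmult) (simp_all only: step measurable_count_space_eq1 Pi_UNIV UNIV_I space_borel)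
    also have "\<dots> = 1"
      using that by (subst ennreal_mult'[symmetric]) simp_all
    finally have "pmf (embed_pmf (\<lambda>e. q (w @ [e]) / q w)) e = q (w @ [e]) / q w"
      using that nonneg by (intro pmf_embed_pmf) auto
    then show ?thesis using that by (simp add: K_def)
  qed
  have wm [measurable]: "(\<lambda>x. map x [0..<n]) \<in> measurable (PiM {0..<n} ?M) (count_space UNIV)" for n
  proof (rule measurable_count_space_eq_countable[THEN iffD2, OF countableI_type], intro conjI ballI)
    fix w :: "'a list"
    have "map x [0..<n] = w \<longleftrightarrow> n = length w \<and> (\<forall>j\<in>{0..<n}. x j = w ! j)" for x
      unfolding list_eq_iff_nth_eq by (simp add: Ball_def)
    then have "(\<lambda>x. map x [0..<n]) -` {w} \<inter> space (PiM {0..<n} ?M) =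
      {x \<in> space (PiM {0..<n} ?M). n = length w \<and> (\<forall>j\<in>{0..<n}. x j = w ! j)}"
      by blast
    also have "\<dots> \<in> sets (PiM {0..<n} ?M)" by measurable
    finally show "(\<lambda>x. map x [0..<n]) -` {w} \<inter> space (PiM {0..<n} ?M) \<in> sets (PiM {0..<n} ?M)" .
  qed simp
  interpret IT: Ionescu_Tulcea P ?M
    unfolding P_def
    by (rule Ionescu_Tulcea.intro)
      (rule measurable_compose[OF wm measurable_measure_pmf], rule measure_pmf.prob_space_axioms)
  \<comment> \<open>\<open>IT.C 0 n\<close> is the law of the first n letters, started from the
    empty history.\<close>
  have C: "emeasure (IT.C 0 n (\<lambda>x. undefined)) {x \<in> space (PiM {0..<n} ?M). map x [0..<n] = w} = q w"
    if "length w = n" for n w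
    using that
  proof (induction n arbitrary: w)
    case 0
    then show ?case by (simp add: q0 space_PiM sets_PiM_empty)
  next
    case (Suc n)
    obtain v e where w: "w = v @ [e]" and v: "length v = n"
      using Suc.prems by (metis length_Suc_conv_rev)
    let ?A = "{x \<in> space (PiM {0..<Suc n} ?M). map x [0..<Suc n] = w}"
    let ?V = "{x \<in> space (PiM {0..<n} ?M). map x [0..<n] = v}"
    have A: "?A \<in> sets (PiM {0..<Suc n} ?M)" by measurable
    have [simp]: "(\<lambda>x. undefined) \<in> space (PiM {0..<0} ?M)" by (simp add: space_PiM)
    have pre: "fun_upd x n -` ?A \<inter> space (count_space UNIV) = (if map x [0..<n] = v then {e} else {})"
      if x: "x \<in> space (PiM {0..<n} ?M)" for x
    proof -
      have up: "x(n := y) \<in> space (PiM {0..<Suc n} ?M)" for y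
        using x by (auto simp: space_PiM PiE_iff extensional_def)
      have "map (x(n := y)) [0..<n] = map x [0..<n]" for y by auto
      then show ?thesis using up v by (auto simp: w)
    qed
    have eP: "emeasure (IT.eP n x) ?A = ennreal (pmf (K v) e) * indicator ?V x"
      if x: "x \<in> space (PiM {0..<n} ?M)" for x
      unfolding IT.emeasure_eP[OF x A] pre[OF x] using x by (auto simp: P_def emeasure_pmf_single)
    have V: "?V \<in> sets (IT.C 0 n (\<lambda>x. undefined))"
      using measurable_sets[OF wm, of "{v}" n] by (subst IT.sets_C) (auto simp: vimage_def Int_def conj_commute)
    have "emeasure (IT.C 0 (Suc n) (\<lambda>x. undefined)) ?A
      = (\<integral>\<^sup>+x. emeasure (IT.eP n x) ?A \<partial>IT.C 0 n (\<lambda>x. undefined))"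
      unfolding IT.C.simps
    proof (subst emeasure_bind[OF _ _ A])
      show "space (IT.C 0 n (\<lambda>x. undefined)) \<noteq> {}" by (simp add: IT.space_C)
      show "IT.eP (0 + n) \<in> measurable (IT.C 0 n (\<lambda>x. undefined)) (subprob_algebra (PiM {0..<Suc n} ?M))"
        using IT.measurable_eP[of n] by (simp add: measurable_cong_sets[OF IT.sets_C refl])
    qed simp
    also have "\<dots> = (\<integral>\<^sup>+x. ennreal (pmf (K v) e) * indicator ?V x \<partial>IT.C 0 n (\<lambda>x. undefined))"
      by (intro nn_integral_cong) (simp add: IT.space_C eP del: upt_Suc)
    also have "\<dots> = ennreal (pmf (K v) e) * ennreal (q v)"
      using V Suc.IH[OF v] by (simp add: nn_integral_cmult_indicator)
    also have "\<dots> = q w"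
    proof (cases "q v > 0")
      case True
      then show ?thesis using nonneg by (simp add: ennreal_mult'[symmetric] pmf_K w)
    next
      case False
      then have "q v = 0" using nonneg[of v] by simp
      \<comment> \<open>When \<open>v\<close> has no mass, \<open>step\<close> forces its extension
        \<open>w\<close> to have none, so the default kernel is harmless.\<close>
      have "ennreal (q w) \<le> (\<integral>\<^sup>+e. ennreal (q (v @ [e])) \<partial>count_space UNIV)"
        unfolding w by (rule nn_integral_ge_point) simp
      then have "q w = 0" using step[of v] \<open>q v = 0\<close> nonneg[of w] by (simp add: ennreal_eq_0_iff)
      then show ?thesis using \<open>q v = 0\<close> by simp
    qed
    finally show ?case .
  qed
  \<comment> \<open>The projective limit lives on the product sigma-algebra; the identity map moves
    it to \<open>seq_borel\<close>.\<close>
  define M where "M = distr IT.PF.lim (seq_borel (UNIV :: (nat \<Rightarrow> 'a) set)) (\<lambda>x. x)"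
  have idm [measurable]: "(\<lambda>x. x) \<in> measurable IT.PF.lim (seq_borel (UNIV :: (nat \<Rightarrow> 'a) set))"
  proof (rule measurable_seq_borel)
    show "(\<lambda>x. x i) \<in> measurable IT.PF.lim (count_space UNIV)" for i
      using measurable_component_singleton[of i UNIV ?M]
      by (simp add: measurable_cong_sets[OF IT.PF.sets_lim refl])
  qed simp
  have qM: "emeasure M {x. map x [0..<length w] = w} = q w" for w
  proof -
    let ?n = "length w"
    let ?X = "{x \<in> space (PiM {0..<?n} ?M). map x [0..<?n] = w}"
    have X: "?X \<in> sets (PiM {0..<?n} ?M)" by measurable
    have S: "{x. map x [0..<?n] = w} \<in> sets (seq_borel (UNIV :: (nat \<Rightarrow> 'a) set))"
      using window_measurable[of UNIV "\<lambda>v. v = w" "[0..<?n]"] by simp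
    have emb: "{x. map x [0..<?n] = w} = IT.PF.emb UNIV {0..<?n} ?X"
    proof -
      have "map (restrict x {0..<?n}) [0..<?n] = map x [0..<?n]" for x :: "nat \<Rightarrow> 'a"
        by (intro map_cong) auto
      then show ?thesis by (auto simp: prod_emb_def space_PiM simp del: restrict_apply map_eq_conv)
    qed
    have "emeasure M {x. map x [0..<?n] = w} = emeasure IT.PF.lim {x. map x [0..<?n] = w}"
      unfolding M_def using S by (subst emeasure_distr) (auto simp: space_PiM)
    also have "\<dots> = IT.CI {0..<?n} ?X"
      unfolding emb using X by (intro IT.lim) simp_all
    also have "\<dots> = IT.C 0 ?n (\<lambda>_. undefined) (IT.PF.emb {0..<?n} {0..<?n} ?X)"
      using X by (intro IT.emeasure_CI) simp_all
    also have "IT.PF.emb {0..<?n} {0..<?n} ?X = ?X"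
      by (intro prod_emb_id) (auto simp: space_PiM)
    finally show ?thesis using C by simp
  qed
  have "emeasure M (space M) = 1"
    using qM[of "[]"] by (simp add: M_def q0)
  then have "prob_space M" by (rule prob_spaceI)
  moreover have "measure M {x. map x [0..<length w] = w} = q w" for w
    using qM[of w] nonneg by (simp add: measure_def)
  ultimately show ?thesis by (intro exI[of _ M]) (simp add: M_def)
qed

section \<open>Sums over words\<close>

lemma nn_integral_eq_infsum:
  fixes f :: "'a \<Rightarrow> real"
  assumes "\<And>x. x \<in> A \<Longrightarrow> 0 \<le> f x" and "f summable_on A"
  shows "(\<integral>\<^sup>+x. ennreal (f x) \<partial>count_space A) = ennreal (infsum f A)"
proof -
  have "(\<lambda>x. norm (f x)) summable_on A"
    using assms by (auto intro: summable_on_cong[THEN iffD1, rotated])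
  then have "Infinite_Set_Sum.abs_summable_on f A" using abs_summable_equivalent by blast
  then show ?thesis
    using assms by (simp add: nn_integral_conv_infsetsum infsetsum_infsum)
qed

lemma summable_on_of_nn_integral:
  fixes f :: "'a \<Rightarrow> real"
  assumes "\<And>x. x \<in> A \<Longrightarrow> 0 \<le> f x" and "(\<integral>\<^sup>+x. ennreal (f x) \<partial>count_space A) < \<infinity>"
  shows "f summable_on A"
proof -
  have "Infinite_Set_Sum.abs_summable_on f A"
    unfolding Infinite_Set_Sum.abs_summable_on_def
  proof (rule integrableI_bounded)
    have "(\<integral>\<^sup>+x. ennreal (norm (f x)) \<partial>count_space A) = (\<integral>\<^sup>+x. ennreal (f x) \<partial>count_space A)"
      using assms(1) by (intro nn_integral_cong) auto
    then show "(\<integral>\<^sup>+x. ennreal (norm (f x)) \<partial>count_space A) < \<infinity>" using assms(2) by simp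
  qed simp
  then show ?thesis
    by (metis abs_summable_equivalent abs_summable_summable)
qed

text \<open>Iterated over letters instead of over a set of words: sums over concatenations then
  split by induction, without bijections between sets of words, and values in \<open>ennreal\<close>
  remove all summability conditions.\<close>

fun wsum :: "nat \<Rightarrow> ('a list \<Rightarrow> ennreal) \<Rightarrow> ennreal" where
  "wsum 0 f = f []"
| "wsum (Suc n) f = (\<integral>\<^sup>+e. wsum n (\<lambda>w. f (e # w)) \<partial>count_space UNIV)"

lemma wsum_mono: "(\<And>w. length w = n \<Longrightarrow> f w \<le> g w) \<Longrightarrow> wsum n f \<le> wsum n g"
  by (induction n arbitrary: f g) (auto intro!: nn_integral_mono)

lemma wsum_cong: "(\<And>w. length w = n \<Longrightarrow> f w = g w) \<Longrightarrow> wsum n f = wsum n g"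
  by (intro antisym wsum_mono) auto

lemma wsum_cmult: "wsum n (\<lambda>w. c * f w) = c * wsum n f"
  by (induction n arbitrary: f) (auto simp: nn_integral_cmult)

lemma wsum_multc: "wsum n (\<lambda>w. f w * c) = wsum n f * c"
  using wsum_cmult[of n c f] by (simp add: mult.commute)

lemma wsum_append: "wsum (m + n) f = wsum m (\<lambda>u. wsum n (\<lambda>v. f (u @ v)))"
  by (induction m arbitrary: f) auto

lemma wsum_sum: "finite I \<Longrightarrow> wsum n (\<lambda>w. \<Sum>i\<in>I. f i w) = (\<Sum>i\<in>I. wsum n (f i))"
  by (induction n arbitrary: f) (auto simp: nn_integral_sum)

lemma wsum_ge_point: "f w \<le> wsum (length w) f"
proof (induction w arbitrary: f)
  case (Cons e w)
  have "f (e # w) \<le> wsum (length w) (\<lambda>v. f (e # v))" by (rule Cons.IH)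
  also have "\<dots> \<le> wsum (length (e # w)) f"
    by (simp, rule nn_integral_ge_point) simp
  finally show ?case .
qed simp

text \<open>The link from iterated sums to measures of countable disjoint unions and to the infinite
  sum in \<open>pressure\<close>.\<close>

lemma wsum_eq_nn_integral:
  fixes f :: "'a::countable list \<Rightarrow> ennreal"
  shows "wsum n f = (\<integral>\<^sup>+w. f w \<partial>count_space {w. length w = n})"
proof (induction n arbitrary: f)
  case 0
  have "{w :: 'a list. length w = 0} = {[]}" by auto
  then show ?case by (simp add: nn_integral_count_space_finite)
next
  case (Suc n)
  have bij: "bij_betw (\<lambda>(e, w). e # w) (UNIV \<times> {w. length w = n}) {w :: 'a list. length w = Suc n}"
    by (rule bij_betw_byWitness[where f' = "\<lambda>w. (hd w, tl w)"]) (auto simp: length_Suc_conv)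
  have "(\<integral>\<^sup>+w. f w \<partial>count_space {w. length w = Suc n})
    = (\<integral>\<^sup>+p. f (case p of (e, w) \<Rightarrow> e # w) \<partial>count_space (UNIV \<times> {w. length w = n}))"
    using nn_integral_bij_count_space[OF bij, of f] by simp
  also have "count_space ((UNIV :: 'a set) \<times> {w :: 'a list. length w = n}) =
      count_space UNIV \<Otimes>\<^sub>M count_space {w. length w = n}"
    by (rule pair_measure_countable[symmetric]) (auto intro: countableI_type)
  also have "(\<integral>\<^sup>+p. f (case p of (e, w) \<Rightarrow> e # w) \<partial>(count_space UNIV \<Otimes>\<^sub>M count_space {w. length w = n}))
    = (\<integral>\<^sup>+e. \<integral>\<^sup>+w. f (e # w) \<partial>count_space {w. length w = n} \<partial>count_space UNIV)"
    by (subst sigma_finite_measure.nn_integral_fst[symmetric])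
       (auto intro!: sigma_finite_measure_count_space_countable countableI_type simp: pair_measure_countable)
  finally show ?case by (simp add: Suc.IH)
qed

section \<open>The subshift\<close>

lemma admissible_append:
  "admissible A (u @ v) \<longleftrightarrow> admissible A u \<and> admissible A v \<and> (u = [] \<or> v = [] \<or> A (last u) (hd v))"
  unfolding admissible_def by (auto simp: successively_append_iff)

lemma admissible_Nil [simp]: "admissible A []" by (simp add: admissible_def)

lemma admissible_singleton [simp]: "admissible A [a]" by (simp add: admissible_def)

lemma admissible_Cons: "admissible A (a # v) \<longleftrightarrow> admissible A v \<and> (v = [] \<or> A a (hd v))"
  using admissible_append[of A "[a]" v] by simp

lemma admissible_nth: "admissible A w \<longleftrightarrow> (\<forall>j. Suc j < length w \<longrightarrow> A (w ! j) (w ! Suc j))"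
  unfolding admissible_def successively_conv_nth by auto

lemma shift_iterate: "(shift ^^ j) \<omega> = (\<lambda>k. \<omega> (k + int j))"
  by (induction j) (auto simp: shift_def algebra_simps)

lemma shift_iterate_two_sided: "\<omega> \<in> two_sided A \<Longrightarrow> (shift ^^ j) \<omega> \<in> two_sided A"
  by (auto simp: two_sided_def shift_iterate) (metis add.commute add.left_commute)

lemma birkhoff_sum_add:
  "birkhoff_sum g (m + n) \<omega> = birkhoff_sum g m \<omega> + birkhoff_sum g n ((shift ^^ m) \<omega>)"
  by (induction n) (simp_all add: birkhoff_sum_def shift_iterate add_ac)

lemma cylinder_appendD:
  assumes "\<omega> \<in> cylinder A (u @ v)"
  shows "\<omega> \<in> cylinder A u" "(shift ^^ length u) \<omega> \<in> cylinder A v"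
proof -
  have "\<omega> (int j) = (u @ v) ! j" if "j < length u + length v" for j
    using assms that by (auto simp: cylinder_def)
  from this this[of "_ + length u"] show "\<omega> \<in> cylinder A u" "(shift ^^ length u) \<omega> \<in> cylinder A v"
    using assms shift_iterate_two_sided[of \<omega> A "length u"]
    by (auto simp: cylinder_def nth_append shift_iterate)
qed

lemma cylinder_admissible: "\<omega> \<in> cylinder A w \<Longrightarrow> admissible A w"
  unfolding admissible_nth cylinder_def two_sided_def
  by (auto, metis Suc_lessD of_nat_Suc add.commute)

locale hoelder_shift =
  fixes A :: "'e::countable \<Rightarrow> 'e \<Rightarrow> bool" and \<psi> :: "(int \<Rightarrow> 'e) \<Rightarrow> real"
  assumes irr: "finitely_irreducible A"
    and hoelder: "hoelder_potential A \<psi>"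
    and summable: "summable_potential A \<psi>"
begin

lemma succ_exists: "\<exists>b. A a b"
proof -
  obtain \<gamma> where "admissible A (a # \<gamma> @ [a])" using irr unfolding finitely_irreducible_def by blast
  then show ?thesis by (auto simp: admissible_Cons)
qed

lemma pred_exists: "\<exists>b. A b a"
proof -
  obtain \<gamma> where "admissible A (a # \<gamma> @ [a])" using irr unfolding finitely_irreducible_def by blast
  then have "admissible A ((a # \<gamma>) @ [a])" by simp
  then show ?thesis unfolding admissible_append by auto
qed

lemma extend_future:
  assumes "admissible A w"
  shows "\<exists>y\<in>one_sided A. \<forall>j<length w. y j = w ! j"
proof -
  obtain s where s: "\<And>a. A a (s a)" using succ_exists by metis
  \<comment> \<open>Past the end of the word, the successor choice \<open>s\<close> is iterated from
    the last letter; for the empty word the iteration starts at an arbitrary letter.\<close>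
  define y where "y j = (if j < length w then w ! j else (s ^^ (Suc j - length w)) (if w = [] then undefined else last w))" for j
  have "A (y j) (y (Suc j))" for j
  proof -
    consider "Suc j < length w" | "Suc j = length w" | "length w \<le> j" by linarith
    then show ?thesis
    proof cases
      case 1
      then show ?thesis using assms by (auto simp: y_def admissible_nth)
    next
      case 2
      then have "w \<noteq> []" "j = length w - 1" by auto
      then show ?thesis using s 2 by (auto simp: y_def last_conv_nth)
    next
      case 3
      then show ?thesis using s by (simp add: y_def Suc_diff_le)
    qed
  qed
  then show ?thesis by (intro bexI[of _ y]) (auto simp: one_sided_def y_def)
qed

lemma extend_past:
  assumes "y \<in> one_sided A"
  shows "\<exists>\<omega>\<in>two_sided A. \<forall>j. \<omega> (int j) = y j"
proof -
  obtain p where p: "\<And>a. A (p a) a" using pred_exists by metis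
  define \<omega> where "\<omega> k = (if 0 \<le> k then y (nat k) else (p ^^ nat (- k)) (y 0))" for k :: int
  have "A (\<omega> k) (\<omega> (k + 1))" for k
  proof -
    consider "0 \<le> k" | "k < 0" by linarith
    then show ?thesis
    proof cases
      case 1
      then have "nat (k + 1) = Suc (nat k)" by simp
      then show ?thesis using 1 assms by (auto simp: \<omega>_def one_sided_def)
    next
      case 2
      then have e: "nat (- k) = Suc (nat (- (k + 1)))" by simp
      have "\<omega> (k + 1) = (p ^^ nat (- (k + 1))) (y 0)"
        using 2 by (cases "k = -1") (auto simp: \<omega>_def)
      then show ?thesis using p 2 by (simp add: \<omega>_def e)
    qed
  qed
  then show ?thesis by (intro bexI[of _ \<omega>]) (auto simp: two_sided_def \<omega>_def)
qed

lemma cylinder_nonempty: "admissible A w \<Longrightarrow> \<exists>\<omega>. \<omega> \<in> cylinder A w"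
  using extend_future[of w] extend_past unfolding cylinder_def by fastforce

text \<open>After j shifts, the two points agree on the radius min j (n - 1 - j), the distance to
  the nearer end of the block. The Hoelder estimate thus decays geometrically away from both ends,
  and the total is bounded independently of n.\<close>

lemma distortion:
  "\<exists>\<kappa>\<ge>0. \<forall>n. \<forall>\<omega>\<in>two_sided A. \<forall>\<tau>\<in>two_sided A. (\<forall>j<n. \<omega> (int j) = \<tau> (int j)) \<longrightarrow>
     birkhoff_sum \<psi> n \<omega> \<le> birkhoff_sum \<psi> n \<tau> + \<kappa>"
proof -
  obtain \<beta> \<alpha> L where \<beta>: "0 < \<beta>" "0 < \<alpha>" "0 \<le> L"
    and h: "\<And>\<omega> \<tau>. \<omega> \<in> two_sided A \<Longrightarrow> \<tau> \<in> two_sided A \<Longrightarrow> \<omega> 0 = \<tau> 0 \<Longrightarrow>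
      \<bar>\<psi> \<omega> - \<psi> \<tau>\<bar> \<le> L * shift_dist \<beta> \<omega> \<tau> powr \<alpha>"
    using hoelder unfolding hoelder_potential_def by blast
  define \<theta> where "\<theta> = exp (- \<beta> * \<alpha>)"
  have \<theta>: "0 < \<theta>" "\<theta> < 1" using \<beta> by (auto simp: \<theta>_def)
  \<comment> \<open>One geometric series for each end of the block: the points may differ both
    before 0 and from n onwards.\<close>
  define \<kappa> where "\<kappa> = 2 * L / (1 - \<theta>)"
  have geo: "(\<Sum>j<n. \<theta> ^ j) \<le> 1 / (1 - \<theta>)" for n
    using \<theta> by (subst geometric_sum) (auto simp: field_simps)
  have "birkhoff_sum \<psi> n \<omega> \<le> birkhoff_sum \<psi> n \<tau> + \<kappa>"
    if \<omega>: "\<omega> \<in> two_sided A" and \<tau>: "\<tau> \<in> two_sided A" and eq: "\<forall>j<n. \<omega> (int j) = \<tau> (int j)" for n \<omega> \<tau>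
  proof -
    have one: "\<psi> ((shift ^^ j) \<omega>) - \<psi> ((shift ^^ j) \<tau>) \<le> L * (\<theta> ^ j + \<theta> ^ (n - Suc j))" if j: "j < n" for j
    proof -
      let ?x = "(shift ^^ j) \<omega>" and ?y = "(shift ^^ j) \<tau>"
      let ?m = "min (int j) (int n - 1 - int j)"
      have ag: "?x k = ?y k" if "\<bar>k\<bar> \<le> ?m" for k
      proof -
        have "0 \<le> k + int j" "k + int j < int n" using that by auto
        then show ?thesis using eq[rule_format, of "nat (k + int j)"] by (simp add: shift_iterate)
      qed
      have "shift_dist \<beta> ?x ?y powr \<alpha> \<le> exp (- \<beta> * of_int ?m) powr \<alpha>"
      proof (cases "?x = ?y")
        case False
        have "?m \<le> agreement ?x ?y"
          by (rule agreement_props(3)[OF False]) (use j ag in auto)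
        then have "shift_dist \<beta> ?x ?y \<le> exp (- \<beta> * of_int ?m)"
          using False \<beta> by (simp add: shift_dist_def del: of_int_min)
        then show ?thesis using \<beta> by (intro powr_mono2) (auto simp: shift_dist_def)
      qed (simp add: shift_dist_def)
      also have "exp (- \<beta> * of_int ?m) powr \<alpha> = \<theta> ^ nat ?m"
      proof -
        have "of_int i = real (nat i)" if "0 \<le> i" for i :: int using that by simp
        then have m: "of_int ?m = real (nat ?m)" using j by fastforce
        have "exp (- \<beta> * x) powr \<alpha> = exp (x * (- \<beta> * \<alpha>))" for x
          by (simp add: powr_def)
        then show ?thesis unfolding m \<theta>_def by (simp only: exp_of_nat_mult)
      qed
      also have "\<dots> \<le> \<theta> ^ j + \<theta> ^ (n - Suc j)"
      proof -
        have "nat ?m = j \<or> nat ?m = n - Suc j" using j by (auto simp: min_def)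
        then show ?thesis
          by (rule disjE; simp only:) (use \<theta> in simp_all)
      qed
      finally have *: "shift_dist \<beta> ?x ?y powr \<alpha> \<le> \<theta> ^ j + \<theta> ^ (n - Suc j)" .
      \<comment> \<open>The Hoelder condition compares only points with the same zeroth letter; j <
        n guarantees this.\<close>
      have "?x 0 = ?y 0" using ag[of 0] j by auto
      then have "\<psi> ?x - \<psi> ?y \<le> L * shift_dist \<beta> ?x ?y powr \<alpha>"
        using h[of ?x ?y] shift_iterate_two_sided \<omega> \<tau> by fastforce
      also have "\<dots> \<le> L * (\<theta> ^ j + \<theta> ^ (n - Suc j))" using * \<beta> by (intro mult_left_mono) auto
      finally show ?thesis .
    qed
    have "birkhoff_sum \<psi> n \<omega> - birkhoff_sum \<psi> n \<tau> \<le> (\<Sum>j<n. L * (\<theta> ^ j + \<theta> ^ (n - Suc j)))"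
      unfolding birkhoff_sum_def sum_subtractf[symmetric] by (intro sum_mono one) simp
    also have "\<dots> = L * ((\<Sum>j<n. \<theta> ^ j) + (\<Sum>j<n. \<theta> ^ (n - Suc j)))"
      by (simp add: sum_distrib_left[symmetric] sum.distrib)
    also have "(\<Sum>j<n. \<theta> ^ (n - Suc j)) = (\<Sum>j<n. \<theta> ^ j)" by (rule sum.nat_diff_reindex)
    also have "L * ((\<Sum>j<n. \<theta> ^ j) + (\<Sum>j<n. \<theta> ^ j)) \<le> L * (1 / (1 - \<theta>) + 1 / (1 - \<theta>))"
      using geo \<beta> by (intro mult_left_mono add_mono) auto
    also have "\<dots> = \<kappa>" by (simp add: \<kappa>_def)
    finally show ?thesis by simp
  qed
  moreover have "\<kappa> \<ge> 0" using \<beta> \<theta> by (auto simp: \<kappa>_def)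
  ultimately show ?thesis by blast
qed

end

text \<open>Estimating b (m * n) once as m blocks of length n and once as n blocks of length m shows
  that b m / m and b n / n differ by at most \<kappa> / m + \<kappa> / n. This makes the quotients
  Cauchy, and letting m tend to infinity leaves an error uniform in n, which is what turns partition
  sums into exponentials up to a constant.\<close>

lemma almost_additive_limit:
  fixes b :: "nat \<Rightarrow> real"
  assumes add: "\<And>m n. 1 \<le> m \<Longrightarrow> 1 \<le> n \<Longrightarrow> \<bar>b (m + n) - b m - b n\<bar> \<le> \<kappa>"
  shows "\<exists>P. (\<lambda>n. b n / real n) \<longlonglongrightarrow> P \<and> (\<forall>n\<ge>1. \<bar>b n - real n * P\<bar> \<le> \<kappa>)"
proof -
  have "\<bar>b (Suc k * n) - real (Suc k) * b n\<bar> \<le> real k * \<kappa>" if "1 \<le> n" for k n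
  proof (induction k)
    case (Suc k)
    have "\<bar>b (Suc k * n + n) - b (Suc k * n) - b n\<bar> \<le> \<kappa>"
      using that by (intro add) auto
    with Suc show ?case by (simp add: algebra_simps)
  qed simp
  then have mult: "\<bar>b (k * n) - real k * b n\<bar> \<le> real k * \<kappa>" if "1 \<le> n" "1 \<le> k" for k n
  proof -
    obtain j where j: "k = Suc j" using \<open>1 \<le> k\<close> by (cases k) auto
    have "\<kappa> \<ge> 0" using add[of 1 1] by linarith
    then have "real j * \<kappa> \<le> real k * \<kappa>" by (simp add: j mult_right_mono)
    with \<open>\<And>n k. 1 \<le> n \<Longrightarrow> \<bar>b (Suc k * n) - real (Suc k) * b n\<bar> \<le> real k * \<kappa>\<close>[OF \<open>1 \<le> n\<close>, of j] j
    show ?thesis by simp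
  qed
  have close: "\<bar>b m / real m - b n / real n\<bar> \<le> \<kappa> / real m + \<kappa> / real n" if "1 \<le> m" "1 \<le> n" for m n
  proof -
    have "\<bar>real n * b m - real m * b n\<bar> \<le> real n * \<kappa> + real m * \<kappa>"
      using mult[OF that] mult[OF that(2,1)] by (simp add: mult.commute[of m n])
    then have "\<bar>real n * b m - real m * b n\<bar> / (real m * real n) \<le> (real n * \<kappa> + real m * \<kappa>) / (real m * real n)"
      by (intro divide_right_mono) auto
    moreover have "\<bar>real n * b m - real m * b n\<bar> / (real m * real n) = \<bar>b m / real m - b n / real n\<bar>"
    proof -
      have "b m / real m - b n / real n = (real n * b m - real m * b n) / (real m * real n)"
        using that by (simp add: field_simps)
      then show ?thesis by (simp add: abs_mult)
    qed
    moreover have "(real n * \<kappa> + real m * \<kappa>) / (real m * real n) = \<kappa> / real m + \<kappa> / real n"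
      using that by (simp add: field_simps)
    ultimately show ?thesis by simp
  qed
  have k0: "(\<lambda>n. \<kappa> / real n) \<longlonglongrightarrow> 0" by (rule lim_const_over_n)
  have "Cauchy (\<lambda>n. b n / real n)"
  proof (rule CauchyI)
    fix e :: real assume "0 < e"
    then have "\<forall>\<^sub>F n in sequentially. \<kappa> / real n < e / 2"
      by (intro order_tendstoD(2)[OF k0]) simp
    then obtain N where N: "\<And>n. n \<ge> N \<Longrightarrow> \<kappa> / real n < e / 2" by (auto simp: eventually_sequentially)
    show "\<exists>M. \<forall>m\<ge>M. \<forall>n\<ge>M. norm (b m / real m - b n / real n) < e"
    proof (intro exI[of _ "max N 1"] allI impI)
      fix m n assume "max N 1 \<le> m" "max N 1 \<le> n"
      then have "\<bar>b m / real m - b n / real n\<bar> \<le> \<kappa> / real m + \<kappa> / real n"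
        "\<kappa> / real m < e / 2" "\<kappa> / real n < e / 2"
        using close[of m n] N[of m] N[of n] by auto
      then show "norm (b m / real m - b n / real n) < e"
        unfolding real_norm_def by linarith
    qed
  qed
  then obtain P where P: "(\<lambda>n. b n / real n) \<longlonglongrightarrow> P"
    using Cauchy_convergent convergent_def by blast
  have "\<bar>b n - real n * P\<bar> \<le> \<kappa>" if n: "1 \<le> n" for n
  proof -
    have "\<bar>b n / real n - P\<bar> \<le> \<kappa> / real n + 0"
    proof (rule LIMSEQ_le)
      show "(\<lambda>m. \<bar>b n / real n - b m / real m\<bar>) \<longlonglongrightarrow> \<bar>b n / real n - P\<bar>"
        by (intro tendsto_intros P)
      show "(\<lambda>m. \<kappa> / real n + \<kappa> / real m) \<longlonglongrightarrow> \<kappa> / real n + 0"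
        by (intro tendsto_intros k0)
      show "\<exists>N. \<forall>m\<ge>N. \<bar>b n / real n - b m / real m\<bar> \<le> \<kappa> / real n + \<kappa> / real m"
        using close n by blast
    qed
    then have "real n * \<bar>b n / real n - P\<bar> \<le> real n * (\<kappa> / real n)" by (intro mult_left_mono) auto
    moreover have "real n * \<bar>b n / real n - P\<bar> = \<bar>b n - real n * P\<bar>"
    proof -
      have "b n - real n * P = real n * (b n / real n - P)" using n by (simp add: field_simps)
      then show ?thesis by (simp add: abs_mult)
    qed
    ultimately show ?thesis using n by simp
  qed
  with P show ?thesis by blast
qed

context hoelder_shift
begin

section \<open>Weights of words\<close>

definition distortion_const :: real where
  "distortion_const = (SOME \<kappa>. \<kappa> \<ge> 0 \<and> (\<forall>n. \<forall>\<omega>\<in>two_sided A. \<forall>\<tau>\<in>two_sided A.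
     (\<forall>j<n. \<omega> (int j) = \<tau> (int j)) \<longrightarrow> birkhoff_sum \<psi> n \<omega> \<le> birkhoff_sum \<psi> n \<tau> + \<kappa>))"

lemma distortion_const:
  "distortion_const \<ge> 0"
  "\<lbrakk>\<omega> \<in> two_sided A; \<tau> \<in> two_sided A; \<And>j. j < n \<Longrightarrow> \<omega> (int j) = \<tau> (int j)\<rbrakk>
    \<Longrightarrow> birkhoff_sum \<psi> n \<omega> \<le> birkhoff_sum \<psi> n \<tau> + distortion_const"
  using someI_ex[OF distortion[unfolded Bex_def]] unfolding distortion_const_def[symmetric] Bex_def[symmetric] by auto

text \<open>Two factors exp \<open>distortion_const\<close>: the weights of two adjacent words are
  both compared with Birkhoff sums along one common point.\<close>

definition K :: real where "K = exp (2 * distortion_const)"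

lemma K_ge_1: "1 \<le> K" using distortion_const(1) by (simp add: K_def)

text \<open>The value 0 lets sums run over all words of a given length. On admissible words the
  cylinder is nonempty and distortion bounds the Birkhoff sums there, so the supremum is
  genuine.\<close>

definition wt :: "'e list \<Rightarrow> real" where
  "wt w = (if admissible A w then exp (SUP \<omega>\<in>cylinder A w. birkhoff_sum \<psi> (length w) \<omega>) else 0)"

lemma wt_nonneg [simp]: "0 \<le> wt w" by (simp add: wt_def)

lemma wt_pos_iff [simp]: "0 < wt w \<longleftrightarrow> admissible A w" by (simp add: wt_def)

lemma wt_eq_0 [simp]: "\<not> admissible A w \<Longrightarrow> wt w = 0" by (simp add: wt_def)

lemma
  assumes \<omega>: "\<omega> \<in> cylinder A w"
  shows wt_lower: "exp (birkhoff_sum \<psi> (length w) \<omega>) \<le> wt w"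
    and wt_upper': "wt w \<le> exp distortion_const * exp (birkhoff_sum \<psi> (length w) \<omega>)"
    and wt_upper: "wt w \<le> K * exp (birkhoff_sum \<psi> (length w) \<omega>)"
proof -
  let ?S = "birkhoff_sum \<psi> (length w)"
  have bd: "?S \<tau> \<le> ?S \<omega> + distortion_const" if "\<tau> \<in> cylinder A w" for \<tau>
    using that \<omega> by (intro distortion_const) (auto simp: cylinder_def)
  then have "bdd_above (?S ` cylinder A w)" by (auto intro!: bdd_aboveI2)
  then have "?S \<omega> \<le> (SUP \<omega>\<in>cylinder A w. ?S \<omega>)" using \<omega> by (intro cSUP_upper) auto
  then show "exp (?S \<omega>) \<le> wt w" using cylinder_admissible[OF \<omega>] by (simp add: wt_def)
  have "(SUP \<omega>\<in>cylinder A w. ?S \<omega>) \<le> ?S \<omega> + distortion_const" using \<omega> bd by (intro cSUP_least) auto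
  then show u: "wt w \<le> exp distortion_const * exp (?S \<omega>)"
    using cylinder_admissible[OF \<omega>] by (simp add: wt_def exp_add[symmetric] add.commute)
  show "wt w \<le> K * exp (?S \<omega>)"
    by (rule order_trans[OF u]) (use distortion_const(1) in \<open>simp add: K_def\<close>)
qed

lemma wt_Nil [simp]: "wt [] = 1"
proof -
  have "cylinder A [] \<noteq> {}" using cylinder_nonempty[of "[]"] by auto
  then show ?thesis by (simp add: wt_def birkhoff_sum_def)
qed

lemma wt_append_le: "wt (u @ v) \<le> wt u * wt v"
proof (cases "admissible A (u @ v)")
  case True
  then have adm: "admissible A u" "admissible A v" by (auto simp: admissible_append)
  have "birkhoff_sum \<psi> (length (u @ v)) \<omega> \<le> ln (wt u * wt v)" if \<omega>: "\<omega> \<in> cylinder A (u @ v)" for \<omega>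
  proof -
    have "exp (birkhoff_sum \<psi> (length (u @ v)) \<omega>) =
      exp (birkhoff_sum \<psi> (length u) \<omega>) * exp (birkhoff_sum \<psi> (length v) ((shift ^^ length u) \<omega>))"
      by (simp add: birkhoff_sum_add exp_add)
    also have "\<dots> \<le> wt u * wt v"
      using cylinder_appendD[OF \<omega>] by (intro mult_mono wt_lower) auto
    finally show ?thesis using adm by (subst ln_ge_iff) auto
  qed
  then have "(SUP \<omega>\<in>cylinder A (u @ v). birkhoff_sum \<psi> (length (u @ v)) \<omega>) \<le> ln (wt u * wt v)"
    using cylinder_nonempty[OF True] by (intro cSUP_least) auto
  then have "exp (SUP \<omega>\<in>cylinder A (u @ v). birkhoff_sum \<psi> (length (u @ v)) \<omega>) \<le> exp (ln (wt u * wt v))"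
    by simp
  then show ?thesis using True adm by (simp add: wt_def)
qed simp

text \<open>A point of the joint cylinder lies in the first cylinder and is shifted into the second,
  and each weight is at most one distortion factor above the exponential of the Birkhoff sum there.
  Admissibility of the junction is what provides the point.\<close>

lemma wt_append_ge:
  assumes "admissible A (u @ v)"
  shows "wt u * wt v \<le> K * wt (u @ v)"
proof -
  obtain \<omega> where \<omega>: "\<omega> \<in> cylinder A (u @ v)" using cylinder_nonempty[OF assms] by blast
  note c = cylinder_appendD[OF \<omega>]
  have "wt u * wt v \<le> (exp distortion_const * exp (birkhoff_sum \<psi> (length u) \<omega>)) *
      (exp distortion_const * exp (birkhoff_sum \<psi> (length v) ((shift ^^ length u) \<omega>)))"
    using c by (intro mult_mono wt_upper') auto
  also have "\<dots> = K * exp (birkhoff_sum \<psi> (length (u @ v)) \<omega>)"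
    by (simp add: K_def birkhoff_sum_add exp_add[symmetric])
  also have "\<dots> \<le> K * wt (u @ v)"
    using wt_lower[OF \<omega>] K_ge_1 by (intro mult_left_mono) auto
  finally show ?thesis .
qed

section \<open>Partition sums\<close>

abbreviation ewt :: "'e list \<Rightarrow> ennreal" where "ewt w \<equiv> ennreal (wt w)"

definition Ze :: "nat \<Rightarrow> ennreal" where "Ze n = wsum n ewt"

lemma ewt_append_le: "ewt (u @ v) \<le> ewt u * ewt v"
  using wt_append_le by (simp add: ennreal_mult[symmetric] ennreal_leI)

lemma ewt_append_ge: "admissible A (u @ v) \<Longrightarrow> ewt u * ewt v \<le> ennreal K * ewt (u @ v)"
  using wt_append_ge K_ge_1 by (simp add: ennreal_mult[symmetric] ennreal_leI)

lemma Ze_add_le: "Ze (m + n) \<le> Ze m * Ze n"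
proof -
  have "Ze (m + n) = wsum m (\<lambda>u. wsum n (\<lambda>v. ewt (u @ v)))" by (simp add: Ze_def wsum_append)
  also have "\<dots> \<le> wsum m (\<lambda>u. wsum n (\<lambda>v. ewt u * ewt v))"
    by (intro wsum_mono ewt_append_le)
  also have "\<dots> = Ze m * Ze n" by (simp add: wsum_cmult wsum_multc Ze_def)
  finally show ?thesis .
qed

text \<open>Summability of the potential enters here; submultiplicativity then carries finiteness to
  all lengths.\<close>

lemma Ze_1_finite: "Ze (Suc 0) < \<infinity>"
proof -
  have eq: "wt [e] = exp (SUP \<omega>\<in>cylinder A [e]. \<psi> \<omega>)" for e
    by (simp add: wt_def birkhoff_sum_def)
  have "(\<lambda>e. wt [e]) summable_on UNIV"
    using summable by (simp add: summable_potential_def eq)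
  then have "Ze (Suc 0) = ennreal (\<Sum>\<^sub>\<infinity>e. wt [e])"
    by (simp add: Ze_def nn_integral_eq_infsum)
  then show ?thesis by simp
qed

lemma Ze_finite [simp]: "Ze n < \<infinity>"
proof (induction n)
  case (Suc n)
  have "Ze (n + Suc 0) \<le> Ze n * Ze (Suc 0)" by (rule Ze_add_le)
  also have "\<dots> < \<infinity>" using Suc Ze_1_finite by (simp add: ennreal_mult_less_top)
  finally show ?case by simp
qed (simp add: Ze_def)

lemma Ze_pos [simp]: "0 < Ze n"
proof -
  have "\<exists>w. length w = n \<and> admissible A w"
  proof -
    obtain y where y: "y \<in> one_sided A" using extend_future[of "[]"] by auto
    then show ?thesis
      by (intro exI[of _ "map y [0..<n]"]) (auto simp: admissible_nth one_sided_def)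
  qed
  then obtain w where w: "length w = n" "admissible A w" by blast
  then have "0 < ewt w" by simp
  also have "\<dots> \<le> Ze n" unfolding Ze_def using wsum_ge_point[of ewt w] w by simp
  finally show ?thesis .
qed

definition Z :: "nat \<Rightarrow> real" where "Z n = enn2real (Ze n)"

lemma Z_pos [simp]: "0 < Z n"
  using Ze_pos[of n] Ze_finite[of n] by (simp add: Z_def enn2real_positive_iff)

lemma Ze_eq: "Ze n = ennreal (Z n)"
  using Ze_finite[of n] by (simp add: Z_def less_top)

lemma Z_add_le: "Z (m + n) \<le> Z m * Z n"
  using Ze_add_le[of m n] Z_pos[of m] Z_pos[of n] by (simp add: Ze_eq ennreal_mult[symmetric] less_imp_le)

lemma connecting_words:
  obtains \<Phi> :: "'e list set" where "finite \<Phi>" "\<And>\<gamma>. \<gamma> \<in> \<Phi> \<Longrightarrow> admissible A \<gamma>"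
    "\<And>a b. \<exists>\<gamma>\<in>\<Phi>. admissible A (a # \<gamma> @ [b])"
  using irr unfolding finitely_irreducible_def by blast

text \<open>Irreducibility yields connecting words of varying lengths; the length \<open>s\<close> is restored by
  dropping as many letters at the other end.\<close>

lemma Ze_le_sum_to:
  "\<exists>l C. 0 \<le> C \<and> (\<forall>s>l. \<forall>b. Ze s \<le> ennreal C * wsum s (\<lambda>u. if admissible A (u @ [b]) then ewt u else 0))"
proof -
  obtain \<Phi> where \<Phi>: "finite \<Phi>" "\<And>\<gamma>. \<gamma> \<in> \<Phi> \<Longrightarrow> admissible A \<gamma>"
    "\<And>a b. \<exists>\<gamma>\<in>\<Phi>. admissible A (a # \<gamma> @ [b])" by (rule connecting_words) blast
  define l where "l = (\<Sum>\<gamma>\<in>\<Phi>. length \<gamma>)"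
  \<comment> \<open>For each connecting word, the dropped letters sum to
    \<open>Z (length \<gamma>)\<close>, and \<open>K / wt \<gamma>\<close> is the price of attaching
    \<gamma>.\<close>
  define C where "C = (\<Sum>\<gamma>\<in>\<Phi>. Z (length \<gamma>) * (K / wt \<gamma>))"
  have l: "length \<gamma> \<le> l" if "\<gamma> \<in> \<Phi>" for \<gamma>
    unfolding l_def using that \<Phi>(1) by (intro member_le_sum) auto
  have C_nonneg: "0 \<le> Z (length \<gamma>) * (K / wt \<gamma>)" for \<gamma>
    using K_ge_1 Z_pos[of "length \<gamma>"] by (intro mult_nonneg_nonneg) (auto simp: less_imp_le)
  have "Ze s \<le> ennreal C * wsum s (\<lambda>u. if admissible A (u @ [b]) then ewt u else 0)" if s: "l < s" for s b
  proof -
    define g where "g u = (if admissible A (u @ [b]) then ewt u else 0)" for u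
    have one: "wsum s (\<lambda>u. if admissible A (u @ \<gamma> @ [b]) then ewt u else 0)
        \<le> ennreal (Z (length \<gamma>) * (K / wt \<gamma>)) * wsum s g" if \<gamma>: "\<gamma> \<in> \<Phi>" for \<gamma>
    proof -
      define k where "k = length \<gamma>"
      have k: "k < s" using l[OF \<gamma>] s by (simp add: k_def)
      \<comment> \<open>Write u = u1 u2 with u1 as long as \<gamma>. Dropping u1 and adding \<gamma>
        gives u2 \<gamma>, again of length s and now allowed before b.\<close>
      have *: "(if admissible A ((u1 @ u2) @ \<gamma> @ [b]) then ewt (u1 @ u2) else 0)
          \<le> ewt u1 * (ennreal (K / wt \<gamma>) * g (u2 @ \<gamma>))" for u1 u2
      proof (cases "admissible A (u1 @ u2 @ \<gamma> @ [b])")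
        case True
        then have a: "admissible A (u2 @ \<gamma> @ [b])" "admissible A (u2 @ \<gamma>)"
          using admissible_append[of A u1 "u2 @ \<gamma> @ [b]"] admissible_append[of A "u2 @ \<gamma>" "[b]"] by auto
        have "wt (u1 @ u2) \<le> wt u1 * wt u2" by (rule wt_append_le)
        also have "wt u2 \<le> K / wt \<gamma> * wt (u2 @ \<gamma>)"
          using wt_append_ge[OF a(2)] \<Phi>(2)[OF \<gamma>] by (simp add: field_simps)
        finally have "wt (u1 @ u2) \<le> wt u1 * (K / wt \<gamma> * wt (u2 @ \<gamma>))" by (simp add: mult_left_mono)
        then show ?thesis using True a K_ge_1
          by (simp add: g_def ennreal_mult[symmetric] ennreal_leI)
      qed simp
      have "wsum s (\<lambda>u. if admissible A (u @ \<gamma> @ [b]) then ewt u else 0)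
        = wsum (k + (s - k)) (\<lambda>u. if admissible A (u @ \<gamma> @ [b]) then ewt u else 0)" using k by simp
      also have "\<dots> \<le> wsum k (\<lambda>u1. wsum (s - k) (\<lambda>u2. ewt u1 * (ennreal (K / wt \<gamma>) * g (u2 @ \<gamma>))))"
        unfolding wsum_append by (intro wsum_mono *)
      also have "\<dots> = Ze k * (ennreal (K / wt \<gamma>) * wsum (s - k) (\<lambda>u2. g (u2 @ \<gamma>)))"
        by (simp add: wsum_cmult wsum_multc Ze_def)
      \<comment> \<open>The fixed suffix \<gamma> is one term in the sum over all suffixes of its
        length.\<close>
      also have "wsum (s - k) (\<lambda>u2. g (u2 @ \<gamma>)) \<le> wsum (s - k) (\<lambda>u2. wsum k (\<lambda>v. g (u2 @ v)))"
        unfolding k_def by (intro wsum_mono wsum_ge_point)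
      also have "\<dots> = wsum s g" using k by (simp add: wsum_append[symmetric])
      finally show ?thesis using K_ge_1 Z_pos[of k]
        by (simp add: k_def[symmetric] Ze_eq ennreal_mult[symmetric] mult.assoc[symmetric] mult_left_mono less_imp_le)
    qed
    have "Ze s \<le> wsum s (\<lambda>u. \<Sum>\<gamma>\<in>\<Phi>. if admissible A (u @ \<gamma> @ [b]) then ewt u else 0)"
      unfolding Ze_def
    proof (rule wsum_mono)
      fix u :: "'e list" assume "length u = s"
      then have "u \<noteq> []" using s by auto
      show "ewt u \<le> (\<Sum>\<gamma>\<in>\<Phi>. if admissible A (u @ \<gamma> @ [b]) then ewt u else 0)"
      proof (cases "admissible A u")
        case True
        obtain \<gamma> where \<gamma>: "\<gamma> \<in> \<Phi>" "admissible A (last u # \<gamma> @ [b])" using \<Phi>(3) by blast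
        then have "admissible A (u @ \<gamma> @ [b])"
          using True by (auto simp: admissible_append[of A u] admissible_Cons)
        then have "ewt u = (if admissible A (u @ \<gamma> @ [b]) then ewt u else 0)" by simp
        also have "\<dots> \<le> (\<Sum>\<gamma>\<in>\<Phi>. if admissible A (u @ \<gamma> @ [b]) then ewt u else 0)"
          using \<gamma> \<Phi>(1) by (intro member_le_sum) auto
        finally show ?thesis .
      qed simp
    qed
    also have "\<dots> = (\<Sum>\<gamma>\<in>\<Phi>. wsum s (\<lambda>u. if admissible A (u @ \<gamma> @ [b]) then ewt u else 0))"
      by (rule wsum_sum[OF \<Phi>(1)])
    also have "\<dots> \<le> (\<Sum>\<gamma>\<in>\<Phi>. ennreal (Z (length \<gamma>) * (K / wt \<gamma>)) * wsum s g)"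
      by (intro sum_mono one)
    also have "\<dots> = ennreal C * wsum s g"
      using C_nonneg by (simp add: C_def sum_distrib_right[symmetric] sum_ennreal)
    finally show ?thesis unfolding g_def .
  qed
  moreover have "0 \<le> C" unfolding C_def by (intro sum_nonneg C_nonneg)
  ultimately show ?thesis by blast
qed

text \<open>Mirror image of \<open>Ze_le_sum_to\<close>: \<gamma> is put in front and as many
  letters are dropped at the end.\<close>

lemma Ze_le_sum_from:
  "\<exists>l C. 0 \<le> C \<and> (\<forall>s>l. \<forall>b. Ze s \<le> ennreal C * wsum s (\<lambda>u. if admissible A (b # u) then ewt u else 0))"
proof -
  obtain \<Phi> where \<Phi>: "finite \<Phi>" "\<And>\<gamma>. \<gamma> \<in> \<Phi> \<Longrightarrow> admissible A \<gamma>"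
    "\<And>a b. \<exists>\<gamma>\<in>\<Phi>. admissible A (a # \<gamma> @ [b])" by (rule connecting_words) blast
  define l where "l = (\<Sum>\<gamma>\<in>\<Phi>. length \<gamma>)"
  define C where "C = (\<Sum>\<gamma>\<in>\<Phi>. Z (length \<gamma>) * (K / wt \<gamma>))"
  have l: "length \<gamma> \<le> l" if "\<gamma> \<in> \<Phi>" for \<gamma>
    unfolding l_def using that \<Phi>(1) by (intro member_le_sum) auto
  have C_nonneg: "0 \<le> Z (length \<gamma>) * (K / wt \<gamma>)" for \<gamma>
    using K_ge_1 Z_pos[of "length \<gamma>"] by (intro mult_nonneg_nonneg) (auto simp: less_imp_le)
  have "Ze s \<le> ennreal C * wsum s (\<lambda>u. if admissible A (b # u) then ewt u else 0)" if s: "l < s" for s b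
  proof -
    define g where "g u = (if admissible A (b # u) then ewt u else 0)" for u
    have one: "wsum s (\<lambda>u. if admissible A (b # \<gamma> @ u) then ewt u else 0)
        \<le> ennreal (Z (length \<gamma>) * (K / wt \<gamma>)) * wsum s g" if \<gamma>: "\<gamma> \<in> \<Phi>" for \<gamma>
    proof -
      define k where "k = length \<gamma>"
      have k: "k < s" using l[OF \<gamma>] s by (simp add: k_def)
      have *: "(if admissible A (b # \<gamma> @ u2 @ u1) then ewt (u2 @ u1) else 0)
          \<le> ennreal (K / wt \<gamma>) * g (\<gamma> @ u2) * ewt u1" for u1 u2
      proof (cases "admissible A (b # \<gamma> @ u2 @ u1)")
        case True
        then have a: "admissible A (b # \<gamma> @ u2)" "admissible A (\<gamma> @ u2)"
          using admissible_append[of A "b # \<gamma> @ u2" u1] by (auto simp: admissible_Cons)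
        have "wt (u2 @ u1) \<le> wt u2 * wt u1" by (rule wt_append_le)
        also have "wt u2 \<le> K / wt \<gamma> * wt (\<gamma> @ u2)"
          using wt_append_ge[OF a(2)] \<Phi>(2)[OF \<gamma>] by (simp add: field_simps)
        finally have "wt (u2 @ u1) \<le> K / wt \<gamma> * wt (\<gamma> @ u2) * wt u1" by (simp add: mult_right_mono)
        then show ?thesis using True a K_ge_1
          by (simp add: g_def ennreal_mult[symmetric] ennreal_leI)
      qed simp
      have "wsum s (\<lambda>u. if admissible A (b # \<gamma> @ u) then ewt u else 0)
        = wsum ((s - k) + k) (\<lambda>u. if admissible A (b # \<gamma> @ u) then ewt u else 0)" using k by simp
      also have "\<dots> \<le> wsum (s - k) (\<lambda>u2. wsum k (\<lambda>u1. ennreal (K / wt \<gamma>) * g (\<gamma> @ u2) * ewt u1))"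
        unfolding wsum_append by (intro wsum_mono *)
      also have "\<dots> = Ze k * (ennreal (K / wt \<gamma>) * wsum (s - k) (\<lambda>u2. g (\<gamma> @ u2)))"
        by (simp add: wsum_cmult wsum_multc Ze_def mult.commute)
      also have "wsum (s - k) (\<lambda>u2. g (\<gamma> @ u2)) \<le> wsum k (\<lambda>v. wsum (s - k) (\<lambda>u2. g (v @ u2)))"
        unfolding k_def by (rule wsum_ge_point)
      also have "\<dots> = wsum s g" using k by (simp add: wsum_append[symmetric])
      finally show ?thesis using K_ge_1 Z_pos[of k]
        by (simp add: k_def[symmetric] Ze_eq ennreal_mult[symmetric] mult.assoc[symmetric] mult_left_mono less_imp_le)
    qed
    have "Ze s \<le> wsum s (\<lambda>u. \<Sum>\<gamma>\<in>\<Phi>. if admissible A (b # \<gamma> @ u) then ewt u else 0)"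
      unfolding Ze_def
    proof (rule wsum_mono)
      fix u :: "'e list" assume "length u = s"
      then have ne: "u \<noteq> []" using s by auto
      show "ewt u \<le> (\<Sum>\<gamma>\<in>\<Phi>. if admissible A (b # \<gamma> @ u) then ewt u else 0)"
      proof (cases "admissible A u")
        case True
        obtain \<gamma> where \<gamma>: "\<gamma> \<in> \<Phi>" "admissible A (b # \<gamma> @ [hd u])" using \<Phi>(3) by blast
        have "admissible A ((b # \<gamma>) @ u)"
          using True \<gamma>(2) ne admissible_append[of A "b # \<gamma>" u] admissible_append[of A "b # \<gamma>" "[hd u]"] by simp
        then have "ewt u = (if admissible A (b # \<gamma> @ u) then ewt u else 0)" by simp
        also have "\<dots> \<le> (\<Sum>\<gamma>\<in>\<Phi>. if admissible A (b # \<gamma> @ u) then ewt u else 0)"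
          using \<gamma> \<Phi>(1) by (intro member_le_sum) auto
        finally show ?thesis .
      qed simp
    qed
    also have "\<dots> = (\<Sum>\<gamma>\<in>\<Phi>. wsum s (\<lambda>u. if admissible A (b # \<gamma> @ u) then ewt u else 0))"
      by (rule wsum_sum[OF \<Phi>(1)])
    also have "\<dots> \<le> (\<Sum>\<gamma>\<in>\<Phi>. ennreal (Z (length \<gamma>) * (K / wt \<gamma>)) * wsum s g)"
      by (intro sum_mono one)
    also have "\<dots> = ennreal C * wsum s g"
      using C_nonneg by (simp add: C_def sum_distrib_right[symmetric] sum_ennreal)
    finally show ?thesis unfolding g_def .
  qed
  moreover have "0 \<le> C" unfolding C_def by (intro sum_nonneg C_nonneg)
  ultimately show ?thesis by blast
qed

end

lemma wsum_delta: "wsum (length v) (\<lambda>w. if w = v then f w else 0) = f v"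
proof (induction v arbitrary: f)
  case (Cons e v)
  have "wsum (length (e # v)) (\<lambda>w. if w = e # v then f w else 0)
    = (\<integral>\<^sup>+a. wsum (length v) (\<lambda>w. if w = v then (if a = e then f (e # w) else 0) else 0) \<partial>count_space UNIV)"
    by (auto intro!: nn_integral_cong wsum_cong)
  also have "\<dots> = (\<integral>\<^sup>+a. f (e # v) * indicator {e} a \<partial>count_space UNIV)"
    by (intro nn_integral_cong) (auto simp: Cons.IH split: split_indicator)
  also have "\<dots> = f (e # v)" by (subst nn_integral_cmult_indicator) auto
  finally show ?case .
qed simp

section \<open>Uniform gaps and almost multiplicative partition sums\<close>

context hoelder_shift
begin

text \<open>Beyond the length l, a proportion of at least 1 / C of the partition sum comes from
  words that can precede b, and likewise from words that can follow b. The constants are uniform in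
  b although the alphabet may be infinite.\<close>

definition gap_bound :: "nat \<Rightarrow> real \<Rightarrow> bool" where
  "gap_bound l C \<longleftrightarrow> 1 \<le> C \<and> (\<forall>s>l. \<forall>b.
     Ze s \<le> ennreal C * wsum s (\<lambda>u. if admissible A (u @ [b]) then ewt u else 0) \<and>
     Ze s \<le> ennreal C * wsum s (\<lambda>u. if admissible A (b # u) then ewt u else 0))"

lemma gap_bound_exists: "\<exists>p. gap_bound (fst p) (snd p)"
proof -
  obtain l C where 1: "0 \<le> C" "\<And>s b. s > l \<Longrightarrow> Ze s \<le> ennreal C * wsum s (\<lambda>u. if admissible A (u @ [b]) then ewt u else 0)"
    using Ze_le_sum_to by blast
  obtain l' C' where 2: "0 \<le> C'" "\<And>s b. s > l' \<Longrightarrow> Ze s \<le> ennreal C' * wsum s (\<lambda>u. if admissible A (b # u) then ewt u else 0)"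
    using Ze_le_sum_from by blast
  have "gap_bound (max l l') (max 1 (max C C'))"
    unfolding gap_bound_def
  proof (intro conjI allI impI)
    fix s b assume s: "max l l' < s"
    have "ennreal C \<le> ennreal (max 1 (max C C'))" "ennreal C' \<le> ennreal (max 1 (max C C'))"
      by (intro ennreal_leI; simp)+
    then show "Ze s \<le> ennreal (max 1 (max C C')) * wsum s (\<lambda>u. if admissible A (u @ [b]) then ewt u else 0)"
      "Ze s \<le> ennreal (max 1 (max C C')) * wsum s (\<lambda>u. if admissible A (b # u) then ewt u else 0)"
      using order_trans[OF 1(2)[of s b] mult_right_mono] order_trans[OF 2(2)[of s b] mult_right_mono] s by auto
  qed simp
  then show ?thesis by (intro exI[of _ "(max l l', max 1 (max C C'))"]) simp
qed

definition gap :: nat where "gap = fst (SOME p. gap_bound (fst p) (snd p))"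
definition gap_const :: real where "gap_const = snd (SOME p. gap_bound (fst p) (snd p))"

lemma
  shows gap_const_ge_1: "1 \<le> gap_const"
    and Ze_gap_to: "gap < s \<Longrightarrow> Ze s \<le> ennreal gap_const * wsum s (\<lambda>u. if admissible A (u @ [b]) then ewt u else 0)"
    and Ze_gap_from: "gap < s \<Longrightarrow> Ze s \<le> ennreal gap_const * wsum s (\<lambda>u. if admissible A (b # u) then ewt u else 0)"
proof -
  have "gap_bound gap gap_const"
    unfolding gap_def gap_const_def by (rule someI_ex[OF gap_bound_exists])
  then show "1 \<le> gap_const"
    "gap < s \<Longrightarrow> Ze s \<le> ennreal gap_const * wsum s (\<lambda>u. if admissible A (u @ [b]) then ewt u else 0)"
    "gap < s \<Longrightarrow> Ze s \<le> ennreal gap_const * wsum s (\<lambda>u. if admissible A (b # u) then ewt u else 0)"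
    unfolding gap_bound_def by blast+
qed

lemma Z_nonzero [simp]: "Z n \<noteq> 0" and Z_nonneg [simp]: "0 \<le> Z n"
  by (rule less_imp_neq[OF Z_pos, symmetric], rule less_imp_le[OF Z_pos])

text \<open>Restricting the left word to those that can precede v and the right word to those that
  can follow v costs \<open>gap_const\<close> each, and the two junctions cost a factor K
  each.\<close>

lemma three_words:
  assumes v: "v \<noteq> []" "admissible A v" and st: "gap < s" "gap < t"
  shows "ewt v * (Ze s * Ze t) \<le> ennreal (gap_const ^ 2 * K ^ 2) * wsum s (\<lambda>u. wsum t (\<lambda>u'. ewt (u @ v @ u')))"
proof -
  let ?f = "\<lambda>u. if admissible A (u @ [hd v]) then ewt u else 0"
  let ?g = "\<lambda>u. if admissible A (last v # u) then ewt u else 0"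
  have *: "?f u * ewt v * ?g u' \<le> ennreal (K ^ 2) * ewt (u @ v @ u')"
    if "length u = s" "length u' = t" for u u'
  proof (cases "admissible A (u @ [hd v]) \<and> admissible A (last v # u')")
    case True
    have ne: "u \<noteq> []" "u' \<noteq> []" using that st by auto
    have a: "admissible A (u @ v @ u')" "admissible A (v @ u')"
      using True v ne by (auto simp: admissible_append admissible_Cons)
    have "wt u * wt v * wt u' = wt u * (wt v * wt u')" by simp
    also have "\<dots> \<le> wt u * (K * wt (v @ u'))" by (intro mult_left_mono wt_append_ge a) simp
    also have "\<dots> = K * (wt u * wt (v @ u'))" by simp
    also have "\<dots> \<le> K * (K * wt (u @ v @ u'))" using K_ge_1 by (intro mult_left_mono wt_append_ge a) simp
    also have "\<dots> = K ^ 2 * wt (u @ v @ u')" by (simp add: power2_eq_square)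
    finally show ?thesis using True K_ge_1 by (simp add: ennreal_mult[symmetric] ennreal_leI)
  qed auto
  have "ewt v * (Ze s * Ze t) \<le> ewt v * ((ennreal gap_const * wsum s ?f) * (ennreal gap_const * wsum t ?g))"
    by (intro mult_left_mono mult_mono Ze_gap_to Ze_gap_from st) auto
  also have "\<dots> = ennreal (gap_const ^ 2) * wsum s (\<lambda>u. wsum t (\<lambda>u'. ?f u * ewt v * ?g u'))"
    using gap_const_ge_1 by (simp add: wsum_cmult wsum_multc power2_eq_square ennreal_mult mult_ac)
  also have "\<dots> \<le> ennreal (gap_const ^ 2) * wsum s (\<lambda>u. wsum t (\<lambda>u'. ennreal (K ^ 2) * ewt (u @ v @ u')))"
    by (intro mult_left_mono wsum_mono *) auto
  also have "\<dots> = ennreal (gap_const ^ 2 * K ^ 2) * wsum s (\<lambda>u. wsum t (\<lambda>u'. ewt (u @ v @ u')))"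
    using K_ge_1 by (simp add: wsum_cmult ennreal_mult mult_ac)
  finally show ?thesis .
qed

text \<open>For each u, the second sum is restricted to words that can follow the last letter of u;
  m \<ge> 1 provides that letter.\<close>

lemma Z_mult_le_gap:
  assumes "1 \<le> m" "gap < n"
  shows "Z m * Z n \<le> gap_const * K * Z (m + n)"
proof -
  have *: "ewt u * (if admissible A (last u # v) then ewt v else 0) \<le> ennreal K * ewt (u @ v)"
    if "length u = m" for u v
  proof (cases "admissible A u \<and> admissible A (last u # v)")
    case True
    then have "admissible A (u @ v)" by (auto simp: admissible_append admissible_Cons)
    then show ?thesis using True ewt_append_ge by simp
  qed auto
  have "Ze m * Ze n = wsum m (\<lambda>u. ewt u * Ze n)" by (simp add: Ze_def wsum_multc)
  also have "\<dots> \<le> wsum m (\<lambda>u. ewt u * (ennreal gap_const * wsum n (\<lambda>v. if admissible A (last u # v) then ewt v else 0)))"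
    by (intro wsum_mono mult_left_mono Ze_gap_from assms) auto
  also have "\<dots> = ennreal gap_const * wsum m (\<lambda>u. wsum n (\<lambda>v. ewt u * (if admissible A (last u # v) then ewt v else 0)))"
    by (simp add: wsum_cmult mult_ac)
  also have "\<dots> \<le> ennreal gap_const * wsum m (\<lambda>u. wsum n (\<lambda>v. ennreal K * ewt (u @ v)))"
    by (intro mult_left_mono wsum_mono *) auto
  also have "\<dots> = ennreal (gap_const * K) * Ze (m + n)"
    using K_ge_1 gap_const_ge_1 by (simp add: wsum_cmult Ze_def wsum_append ennreal_mult mult_ac)
  finally show ?thesis
    using K_ge_1 gap_const_ge_1 Z_pos by (simp add: Ze_eq ennreal_mult[symmetric] less_imp_le)
qed

text \<open>When the second factor is too short, the auxiliary factor \<open>Z (Suc gap)\<close>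
  lengthens it beyond the gap; submultiplicativity splits that factor off again, so that it
  cancels.\<close>

lemma Z_mult_le:
  assumes "1 \<le> m" "1 \<le> n"
  shows "Z m * Z n \<le> (gap_const * K) ^ 2 * Z (m + n)"
proof -
  let ?c = "gap_const * K" and ?l = "Suc gap"
  have c: "1 \<le> ?c" using K_ge_1 gap_const_ge_1 by (intro mult_ge1_I)
  have "(Z m * Z n) * Z ?l = Z m * (Z n * Z ?l)" by simp
  also have "\<dots> \<le> Z m * (?c * Z (n + ?l))"
    using assms by (intro mult_left_mono Z_mult_le_gap) (auto simp: less_imp_le)
  also have "\<dots> = ?c * (Z m * Z (n + ?l))" by simp
  also have "\<dots> \<le> ?c * (?c * Z (m + (n + ?l)))"
    using assms c by (intro mult_left_mono Z_mult_le_gap) auto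
  also have "\<dots> \<le> ?c * (?c * (Z (m + n) * Z ?l))"
    using c Z_add_le[of "m + n" ?l] by (intro mult_left_mono) (auto simp: add_ac)
  also have "\<dots> = (?c ^ 2 * Z (m + n)) * Z ?l" by (simp add: power2_eq_square)
  finally show ?thesis by (simp only: mult_le_cancel_right_pos[OF Z_pos])
qed

lemma Z_eq_infsum:
  "(\<Sum>\<^sub>\<infinity>w\<in>{w. admissible A w \<and> length w = n}. exp (SUP \<omega>\<in>cylinder A w. birkhoff_sum \<psi> n \<omega>)) = Z n"
proof -
  let ?S = "{w :: 'e list. length w = n}"
  have fin: "(\<integral>\<^sup>+w. ennreal (wt w) \<partial>count_space ?S) < \<infinity>"
    using Ze_finite[of n] by (simp add: Ze_def wsum_eq_nn_integral)
  have "ennreal (Z n) = ennreal (infsum wt ?S)"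
    using nn_integral_eq_infsum[OF _ summable_on_of_nn_integral[OF _ fin]]
    by (simp add: Ze_eq[symmetric] Ze_def wsum_eq_nn_integral)
  then have "Z n = infsum wt ?S"
    using Z_pos[of n] by (subst (asm) ennreal_inj) (auto intro: infsum_nonneg less_imp_le)
  also have "\<dots> = infsum wt {w. admissible A w \<and> length w = n}"
    by (rule infsum_cong_neutral) auto
  also have "\<dots> = (\<Sum>\<^sub>\<infinity>w\<in>{w. admissible A w \<and> length w = n}. exp (SUP \<omega>\<in>cylinder A w. birkhoff_sum \<psi> n \<omega>))"
    by (rule infsum_cong) (auto simp: wt_def)
  finally show ?thesis by simp
qed

abbreviation P :: real where "P \<equiv> pressure A \<psi>"

definition Zc :: real where "Zc = (gap_const * K) ^ 2"

lemma Zc_ge_1: "1 \<le> Zc"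
proof -
  have "1 \<le> gap_const * K" using K_ge_1 gap_const_ge_1 by (intro mult_ge1_I)
  then show ?thesis by (simp add: Zc_def)
qed

text \<open>\<open>ln (Z n)\<close> is almost additive with defect \<open>ln Zc\<close>. Hence the
  limit defining the pressure exists, and the uniform error of \<open>almost_additive_limit\<close>
  exponentiates to these bounds.\<close>

lemma Z_pressure: "exp (P * real n) / Zc \<le> Z n" "Z n \<le> Zc * exp (P * real n)"
proof -
  have "\<bar>ln (Z (m + n)) - ln (Z m) - ln (Z n)\<bar> \<le> ln Zc" if "1 \<le> m" "1 \<le> n" for m n
  proof -
    have "ln (Z (m + n)) \<le> ln (Z m * Z n)" using Z_add_le by (subst ln_le_cancel_iff) auto
    moreover have "ln (Z m * Z n) \<le> ln (Zc * Z (m + n))"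
      using Z_mult_le[OF that] Zc_ge_1 by (subst ln_le_cancel_iff) (auto simp: Zc_def[symmetric])
    ultimately show ?thesis
      using Zc_ge_1 ln_ge_zero[OF Zc_ge_1] by (simp add: ln_mult_pos)
  qed
  then obtain p where p: "(\<lambda>n. ln (Z n) / real n) \<longlonglongrightarrow> p" "\<And>n. 1 \<le> n \<Longrightarrow> \<bar>ln (Z n) - real n * p\<bar> \<le> ln Zc"
    using almost_additive_limit[of "\<lambda>n. ln (Z n)" "ln Zc"] by blast
  have "P = p"
    unfolding pressure_def Z_eq_infsum using p(1) by (intro limI) (simp add: divide_simps mult.commute)
  have "exp (P * real n) / Zc \<le> Z n \<and> Z n \<le> Zc * exp (P * real n)"
  \<comment> \<open>The limit estimate starts at n = 1; for n = 0 the sum has the single term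
    1.\<close>
  proof (cases "n = 0")
    case True
    have "Z 0 = 1" by (simp add: Z_def Ze_def)
    then show ?thesis using True Zc_ge_1 by simp
  next
    case False
    then have "ln (Z n) \<le> ln Zc + P * real n" "P * real n - ln Zc \<le> ln (Z n)"
      using p(2)[of n] by (auto simp: \<open>P = p\<close> mult.commute abs_le_iff)
    then have "exp (ln (Z n)) \<le> exp (ln Zc + P * real n)" "exp (P * real n - ln Zc) \<le> exp (ln (Z n))"
      by (simp_all only: exp_le_cancel_iff)
    then show ?thesis using Zc_ge_1 by (simp add: exp_add exp_diff)
  qed
  then show "exp (P * real n) / Zc \<le> Z n" "Z n \<le> Zc * exp (P * real n)" by auto
qed

section \<open>Periodic approximations of the Gibbs state\<close>

definition word_pmf :: "nat \<Rightarrow> 'e list pmf" where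
  "word_pmf N = embed_pmf (\<lambda>w. if length w = N then wt w / Z N else 0)"

lemma pmf_word_pmf: "pmf (word_pmf N) w = (if length w = N then wt w / Z N else 0)"
  unfolding word_pmf_def
proof (rule pmf_embed_pmf)
  show "0 \<le> (if length w = N then wt w / Z N else 0)" for w
    using Z_pos[of N] by (auto intro!: divide_nonneg_pos)
  have "(\<integral>\<^sup>+w. ennreal (if length w = N then wt w / Z N else 0) \<partial>count_space UNIV)
    = (\<integral>\<^sup>+w. ennreal (wt w) * ennreal (1 / Z N) \<partial>count_space {w. length w = N})"
    using Z_pos[of N]
    by (auto simp: nn_integral_count_space_indicator ennreal_mult[symmetric] less_imp_le intro!: nn_integral_cong split: split_indicator)
  also have "\<dots> = Ze N * ennreal (1 / Z N)"
    by (simp add: nn_integral_multc Ze_def wsum_eq_nn_integral)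
  also have "\<dots> = 1" using Z_pos[of N] by (simp add: Ze_eq ennreal_mult[symmetric] less_imp_le)
  finally show "(\<integral>\<^sup>+w. ennreal (if length w = N then wt w / Z N else 0) \<partial>count_space UNIV) = 1" .
qed

lemma emeasure_word_pmf:
  "emeasure (word_pmf N) {w. Q w} = wsum N (\<lambda>w. if Q w then ewt w else 0) * ennreal (1 / Z N)"
proof -
  have "emeasure (word_pmf N) {w. Q w} = (\<integral>\<^sup>+w. ennreal (pmf (word_pmf N) w) * indicator {w. Q w} w \<partial>count_space UNIV)"
    by (simp add: nn_integral_measure_pmf[symmetric])
  also have "\<dots> = (\<integral>\<^sup>+w. (if Q w then ewt w else 0) * ennreal (1 / Z N) \<partial>count_space {w. length w = N})"
    using Z_pos[of N]
    by (auto simp: nn_integral_count_space_indicator pmf_word_pmf ennreal_mult[symmetric] less_imp_le intro!: nn_integral_cong split: split_indicator)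
  also have "\<dots> = wsum N (\<lambda>w. if Q w then ewt w else 0) * ennreal (1 / Z N)"
    by (simp add: nn_integral_multc wsum_eq_nn_integral)
  finally show ?thesis .
qed

lemma emeasure_word_pmf_at:
  "emeasure (word_pmf (s + (length v + t))) {w. take (length v) (drop s w) = v}
    = wsum s (\<lambda>u. wsum t (\<lambda>u'. ewt (u @ v @ u'))) * ennreal (1 / Z (s + (length v + t)))"
proof -
  have "wsum (s + (length v + t)) (\<lambda>w. if take (length v) (drop s w) = v then ewt w else 0)
    = wsum s (\<lambda>u. wsum (length v) (\<lambda>v'. wsum t (\<lambda>u'. if v' = v then ewt (u @ v' @ u') else 0)))"
    unfolding wsum_append by (intro wsum_cong) auto
  \<comment> \<open>The instance of \<open>wsum_cmult\<close> with factor 0 says that a sum of zeros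
    vanishes.\<close>
  also have "\<dots> = wsum s (\<lambda>u. wsum (length v) (\<lambda>v'. if v' = v then wsum t (\<lambda>u'. ewt (u @ v' @ u')) else 0))"
    using wsum_cmult[of t 0 "\<lambda>_. 0"] by (intro wsum_cong) auto
  also have "\<dots> = wsum s (\<lambda>u. wsum t (\<lambda>u'. ewt (u @ v @ u')))"
    by (simp add: wsum_delta)
  finally show ?thesis by (simp add: emeasure_word_pmf)
qed

text \<open>\<open>gap_const ^ 2 * K ^ 2\<close> comes from surrounding a word by free words,
  \<open>Zc ^ 3\<close> from replacing three partition sums by exponentials.\<close>

definition G :: real where "G = gap_const ^ 2 * K ^ 2 * Zc ^ 3"

lemma G_ge_1: "1 \<le> G"
proof -
  have "1 \<le> gap_const ^ 2" "1 \<le> K ^ 2" "1 \<le> Zc ^ 3" using gap_const_ge_1 K_ge_1 Zc_ge_1 by auto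
  then show ?thesis unfolding G_def by (intro mult_ge1_I)
qed

lemma Z_ratio:
  "Z s * Z t / Z (s + (n + t)) \<le> Zc ^ 3 * exp (- P * real n)"
  "exp (- P * real n) / Zc ^ 3 \<le> Z s * Z t / Z (s + (n + t))"
proof -
  let ?N = "s + (n + t)"
  have e: "exp (P * real s) * exp (P * real t) / exp (P * real ?N) = exp (- P * real n)"
    by (simp add: exp_add[symmetric] exp_diff[symmetric] algebra_simps)
  have "Z s * Z t / Z ?N \<le> (Zc * exp (P * real s)) * (Zc * exp (P * real t)) / (exp (P * real ?N) / Zc)"
    using Zc_ge_1 by (intro frac_le mult_mono Z_pressure) (auto simp: less_imp_le)
  also have "\<dots> = Zc ^ 3 * (exp (P * real s) * exp (P * real t) / exp (P * real ?N))"
    using Zc_ge_1 by (simp add: power3_eq_cube)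
  finally show "Z s * Z t / Z ?N \<le> Zc ^ 3 * exp (- P * real n)" unfolding e .
  have "exp (- P * real n) / Zc ^ 3 = (exp (P * real s) / Zc) * (exp (P * real t) / Zc) / (Zc * exp (P * real ?N))"
    unfolding e[symmetric] using Zc_ge_1 by (simp add: power3_eq_cube)
  also have "\<dots> \<le> Z s * Z t / Z ?N"
    using Zc_ge_1 by (intro frac_le mult_mono Z_pressure) (auto simp: less_imp_le)
  finally show "exp (- P * real n) / Zc ^ 3 \<le> Z s * Z t / Z ?N" .
qed

lemma measure_word_pmf_le:
  "measure (word_pmf (s + (length v + t))) {w. take (length v) (drop s w) = v} \<le> G * wt v * exp (- P * real (length v))"
proof -
  let ?N = "s + (length v + t)"
  have "wsum s (\<lambda>u. wsum t (\<lambda>u'. ewt (u @ v @ u'))) \<le> wsum s (\<lambda>u. wsum t (\<lambda>u'. ewt u * (ewt v * ewt u')))"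
    by (intro wsum_mono order_trans[OF ewt_append_le] mult_left_mono ewt_append_le) auto
  also have "\<dots> = Ze s * (ewt v * Ze t)" by (simp add: wsum_cmult wsum_multc Ze_def)
  finally have "emeasure (word_pmf ?N) {w. take (length v) (drop s w) = v} \<le> Ze s * (ewt v * Ze t) * ennreal (1 / Z ?N)"
    unfolding emeasure_word_pmf_at by (intro mult_right_mono) auto
  also have "\<dots> = ennreal (wt v * (Z s * Z t / Z ?N))"
    using Z_pos by (simp add: Ze_eq ennreal_mult[symmetric] less_imp_le mult_ac)
  finally have "measure (word_pmf ?N) {w. take (length v) (drop s w) = v} \<le> wt v * (Z s * Z t / Z ?N)"
    using Z_pos by (simp add: measure_pmf.emeasure_eq_measure less_imp_le)
  also have "\<dots> \<le> wt v * (Zc ^ 3 * exp (- P * real (length v)))"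
    by (intro mult_left_mono Z_ratio) simp
  also have "\<dots> = Zc ^ 3 * (wt v * exp (- P * real (length v)))" by simp
  also have "\<dots> \<le> G * (wt v * exp (- P * real (length v)))"
  proof -
    have "1 \<le> gap_const ^ 2 * K ^ 2"
      using gap_const_ge_1 K_ge_1 by (intro mult_ge1_I one_le_power)
    then have "Zc ^ 3 \<le> G" unfolding G_def using Zc_ge_1 by (simp add: mult_le_cancel_right1)
    then show ?thesis by (intro mult_right_mono) auto
  qed
  finally show ?thesis by simp
qed

text \<open>The free words on both sides must be longer than \<open>gap\<close> for
  \<open>three_words\<close>; the upper bound in \<open>measure_word_pmf_le\<close> holds at every
  position.\<close>

lemma measure_word_pmf_ge:
  assumes "v \<noteq> []" "gap < s" "gap < t"
  shows "wt v * exp (- P * real (length v)) / G \<le> measure (word_pmf (s + (length v + t))) {w. take (length v) (drop s w) = v}"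
proof (cases "admissible A v")
  case True
  let ?N = "s + (length v + t)" and ?c = "gap_const ^ 2 * K ^ 2"
  have c: "0 < ?c" using gap_const_ge_1 K_ge_1 by auto
  let ?m = "measure (word_pmf ?N) {w. take (length v) (drop s w) = v}"
  have "ewt v * (Ze s * Ze t) * ennreal (1 / Z ?N) \<le> (ennreal ?c * wsum s (\<lambda>u. wsum t (\<lambda>u'. ewt (u @ v @ u')))) * ennreal (1 / Z ?N)"
    by (intro mult_right_mono three_words True assms) auto
  also have "\<dots> = ennreal ?c * ennreal ?m"
    unfolding measure_pmf.emeasure_eq_measure[symmetric] emeasure_word_pmf_at by (simp add: mult_ac)
  finally have "ennreal (wt v * (Z s * Z t / Z ?N)) \<le> ennreal (?c * ?m)"
    using Z_pos c by (simp add: Ze_eq ennreal_mult[symmetric] less_imp_le mult_ac)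
  then have *: "wt v * (Z s * Z t / Z ?N) \<le> ?c * ?m" using c by simp
  have "wt v * (exp (- P * real (length v)) / Zc ^ 3) \<le> wt v * (Z s * Z t / Z ?N)"
    by (intro mult_left_mono Z_ratio) simp
  with * have "wt v * (exp (- P * real (length v)) / Zc ^ 3) / ?c \<le> ?m"
    using c by (subst pos_divide_le_eq) (auto simp: mult_ac)
  then show ?thesis by (simp add: G_def mult_ac)
qed simp

end

section \<open>Laws of one-sided random sequences\<close>

definition prefixed :: "'a list \<Rightarrow> (nat \<Rightarrow> 'a) set" where
  "prefixed v = {x. \<forall>i<length v. x i = v ! i}"

lemma prefixed_Nil [simp]: "prefixed [] = UNIV"
  by (simp add: prefixed_def)

lemma prefixed_snoc: "prefixed (v @ [e]) = {x \<in> prefixed v. x (length v) = e}"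
  by (auto simp: prefixed_def nth_append less_Suc_eq)

lemma prefixed_Cons: "prefixed (e # v) = {x. x 0 = e \<and> (\<lambda>i. x (Suc i)) \<in> prefixed v}"
  by (auto simp: prefixed_def less_Suc_eq_0_disj)

lemma sum_prefixed_snoc:
  fixes X :: "(nat \<Rightarrow> 'a::countable) pmf"
  shows "(\<integral>\<^sup>+e. ennreal (measure X (prefixed (v @ [e]))) \<partial>count_space UNIV) = ennreal (measure X (prefixed v))"
proof -
  have "prefixed v = (\<Union>e. prefixed (v @ [e]))" by (auto simp: prefixed_snoc)
  also have "emeasure X \<dots> = (\<integral>\<^sup>+e. emeasure X (prefixed (v @ [e])) \<partial>count_space UNIV)"
    by (intro emeasure_UN_countable) (auto simp: disjoint_family_on_def prefixed_snoc)
  finally show ?thesis by (simp add: measure_pmf.emeasure_eq_measure)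
qed

lemma measure_shifted:
  assumes "map_pmf (\<lambda>x i. x (Suc i)) X = X"
  shows "measure X {x. (\<lambda>i. x (Suc i)) \<in> S} = measure X S"
proof -
  have "measure X S = measure (map_pmf (\<lambda>x i. x (Suc i)) X) S" by (simp only: assms)
  also have "\<dots> = measure X {x. (\<lambda>i. x (Suc i)) \<in> S}" by (simp add: vimage_def)
  finally show ?thesis by simp
qed

lemma sum_prefixed_Cons:
  fixes X :: "(nat \<Rightarrow> 'a::countable) pmf"
  assumes "map_pmf (\<lambda>x i. x (Suc i)) X = X"
  shows "(\<integral>\<^sup>+e. ennreal (measure X (prefixed (e # v))) \<partial>count_space UNIV) = ennreal (measure X (prefixed v))"
proof -
  have "{x. (\<lambda>i. x (Suc i)) \<in> prefixed v} = (\<Union>e. prefixed (e # v))" by (auto simp: prefixed_Cons)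
  also have "emeasure X \<dots> = (\<integral>\<^sup>+e. emeasure X (prefixed (e # v)) \<partial>count_space UNIV)"
    by (intro emeasure_UN_countable) (auto simp: disjoint_family_on_def prefixed_Cons)
  finally show ?thesis using measure_shifted[OF assms, of "prefixed v"] by (simp add: measure_pmf.emeasure_eq_measure)
qed

lemma measure_coordinate:
  assumes "map_pmf (\<lambda>x i. x (Suc i)) X = X"
  shows "measure X {x. x n = e} = measure X (prefixed [e])"
proof (induction n)
  case (Suc n)
  then show ?case using measure_shifted[OF assms, of "{x. x n = e}"] by simp
qed (simp add: prefixed_def)

text \<open>Sequential compactness of a countable power of [0, 1] replaces an explicit diagonal
  argument over the words.\<close>

lemma pointwise_subsequence:
  fixes f :: "nat \<Rightarrow> 'i::countable \<Rightarrow> real"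
  assumes "\<And>k i. 0 \<le> f k i \<and> f k i \<le> 1"
  shows "\<exists>p r. strict_mono r \<and> (\<forall>i. (\<lambda>k. f (r k) i) \<longlonglongrightarrow> p i)"
proof -
  have "compactin (product_topology (\<lambda>_. euclidean) UNIV) (PiE (UNIV :: 'i set) (\<lambda>_. {0..1::real}))"
    by (subst compactin_PiE) auto
  then have "compact (PiE (UNIV :: 'i set) (\<lambda>_. {0..1::real}))"
    by (simp add: euclidean_product_topology)
  then have "seq_compact (PiE (UNIV :: 'i set) (\<lambda>_. {0..1::real}))"
    by (rule compact_imp_seq_compact)
  moreover have "\<forall>k. f k \<in> PiE UNIV (\<lambda>_. {0..1})" using assms by auto
  ultimately obtain p r where r: "strict_mono r" "(f \<circ> r) \<longlonglongrightarrow> p"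
    unfolding seq_compact_def by blast
  have "(\<lambda>k. (f \<circ> r) k i) \<longlonglongrightarrow> p i" for i
    by (rule continuous_on_tendsto_compose[OF continuous_on_product_coordinates r(2)]) auto
  with r(1) show ?thesis by (intro exI[of _ p] exI[of _ r]) (simp add: o_def)
qed

context hoelder_shift
begin

text \<open>The uniformly random phase makes the law of the periodic sequence exactly shift invariant; the
  words that wrap around the end have vanishing weight.\<close>

definition periodic_pmf :: "nat \<Rightarrow> (nat \<Rightarrow> 'e) pmf" where
  "periodic_pmf N = bind_pmf (pmf_of_set {..<N}) (\<lambda>s. map_pmf (\<lambda>w i. w ! ((s + i) mod N)) (word_pmf N))"

text \<open>The shift advances the phase cyclically, and the uniform law on the phases is invariant
  under this permutation.\<close>

lemma periodic_pmf_shift: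
  assumes "0 < N"
  shows "map_pmf (\<lambda>x i. x (Suc i)) (periodic_pmf N) = periodic_pmf N"
proof -
  let ?U = "pmf_of_set {..<N}" and ?f = "\<lambda>s. Suc s mod N"
  have bij: "bij_betw ?f {..<N} {..<N}"
    by (rule bij_betw_byWitness[where f' = "\<lambda>s. if s = 0 then N - 1 else s - 1"])
      (use assms in \<open>auto simp: mod_Suc\<close>)
  have U: "map_pmf ?f ?U = ?U"
    using assms by (intro map_pmf_of_set_bij_betw[OF bij]) auto
  have m: "(s + Suc i) mod N = (?f s + i) mod N" for s i by (simp add: mod_simps)
  have "map_pmf (\<lambda>x i. x (Suc i)) (periodic_pmf N)
    = bind_pmf ?U (\<lambda>s. map_pmf (\<lambda>w i. w ! ((?f s + i) mod N)) (word_pmf N))"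
    unfolding periodic_pmf_def map_bind_pmf map_pmf_comp m ..
  also have "\<dots> = bind_pmf (map_pmf ?f ?U) (\<lambda>s. map_pmf (\<lambda>w i. w ! ((s + i) mod N)) (word_pmf N))"
    by (simp add: bind_map_pmf)
  finally show ?thesis unfolding U periodic_pmf_def .
qed

lemma measure_periodic_pmf:
  assumes "0 < N"
  shows "measure (periodic_pmf N) S = (\<Sum>s<N. measure (word_pmf N) {w. (\<lambda>i. w ! ((s + i) mod N)) \<in> S}) / real N"
proof -
  have "emeasure (periodic_pmf N) S = (\<Sum>s<N. ennreal (measure (word_pmf N) {w. (\<lambda>i. w ! ((s + i) mod N)) \<in> S})) / real N"
    unfolding measure_pmf.emeasure_eq_measure[symmetric] using assms
    by (simp add: periodic_pmf_def nn_integral_pmf_of_set vimage_def ennreal_of_nat_eq_real_of_nat lessThan_empty_iff)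
  also have "\<dots> = ennreal ((\<Sum>s<N. measure (word_pmf N) {w. (\<lambda>i. w ! ((s + i) mod N)) \<in> S}) / real N)"
    using assms by (simp add: sum_ennreal divide_ennreal sum_nonneg)
  finally show ?thesis by (simp add: measure_pmf.emeasure_eq_measure sum_nonneg)
qed

lemma measure_word_pmf_window:
  assumes "s + length v \<le> N"
  shows "measure (word_pmf N) {w. (\<lambda>i. w ! ((s + i) mod N)) \<in> prefixed v}
    = measure (word_pmf N) {w. take (length v) (drop s w) = v}"
proof (rule measure_pmf.finite_measure_eq_AE)
  have "(\<lambda>i. w ! ((s + i) mod N)) \<in> prefixed v \<longleftrightarrow> take (length v) (drop s w) = v" if "length w = N" for w
    using assms that unfolding list_eq_iff_nth_eq by (simp add: prefixed_def)
  moreover have "length w = N" if "w \<in> set_pmf (word_pmf N)" for w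
    using that by (auto simp: set_pmf_iff pmf_word_pmf split: if_splits)
  ultimately show "AE w in measure_pmf (word_pmf N). (w \<in> {w. (\<lambda>i. w ! ((s + i) mod N)) \<in> prefixed v})
      = (w \<in> {w. take (length v) (drop s w) = v})"
    by (auto simp: AE_measure_pmf_iff)
qed auto

lemma window_le:
  assumes "s + length v \<le> N"
  shows "measure (word_pmf N) {w. (\<lambda>i. w ! ((s + i) mod N)) \<in> prefixed v} \<le> G * wt v * exp (- P * real (length v))"
proof -
  have N: "N = s + (length v + (N - s - length v))" using assms by simp
  show ?thesis
    unfolding measure_word_pmf_window[OF assms] by (subst N) (rule measure_word_pmf_le)
qed

lemma window_ge:
  assumes "gap < s" "s + length v + gap < N" "v \<noteq> []"
  shows "wt v * exp (- P * real (length v)) / G \<le> measure (word_pmf N) {w. (\<lambda>i. w ! ((s + i) mod N)) \<in> prefixed v}"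
proof -
  have N: "N = s + (length v + (N - s - length v))" using assms by simp
  have "s + length v \<le> N" using assms by simp
  then show ?thesis
    unfolding measure_word_pmf_window[OF \<open>s + length v \<le> N\<close>]
    by (subst N) (rule measure_word_pmf_ge, use assms in auto)
qed

text \<open>A window of one letter never wraps around, so there is no error term. The bound is
  uniform in N and summable over the letters; it is the majorant in the passage to the
  limit.\<close>

lemma periodic_pmf_letter: "0 < N \<Longrightarrow> measure (periodic_pmf N) (prefixed [e]) \<le> G * wt [e] * exp (- P)"
proof -
  assume N: "0 < N"
  have "(\<Sum>s<N. measure (word_pmf N) {w. (\<lambda>i. w ! ((s + i) mod N)) \<in> prefixed [e]})
    \<le> (\<Sum>s<N. G * wt [e] * exp (- P))"
    by (intro sum_mono window_le[where v="[e]", simplified]) auto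
  then show ?thesis using N by (simp add: measure_periodic_pmf divide_le_eq mult.commute)
qed

lemma periodic_pmf_le:
  assumes "0 < N"
  shows "measure (periodic_pmf N) (prefixed v) \<le> G * wt v * exp (- P * real (length v)) + real (length v) / real N"
proof -
  let ?c = "G * wt v * exp (- P * real (length v))" and ?n = "length v"
  have c: "0 \<le> ?c" using G_ge_1 by simp
  \<comment> \<open>The summand 1 stands for the phases at which the window wraps around: at most
    \<open>length v\<close> of them, each contributing a probability of at most 1.\<close>
  have "(\<Sum>s<N. measure (word_pmf N) {w. (\<lambda>i. w ! ((s + i) mod N)) \<in> prefixed v})
    \<le> (\<Sum>s<N. ?c + (if N < s + ?n then 1 else 0))"
  proof (rule sum_mono)
    fix s
    show "measure (word_pmf N) {w. (\<lambda>i. w ! ((s + i) mod N)) \<in> prefixed v} \<le> ?c + (if N < s + ?n then 1 else 0)"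
    proof (cases "N < s + ?n")
      case True
      then show ?thesis using c by (simp add: add_increasing)
    next
      case False
      then show ?thesis using window_le[of s v N] by simp
    qed
  qed
  also have "\<dots> = real N * ?c + real (card {s \<in> {..<N}. N < s + ?n})"
    by (simp add: sum.distrib sum.If_cases Int_def)
  also have "card {s \<in> {..<N}. N < s + ?n} \<le> card {N - ?n..<N}"
    by (intro card_mono) auto
  also have "\<dots> \<le> ?n" by simp
  finally have "(\<Sum>s<N. measure (word_pmf N) {w. (\<lambda>i. w ! ((s + i) mod N)) \<in> prefixed v}) \<le> real N * ?c + real ?n"
    by simp
  then show ?thesis
    using assms by (simp add: measure_periodic_pmf field_simps)
qed

lemma periodic_pmf_ge:
  assumes "0 < N" "v \<noteq> []"
  shows "wt v * exp (- P * real (length v)) / G * (1 - (real (length v) + 2 * real gap + 1) / real N)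
    \<le> measure (periodic_pmf N) (prefixed v)"
proof -
  let ?c = "wt v * exp (- P * real (length v)) / G" and ?n = "length v"
  have c: "0 \<le> ?c" using G_ge_1 by simp
  \<comment> \<open>The phases counted here leave more than \<open>gap\<close> letters of the random
    word on both sides of the window.\<close>
  have "?c * (real N - real ?n - 2 * real gap - 1) \<le> ?c * real (card {Suc gap..<N - ?n - gap})"
    using c by (intro mult_left_mono) auto
  also have "\<dots> = (\<Sum>s\<in>{Suc gap..<N - ?n - gap}. ?c)" by simp
  also have "\<dots> \<le> (\<Sum>s\<in>{Suc gap..<N - ?n - gap}. measure (word_pmf N) {w. (\<lambda>i. w ! ((s + i) mod N)) \<in> prefixed v})"
    using assms by (intro sum_mono window_ge) auto
  also have "\<dots> \<le> (\<Sum>s<N. measure (word_pmf N) {w. (\<lambda>i. w ! ((s + i) mod N)) \<in> prefixed v})"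
    by (intro sum_mono2) auto
  finally have "?c * (real N - real ?n - 2 * real gap - 1) / real N \<le> measure (periodic_pmf N) (prefixed v)"
    unfolding measure_periodic_pmf[OF assms(1)] by (intro divide_right_mono) auto
  moreover have "?c * (real N - real ?n - 2 * real gap - 1) / real N = ?c * (1 - (real ?n + 2 * real gap + 1) / real N)"
    using assms(1) by (simp add: field_simps)
  ultimately show ?thesis by simp
qed

text \<open>Pointwise limits of probabilities over an infinite alphabet may lose mass. Additivity in
  the last and in the first letter survives because the sums over that letter are dominated by the
  one-letter bound. The two additivities together express consistency and stationarity.\<close>

lemma gibbs_words_exist:
  "\<exists>p :: 'e list \<Rightarrow> real. p [] = 1 \<and> (\<forall>v. 0 \<le> p v) \<and>
    (\<forall>v. (\<integral>\<^sup>+e. ennreal (p (v @ [e])) \<partial>count_space UNIV) = ennreal (p v)) \<and>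
    (\<forall>v. (\<integral>\<^sup>+e. ennreal (p (e # v)) \<partial>count_space UNIV) = ennreal (p v)) \<and>
    (\<forall>v. v \<noteq> [] \<longrightarrow> wt v * exp (- P * real (length v)) / G \<le> p v \<and> p v \<le> G * wt v * exp (- P * real (length v)))"
proof -
  \<comment> \<open>\<open>Suc k\<close> avoids the meaningless period 0.\<close>
  define f where "f k v = measure (periodic_pmf (Suc k)) (prefixed v)" for k v
  obtain p r where r: "strict_mono r" and lim: "\<And>v. (\<lambda>k. f (r k) v) \<longlonglongrightarrow> p v"
    using pointwise_subsequence[of f] by (auto simp: f_def)
  have p_nonneg: "0 \<le> p v" for v
    by (rule LIMSEQ_le_const[OF lim]) (simp add: f_def)
  have small: "(\<lambda>k. a / real (Suc (r k))) \<longlonglongrightarrow> 0" for a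
  proof -
    have "(\<lambda>k. a / real (Suc k)) \<longlonglongrightarrow> 0"
      using LIMSEQ_Suc[OF lim_const_over_n[of a]] by simp
    then show ?thesis using LIMSEQ_subseq_LIMSEQ[OF _ r] by (fastforce simp: o_def)
  qed
  have dominated: "(\<lambda>k. \<integral>\<^sup>+e. ennreal (f (r k) (g e)) \<partial>count_space UNIV)
      \<longlonglongrightarrow> (\<integral>\<^sup>+e. ennreal (p (g e)) \<partial>count_space UNIV)"
    if g: "\<And>k e. f k (g e) \<le> f k [e]" for g :: "'e \<Rightarrow> 'e list"
  proof (rule nn_integral_dominated_convergence[where w="\<lambda>e. ennreal (G * exp (- P)) * ennreal (wt [e])"])
    have "(\<integral>\<^sup>+e. ennreal (G * exp (- P)) * ennreal (wt [e]) \<partial>count_space UNIV) = ennreal (G * exp (- P)) * Ze (Suc 0)"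
      by (simp add: nn_integral_cmult Ze_def)
    then show "(\<integral>\<^sup>+e. ennreal (G * exp (- P)) * ennreal (wt [e]) \<partial>count_space UNIV) < \<infinity>"
      using Ze_finite[of "Suc 0"] by (simp add: ennreal_mult_less_top)
    show "AE e in count_space UNIV. ennreal (f (r j) (g e)) \<le> ennreal (G * exp (- P)) * ennreal (wt [e])" for j
    proof (rule AE_I2)
      fix e
      have "f (r j) (g e) \<le> G * wt [e] * exp (- P)"
        using g[of "r j" e] periodic_pmf_letter[of "Suc (r j)" e] by (simp add: f_def)
      then show "ennreal (f (r j) (g e)) \<le> ennreal (G * exp (- P)) * ennreal (wt [e])"
        using G_ge_1 by (simp add: ennreal_mult[symmetric] ennreal_leI mult_ac)
    qed
    show "AE e in count_space UNIV. (\<lambda>k. ennreal (f (r k) (g e))) \<longlonglongrightarrow> ennreal (p (g e))"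
      by (intro AE_I2 tendsto_ennrealI lim)
  qed auto
  have sum_snoc: "(\<integral>\<^sup>+e. ennreal (p (v @ [e])) \<partial>count_space UNIV) = ennreal (p v)" for v
  proof -
    \<comment> \<open>The letter e stands at position \<open>length v\<close>; by stationarity it
      has the same probability there as at position 0.\<close>
    have "f k (v @ [e]) \<le> f k [e]" for k e
      unfolding f_def measure_coordinate[OF periodic_pmf_shift, OF zero_less_Suc, of _ "length v", symmetric]
      by (intro measure_pmf.finite_measure_mono) (auto simp: prefixed_snoc)
    then have "(\<lambda>k. \<integral>\<^sup>+e. ennreal (f (r k) (v @ [e])) \<partial>count_space UNIV)
      \<longlonglongrightarrow> (\<integral>\<^sup>+e. ennreal (p (v @ [e])) \<partial>count_space UNIV)" by (rule dominated)
    moreover have "(\<lambda>k. \<integral>\<^sup>+e. ennreal (f (r k) (v @ [e])) \<partial>count_space UNIV) \<longlonglongrightarrow> ennreal (p v)"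
      unfolding f_def sum_prefixed_snoc unfolding f_def[symmetric] by (intro tendsto_ennrealI lim)
    ultimately show ?thesis by (rule LIMSEQ_unique)
  qed
  have sum_Cons: "(\<integral>\<^sup>+e. ennreal (p (e # v)) \<partial>count_space UNIV) = ennreal (p v)" for v
  proof -
    have "f k (e # v) \<le> f k [e]" for k e
      unfolding f_def by (intro measure_pmf.finite_measure_mono) (auto simp: prefixed_Cons)
    then have "(\<lambda>k. \<integral>\<^sup>+e. ennreal (f (r k) (e # v)) \<partial>count_space UNIV)
      \<longlonglongrightarrow> (\<integral>\<^sup>+e. ennreal (p (e # v)) \<partial>count_space UNIV)" by (rule dominated)
    moreover have "(\<lambda>k. \<integral>\<^sup>+e. ennreal (f (r k) (e # v)) \<partial>count_space UNIV) \<longlonglongrightarrow> ennreal (p v)"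
      unfolding f_def sum_prefixed_Cons[OF periodic_pmf_shift, OF zero_less_Suc] unfolding f_def[symmetric]
      by (intro tendsto_ennrealI lim)
    ultimately show ?thesis by (rule LIMSEQ_unique)
  qed
  have upper: "p v \<le> G * wt v * exp (- P * real (length v))" for v
  proof -
    have "p v \<le> G * wt v * exp (- P * real (length v)) + 0"
    proof (rule LIMSEQ_le[OF lim])
      show "(\<lambda>k. G * wt v * exp (- P * real (length v)) + real (length v) / real (Suc (r k)))
        \<longlonglongrightarrow> G * wt v * exp (- P * real (length v)) + 0"
        by (intro tendsto_add tendsto_const small)
      show "\<exists>N. \<forall>n\<ge>N. f (r n) v \<le> G * wt v * exp (- P * real (length v)) + real (length v) / real (Suc (r n))"
        unfolding f_def using periodic_pmf_le by blast
    qed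
    then show ?thesis by simp
  qed
  have lower: "wt v * exp (- P * real (length v)) / G \<le> p v" if v: "v \<noteq> []" for v
  proof -
    let ?c = "wt v * exp (- P * real (length v)) / G" and ?a = "real (length v) + 2 * real gap + 1"
    have "?c * (1 - 0) \<le> p v"
    proof (rule LIMSEQ_le[OF _ lim])
      show "(\<lambda>k. ?c * (1 - ?a / real (Suc (r k)))) \<longlonglongrightarrow> ?c * (1 - 0)"
        by (intro tendsto_mult tendsto_diff tendsto_const small)
      show "\<exists>N. \<forall>n\<ge>N. ?c * (1 - ?a / real (Suc (r n))) \<le> f (r n) v"
        unfolding f_def using periodic_pmf_ge[OF _ v] by blast
    qed
    then show ?thesis by simp
  qed
  have "p [] = 1"
    using LIMSEQ_unique[OF lim[of "[]"], of 1] by (simp add: f_def)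
  then show ?thesis using p_nonneg sum_snoc sum_Cons upper lower by blast
qed

end

section \<open>Two-sided cylinders\<close>

definition wcyl :: "('e \<Rightarrow> 'e \<Rightarrow> bool) \<Rightarrow> int \<Rightarrow> 'e list \<Rightarrow> (int \<Rightarrow> 'e) set" where
  "wcyl A k w = {\<tau> \<in> two_sided A. \<forall>j<length w. \<tau> (k + int j) = w ! j}"

lemma cylinder_eq_wcyl: "cylinder A w = wcyl A 0 w"
  by (simp add: cylinder_def wcyl_def)

lemma wcyl_Nil [simp]: "wcyl A k [] = two_sided A"
  by (simp add: wcyl_def)

lemma wcyl_snoc: "wcyl A k (w @ [e]) = {\<tau> \<in> wcyl A k w. \<tau> (k + int (length w)) = e}"
  by (auto simp: wcyl_def nth_append less_Suc_eq)

lemma wcyl_append: "wcyl A k (u @ v) = wcyl A k u \<inter> wcyl A (k + int (length u)) v"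
proof (induction v rule: rev_induct)
  case (snoc e v)
  then show ?case
    unfolding append_assoc[symmetric] wcyl_snoc[of A k "u @ v"] wcyl_snoc[of A _ v] by (auto simp: add.assoc)
qed (auto simp: wcyl_def)

lemma wcyl_eq_words: "wcyl A k w = {\<tau> \<in> two_sided A. map (\<lambda>j. \<tau> (k + int j)) [0..<length w] = w}"
  unfolding wcyl_def list_eq_iff_nth_eq by simp

lemma wcyl_measurable [measurable, simp]:
  fixes A :: "'e::countable \<Rightarrow> 'e \<Rightarrow> bool"
  shows "wcyl A k w \<in> sets (seq_borel (two_sided A))"
proof -
  have "wcyl A k w = {\<tau> \<in> space (seq_borel (two_sided A)). \<forall>j<length w. \<tau> (k + int j) = w ! j}"
    by (simp add: wcyl_def)
  also have "\<dots> \<in> sets (seq_borel (two_sided A))" by measurable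
  finally show ?thesis .
qed

lemma wcyl_disjoint: "length u = length v \<Longrightarrow> u \<noteq> v \<Longrightarrow> wcyl A k u \<inter> wcyl A k v = {}"
  by (auto simp: wcyl_eq_words)

lemma shift_two_sided: "\<omega> \<in> two_sided A \<Longrightarrow> shift \<omega> \<in> two_sided A"
  using shift_iterate_two_sided[of \<omega> A 1] by simp

lemma shift_wcyl: "shift -` wcyl A k w \<inter> two_sided A = wcyl A (k + 1) w"
  using shift_two_sided[of _ A] by (auto simp: wcyl_def shift_def add_ac)

text \<open>Cut at 0, the window consists of m past and m future letters. The even split fits the
  pairing of coordinates in \<open>two_sided_measure_exists\<close> and, later, the measures on
  fibres.\<close>

definition two_window :: "nat \<Rightarrow> int list" where
  "two_window m = map (\<lambda>j. int j - int m) [0..<2 * m]"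

lemma covering_two_window: "covering two_window"
  unfolding covering_def
proof (intro allI impI)
  fix I :: "int set" assume "finite I"
  then have "finite ((\<lambda>i. nat \<bar>i\<bar>) ` I)" by simp
  then obtain m where m: "\<forall>n\<in>(\<lambda>i. nat \<bar>i\<bar>) ` I. n < m" using finite_nat_set_iff_bounded by blast
  have "i \<in> set (two_window m)" if "i \<in> I" for i
  proof -
    have "nat \<bar>i\<bar> < m" using m that by auto
    then have "i = int (nat (i + int m)) - int m" "nat (i + int m) < 2 * m" by auto
    then show ?thesis unfolding two_window_def by (auto simp: image_iff intro!: bexI[of _ "nat (i + int m)"])
  qed
  then show "\<exists>m. I \<subseteq> set (two_window m)" by blast
qed

lemma two_window_mono: "m \<le> n \<Longrightarrow> set (two_window m) \<subseteq> set (two_window n)"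
proof
  fix i assume "m \<le> n" "i \<in> set (two_window m)"
  then obtain j where "j < 2 * m" "i = int j - int m" by (auto simp: two_window_def)
  with \<open>m \<le> n\<close> show "i \<in> set (two_window n)"
    unfolding two_window_def by (auto intro!: image_eqI[of _ _ "j + (n - m)"])
qed

lemma two_window_eq_wcyl:
  "{x \<in> two_sided A. map x (two_window m) = w} = (if length w = 2 * m then wcyl A (- int m) w else {})"
  by (auto simp: wcyl_eq_words two_window_def o_def)

lemma measure_le_of_wcyl:
  fixes A :: "'e::countable \<Rightarrow> 'e \<Rightarrow> bool"
  assumes "finite_measure M" "finite_measure N"
    "sets M = sets (seq_borel (two_sided A))" "sets N = sets (seq_borel (two_sided A))"
    and "\<And>k w. measure M (wcyl A k w) \<le> measure N (wcyl A k w)" and "B \<in> sets M"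
  shows "measure M B \<le> measure N B"
  by (rule measure_le_of_windows[OF covering_two_window assms(1-4) _ assms(6)])
    (simp add: two_window_eq_wcyl assms(5))

lemma measure_eq_of_wcyl:
  fixes A :: "'e::countable \<Rightarrow> 'e \<Rightarrow> bool"
  assumes "finite_measure M" "finite_measure N"
    "sets M = sets (seq_borel (two_sided A))" "sets N = sets (seq_borel (two_sided A))"
    and "\<And>k w. measure M (wcyl A k w) = measure N (wcyl A k w)"
  shows "M = N"
  by (rule measure_eq_of_windows[OF covering_two_window assms(1-4)])
    (simp add: two_window_eq_wcyl assms(5))

lemma emeasure_split_words:
  fixes A :: "'e::countable \<Rightarrow> 'e \<Rightarrow> bool"
  assumes M: "sets M = sets (seq_borel (two_sided A))" and B: "B \<in> sets M"
  shows "wsum n (\<lambda>w. emeasure M (B \<inter> wcyl A k w)) = emeasure M B"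
proof -
  have "B \<subseteq> two_sided A" using sets.sets_into_space[OF B] sets_eq_imp_space_eq[OF M] by simp
  moreover have "x \<in> wcyl A k (map (\<lambda>j. x (k + int j)) [0..<n])" if "x \<in> two_sided A" for x
    using that by (simp add: wcyl_def)
  ultimately have "x \<in> (\<Union>w\<in>{w. length w = n}. B \<inter> wcyl A k w)" if "x \<in> B" for x
    using that by (intro UN_I[of "map (\<lambda>j. x (k + int j)) [0..<n]"]) auto
  then have "B = (\<Union>w\<in>{w. length w = n}. B \<inter> wcyl A k w)" by blast
  then have "emeasure M B = emeasure M (\<Union>w\<in>{w. length w = n}. B \<inter> wcyl A k w)" by simp
  also have "\<dots> = (\<integral>\<^sup>+w. emeasure M (B \<inter> wcyl A k w) \<partial>count_space {w. length w = n})"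
  proof (rule emeasure_UN_countable)
    show "B \<inter> wcyl A k w \<in> sets M" for w using B M by (intro sets.Int) auto
    show "disjoint_family_on (\<lambda>w. B \<inter> wcyl A k w) {w. length w = n}"
      unfolding disjoint_family_on_def using wcyl_disjoint[of _ _ A k] by blast
  qed auto
  finally show ?thesis by (simp add: wsum_eq_nn_integral)
qed

lemma shift_measurable [measurable]:
  fixes A :: "'e::countable \<Rightarrow> 'e \<Rightarrow> bool"
  shows "shift \<in> measurable (seq_borel (two_sided A)) (seq_borel (two_sided A))"
proof (rule measurable_seq_borel)
  show "(\<lambda>x. shift x i) \<in> measurable (seq_borel (two_sided A)) (count_space UNIV)" for i
    unfolding shift_def by measurable
qed (simp add: shift_two_sided)

lemma
  fixes A :: "'e::countable \<Rightarrow> 'e \<Rightarrow> bool"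
  assumes "invariant_prob A \<mu>"
  shows invariant_prob_space: "prob_space \<mu>"
    and invariant_sets: "sets \<mu> = sets (seq_borel (two_sided A))"
    and invariant_space: "space \<mu> = two_sided A"
    and invariant_shift_measurable: "shift \<in> measurable \<mu> \<mu>"
    and invariant_distr: "distr \<mu> \<mu> shift = \<mu>"
proof -
  show "prob_space \<mu>" and s: "sets \<mu> = sets (seq_borel (two_sided A))"
    using assms by (auto simp: invariant_prob_def)
  show "space \<mu> = two_sided A" using sets_eq_imp_space_eq[OF s] by simp
  show "shift \<in> measurable \<mu> \<mu>"
    by (subst measurable_cong_sets[OF s s]) (rule shift_measurable)
  show "distr \<mu> \<mu> shift = \<mu>"
  proof -
    have "distr \<mu> \<mu> shift = distr \<mu> (seq_borel (two_sided A)) shift"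
      by (rule distr_cong) (simp_all add: s)
    then show ?thesis using assms by (simp add: invariant_prob_def)
  qed
qed

lemma measure_shift_vimage:
  fixes A :: "'e::countable \<Rightarrow> 'e \<Rightarrow> bool"
  assumes "invariant_prob A \<mu>" "B \<in> sets \<mu>"
  shows "measure \<mu> (shift -` B \<inter> two_sided A) = measure \<mu> B"
  using measure_distr[OF invariant_shift_measurable[OF assms(1)] assms(2)]
  by (simp add: invariant_distr[OF assms(1)] invariant_space[OF assms(1)])

lemma measure_wcyl:
  fixes A :: "'e::countable \<Rightarrow> 'e \<Rightarrow> bool"
  assumes "invariant_prob A \<mu>"
  shows "measure \<mu> (wcyl A k w) = measure \<mu> (cylinder A w)"
proof -
  have step: "measure \<mu> (wcyl A (k + 1) w) = measure \<mu> (wcyl A k w)" for k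
    using measure_shift_vimage[OF assms, of "wcyl A k w"] by (simp add: shift_wcyl invariant_sets[OF assms])
  show ?thesis unfolding cylinder_eq_wcyl
  proof (induction k rule: int_induct[where k=0])
    case (step2 i)
    then show ?case using step[of "i - 1"] by simp
  qed (simp_all add: step)
qed

text \<open>The two-sided sequence \<open>\<omega>\<close> is encoded as the one-sided sequence of the pairs
  \<open>(\<omega> n, \<omega> (- n - 1))\<close>.\<close>

lemma two_sided_measure_exists:
  fixes A :: "'e::countable \<Rightarrow> 'e \<Rightarrow> bool" and p :: "'e list \<Rightarrow> real"
  assumes p: "p [] = 1" "\<And>v. 0 \<le> p v"
    and snoc: "\<And>v. (\<integral>\<^sup>+e. ennreal (p (v @ [e])) \<partial>count_space UNIV) = ennreal (p v)"
    and Cons: "\<And>v. (\<integral>\<^sup>+e. ennreal (p (e # v)) \<partial>count_space UNIV) = ennreal (p v)"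
    and adm: "\<And>a b. \<not> A a b \<Longrightarrow> p [a, b] = 0"
  shows "\<exists>\<mu>. invariant_prob A \<mu> \<and> (\<forall>k w. measure \<mu> (wcyl A k w) = p w)"
proof -
  \<comment> \<open>First components are read to the right from 0 and second components to the left
    from -1, hence the reversal.\<close>
  define q where "q u = p (rev (map snd u) @ map fst u)" for u :: "('e \<times> 'e) list"
  have "(\<integral>\<^sup>+ab. ennreal (q (u @ [ab])) \<partial>count_space UNIV) = ennreal (q u)" for u
  proof -
    have "(\<integral>\<^sup>+ab. ennreal (q (u @ [ab])) \<partial>count_space UNIV)
      = (\<integral>\<^sup>+a. \<integral>\<^sup>+b. ennreal (p (b # (rev (map snd u) @ map fst u @ [a]))) \<partial>count_space UNIV \<partial>count_space UNIV)"
      by (subst nn_integral_fst_count_space[symmetric]) (simp add: q_def)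
    also have "\<dots> = (\<integral>\<^sup>+a. ennreal (p ((rev (map snd u) @ map fst u) @ [a])) \<partial>count_space UNIV)"
      by (simp only: Cons append_assoc)
    finally show ?thesis unfolding snoc q_def .
  qed
  then obtain M where M: "prob_space M" "sets M = sets (seq_borel (UNIV :: (nat \<Rightarrow> 'e \<times> 'e) set))"
    and Mq: "\<And>u. measure M {x. map x [0..<length u] = u} = q u"
    using word_measure_exists[of q] p by (auto simp: q_def)
  interpret M: prob_space M by fact
  have spM: "space M = UNIV" using sets_eq_imp_space_eq[OF M(2)] by simp
  have coord [measurable]: "(\<lambda>x. x i) \<in> measurable M (count_space UNIV)" for i
    using coordinate_measurable[of i UNIV] by (simp add: measurable_cong_sets[OF M(2) refl])
  define \<Phi> :: "(nat \<Rightarrow> 'e \<times> 'e) \<Rightarrow> int \<Rightarrow> 'e"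
    where "\<Phi> x k = (if 0 \<le> k then fst (x (nat k)) else snd (x (nat (- k - 1))))" for x k
  have \<Phi>coord [measurable]: "(\<lambda>x. \<Phi> x k) \<in> measurable M (count_space UNIV)" for k
  proof -
    have "(\<lambda>x. fst (x i)) \<in> measurable M (count_space UNIV)" "(\<lambda>x. snd (x i)) \<in> measurable M (count_space UNIV)" for i
      by (rule measurable_compose[OF coord], simp)+
    then show ?thesis unfolding \<Phi>_def by (cases "0 \<le> k") auto
  qed
  define C where "C k w = {x. \<forall>j<length w. \<Phi> x (k + int j) = w ! j}" for k and w :: "'e list"
  have C_sets [measurable]: "C k w \<in> sets M" for k w
  proof -
    have "C k w = {x \<in> space M. \<forall>j<length w. \<Phi> x (k + int j) = w ! j}" by (simp add: C_def spM)
    also have "\<dots> \<in> sets M" by measurable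
    finally show ?thesis .
  qed
  have C_snoc: "C k (w @ [e]) = {x \<in> C k w. \<Phi> x (k + int (length w)) = e}" for k w e
    by (auto simp: C_def nth_append less_Suc_eq)
  have C_Cons: "C k (e # w) = {x \<in> C (k + 1) w. \<Phi> x k = e}" for k w e
    by (auto simp: C_def less_Suc_eq_0_disj add_ac)
  have full: "measure M (C (- int m) w) = p w" if w: "length w = 2 * m" for m w
  proof -
    define u where "u = map (\<lambda>i. (w ! (m + i), w ! (m - 1 - i))) [0..<m]"
    have lu: "length u = m" by (simp add: u_def)
    have "rev (map snd u) @ map fst u = w"
    proof (rule nth_equalityI)
      show "length (rev (map snd u) @ map fst u) = length w" by (simp add: lu w)
      fix i assume "i < length (rev (map snd u) @ map fst u)"
      then show "(rev (map snd u) @ map fst u) ! i = w ! i"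
        by (auto simp: nth_append rev_nth u_def)
    qed
    then have "p w = q u" by (simp add: q_def)
    also have "\<dots> = measure M {x. map x [0..<m] = u}" using Mq[of u] by (simp add: lu)
    also have "{x. map x [0..<m] = u} = C (- int m) w"
    proof (intro set_eqI iffI)
      fix x assume "x \<in> {x. map x [0..<m] = u}"
      then have x: "x i = (w ! (m + i), w ! (m - 1 - i))" if "i < m" for i
        using that by (auto simp: u_def)
      have "\<Phi> x (- int m + int j) = w ! j" if j: "j < 2 * m" for j
      proof (cases "j < m")
        case True
        then have "nat (- (- int m + int j) - 1) = m - 1 - j" by auto
        then show ?thesis using True x[of "m - 1 - j"] by (simp add: \<Phi>_def)
      next
        case False
        then have "nat (- int m + int j) = j - m" by auto
        then show ?thesis using False j x[of "j - m"] by (simp add: \<Phi>_def)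
      qed
      then show "x \<in> C (- int m) w" by (simp add: C_def w)
    next
      fix x assume "x \<in> C (- int m) w"
      then have x: "\<Phi> x (- int m + int j) = w ! j" if "j < 2 * m" for j using that by (simp add: C_def w)
      have "x i = (w ! (m + i), w ! (m - 1 - i))" if i: "i < m" for i
      proof (rule prod_eqI)
        show "fst (x i) = fst (w ! (m + i), w ! (m - 1 - i))" using x[of "m + i"] i by (simp add: \<Phi>_def)
        have "- int m + int (m - 1 - i) < 0" "nat (- (- int m + int (m - 1 - i)) - 1) = i" using i by auto
        then show "snd (x i) = snd (w ! (m + i), w ! (m - 1 - i))" using x[of "m - 1 - i"] i by (simp add: \<Phi>_def)
      qed
      then show "x \<in> {x. map x [0..<m] = u}" by (simp add: u_def)
    qed
    finally show ?thesis by simp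
  qed
  \<comment> \<open>A window inside the centred one is enlarged letter by letter, at the left until
    it starts at -m and then at the right; the induction is on the number of missing
    letters.\<close>
  have inner: "measure M (C k w) = p w" if "- int m \<le> k" "k + int (length w) \<le> int m" for m k w
    using that
  proof (induction "2 * m - length w" arbitrary: k w)
    case 0
    then have "k = - int m" "length w = 2 * m" by auto
    then show ?case using full by simp
  next
    case (Suc d)
    show ?case
    proof (cases "k = - int m")
      case False
      have "C k w = (\<Union>e. C (k - 1) (e # w))" by (auto simp: C_Cons)
      also have "emeasure M \<dots> = (\<integral>\<^sup>+e. emeasure M (C (k - 1) (e # w)) \<partial>count_space UNIV)"
        by (intro emeasure_UN_countable) (auto simp: disjoint_family_on_def C_Cons)
      also have "\<dots> = (\<integral>\<^sup>+e. ennreal (p (e # w)) \<partial>count_space UNIV)"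
        using Suc False by (intro nn_integral_cong) (simp add: M.emeasure_eq_measure)
      finally show ?thesis using p by (simp add: M.emeasure_eq_measure Cons)
    next
      case True
      have "C k w = (\<Union>e. C k (w @ [e]))" by (auto simp: C_snoc)
      also have "emeasure M \<dots> = (\<integral>\<^sup>+e. emeasure M (C k (w @ [e])) \<partial>count_space UNIV)"
        by (intro emeasure_UN_countable) (auto simp: disjoint_family_on_def C_snoc)
      also have "\<dots> = (\<integral>\<^sup>+e. ennreal (p (w @ [e])) \<partial>count_space UNIV)"
        using Suc True by (intro nn_integral_cong) (simp add: M.emeasure_eq_measure)
      finally show ?thesis using p by (simp add: M.emeasure_eq_measure snoc)
    qed
  qed
  have MC: "measure M (C k w) = p w" for k w
    by (rule inner[of "nat \<bar>k\<bar> + length w"]) auto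
  \<comment> \<open>The forbidden two-letter words and their positions are countable, and each has
    probability 0.\<close>
  have "AE x in M. \<forall>k. A (\<Phi> x k) (\<Phi> x (k + 1))"
    unfolding AE_all_countable
  proof
    fix k
    have "AE x in M. \<forall>ab\<in>{(a, b). \<not> A a b}. x \<notin> C k [fst ab, snd ab]"
    proof (subst AE_ball_countable)
      show "\<forall>ab\<in>{(a, b). \<not> A a b}. AE x in M. x \<notin> C k [fst ab, snd ab]"
      proof
        fix ab assume "ab \<in> {(a, b). \<not> A a b}"
        then have "emeasure M (C k [fst ab, snd ab]) = 0"
          using adm by (auto simp: M.emeasure_eq_measure MC)
        then show "AE x in M. x \<notin> C k [fst ab, snd ab]" by (intro AE_not_in) (auto simp: null_sets_def)
      qed
    qed auto
    then show "AE x in M. A (\<Phi> x k) (\<Phi> x (k + 1))"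
      by eventually_elim (force simp: C_def less_Suc_eq numeral_2_eq_2)
  qed
  then have ae: "AE x in M. \<Phi> x \<in> two_sided A" by (simp add: two_sided_def)
  \<comment> \<open>An admissible point is wanted as the value on the exceptional null set. It
    exists because almost every x yields one.\<close>
  have "\<exists>y. y \<in> two_sided A"
  proof (rule ccontr)
    assume "\<not> (\<exists>y. y \<in> two_sided A)"
    then have "AE x in M. False" using ae by simp
    then show False by simp
  qed
  then obtain y where y: "y \<in> two_sided A" by blast
  define \<Psi> where "\<Psi> x = (if \<Phi> x \<in> two_sided A then \<Phi> x else y)" for x
  have [measurable]: "Measurable.pred M (\<lambda>x. \<Phi> x \<in> two_sided A)"
    unfolding two_sided_def mem_Collect_eq
    by (intro pred_intros_countable measurable_compose[OF \<Phi>coord] measurable_compose_countable[where f="\<lambda>a x. A a (\<Phi> x _)"]) simp_all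
  have \<Psi> [measurable]: "\<Psi> \<in> measurable M (seq_borel (two_sided A))"
  proof (rule measurable_seq_borel)
    show "(\<lambda>x. \<Psi> x i) \<in> measurable M (count_space UNIV)" for i
      unfolding \<Psi>_def if_distrib[of "\<lambda>f. f i"] by measurable
  qed (simp add: \<Psi>_def y)
  define \<mu> where "\<mu> = distr M (seq_borel (two_sided A)) \<Psi>"
  interpret \<mu>: prob_space \<mu> unfolding \<mu>_def by (rule M.prob_space_distr) simp
  have s\<mu>: "sets \<mu> = sets (seq_borel (two_sided A))" by (simp add: \<mu>_def)
  have \<mu>: "measure \<mu> (wcyl A k w) = p w" for k w
  proof -
    have "measure \<mu> (wcyl A k w) = measure M (\<Psi> -` wcyl A k w \<inter> space M)"
      unfolding \<mu>_def by (intro measure_distr) auto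
    also have "\<dots> = measure M (C k w)"
    proof (rule M.finite_measure_eq_AE)
      show "AE x in M. (x \<in> \<Psi> -` wcyl A k w \<inter> space M) = (x \<in> C k w)"
        using ae by eventually_elim (auto simp: \<Psi>_def C_def wcyl_def spM)
      show "\<Psi> -` wcyl A k w \<inter> space M \<in> sets M" by (rule measurable_sets[OF \<Psi>]) simp
    qed simp
    finally show ?thesis by (simp add: MC)
  qed
  have "distr \<mu> (seq_borel (two_sided A)) shift = \<mu>"
  proof (rule measure_eq_of_wcyl)
    have sm: "shift \<in> measurable \<mu> (seq_borel (two_sided A))"
      by (simp add: measurable_cong_sets[OF s\<mu> refl])
    then show "finite_measure (distr \<mu> (seq_borel (two_sided A)) shift)"
      by (rule \<mu>.finite_measure_distr)
    show "measure (distr \<mu> (seq_borel (two_sided A)) shift) (wcyl A k w) = measure \<mu> (wcyl A k w)" for k w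
      using sm sets_eq_imp_space_eq[OF s\<mu>]
      by (subst measure_distr) (simp_all add: shift_wcyl \<mu>)
  qed (simp_all add: s\<mu> \<mu>.finite_measure_axioms)
  then show ?thesis
    using \<mu> s\<mu> \<mu>.prob_space_axioms unfolding invariant_prob_def by blast
qed

section \<open>Gibbs bounds expressed by word weights\<close>

lemma admissible_bridge:
  assumes "x \<noteq> []" "v \<noteq> []" "admissible A x" "admissible A v" "admissible A (last x # \<gamma> @ [hd v])"
  shows "admissible A (x @ \<gamma> @ v)"
proof (cases "\<gamma> = []")
  case True
  then show ?thesis using assms by (simp add: admissible_append admissible_Cons)
next
  case False
  have "admissible A (\<gamma> @ [hd v])" "A (last x) (hd (\<gamma> @ [hd v]))"
    using assms(5) unfolding admissible_Cons[of A "last x"] by auto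
  then have "admissible A \<gamma>" "A (last \<gamma>) (hd v)" "A (last x) (hd \<gamma>)"
    using False by (auto simp: admissible_append[of A \<gamma> "[hd v]"])
  then show ?thesis using assms False by (simp add: admissible_append[of A x] admissible_append[of A \<gamma> v])
qed

lemma nonpos_of_exp_bounded:
  fixes a B :: real
  assumes "\<And>n::nat. 1 \<le> n \<Longrightarrow> exp (a * real n) \<le> B"
  shows "a \<le> 0"
proof (rule ccontr)
  assume "\<not> a \<le> 0"
  then have a: "0 < a" by simp
  obtain n :: nat where n: "B / a < real n" using reals_Archimedean2 by blast
  have "B < a * real (Suc n)" using n a by (simp add: field_simps)
  also have "\<dots> \<le> exp (a * real (Suc n))" using exp_ge_add_one_self[of "a * real (Suc n)"] by linarith
  also have "\<dots> \<le> B" by (rule assms) simp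
  finally show False by simp
qed

context hoelder_shift
begin

text \<open>The Gibbs property with weights instead of Birkhoff sums at points, so that inadmissible
  words are covered too, and with the exponent already equal to the pressure.\<close>

definition gibbs_bounds :: "(int \<Rightarrow> 'e) measure \<Rightarrow> real \<Rightarrow> bool" where
  "gibbs_bounds \<mu> c \<longleftrightarrow> invariant_prob A \<mu> \<and> 1 \<le> c \<and> (\<forall>v. v \<noteq> [] \<longrightarrow>
     wt v * exp (- P * real (length v)) / c \<le> measure \<mu> (cylinder A v) \<and>
     measure \<mu> (cylinder A v) \<le> c * wt v * exp (- P * real (length v)))"

lemma
  assumes "gibbs_bounds \<mu> c"
  shows gibbs_bounds_invariant: "invariant_prob A \<mu>"
    and gibbs_bounds_const: "1 \<le> c"
    and gibbs_bounds_lower: "v \<noteq> [] \<Longrightarrow> wt v * exp (- P * real (length v)) / c \<le> measure \<mu> (wcyl A k v)"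
    and gibbs_bounds_upper: "v \<noteq> [] \<Longrightarrow> measure \<mu> (wcyl A k v) \<le> c * wt v * exp (- P * real (length v))"
  using assms measure_wcyl[of A \<mu>] unfolding gibbs_bounds_def by auto

lemma gibbs_bounds_exists: "\<exists>\<mu>. gibbs_bounds \<mu> G"
proof -
  obtain p :: "'e list \<Rightarrow> real" where p: "p [] = 1" "\<And>v. 0 \<le> p v"
    "\<And>v. (\<integral>\<^sup>+e. ennreal (p (v @ [e])) \<partial>count_space UNIV) = ennreal (p v)"
    "\<And>v. (\<integral>\<^sup>+e. ennreal (p (e # v)) \<partial>count_space UNIV) = ennreal (p v)"
    and bounds: "\<And>v. v \<noteq> [] \<Longrightarrow> wt v * exp (- P * real (length v)) / G \<le> p v \<and> p v \<le> G * wt v * exp (- P * real (length v))"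
    using gibbs_words_exist by blast
  have "p [a, b] = 0" if "\<not> A a b" for a b
  proof -
    have "wt [a, b] = 0" using that by (intro wt_eq_0) (simp add: admissible_Cons)
    then show ?thesis using bounds[of "[a, b]"] by simp
  qed
  then obtain \<mu> where \<mu>: "invariant_prob A \<mu>" "\<And>k w. measure \<mu> (wcyl A k w) = p w"
    using two_sided_measure_exists[of p A] p by blast
  have "gibbs_bounds \<mu> G"
    unfolding gibbs_bounds_def cylinder_eq_wcyl \<mu>(2) using \<mu>(1) bounds G_ge_1 by blast
  then show ?thesis by blast
qed

lemma word_of_point: "\<omega> \<in> two_sided A \<Longrightarrow> \<omega> \<in> cylinder A (map (\<lambda>j. \<omega> (int j)) [0..<n])"
  by (simp add: cylinder_def)

lemma gibbs_state_of_bounds: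
  assumes "gibbs_bounds \<mu> c"
  shows "gibbs_state A \<psi> \<mu>"
proof -
  note c = gibbs_bounds_const[OF assms]
  have "inverse (c * K) \<le> measure \<mu> (cylinder A (map (\<lambda>j. \<omega> (int j)) [0..<n])) / exp (birkhoff_sum \<psi> n \<omega> - P * real n) \<and>
    measure \<mu> (cylinder A (map (\<lambda>j. \<omega> (int j)) [0..<n])) / exp (birkhoff_sum \<psi> n \<omega> - P * real n) \<le> c * K"
    if n: "1 \<le> n" and \<omega>: "\<omega> \<in> two_sided A" for n \<omega>
  proof -
    define v where "v = map (\<lambda>j. \<omega> (int j)) [0..<n]"
    define m where "m = measure \<mu> (cylinder A v)"
    define E where "E = exp (birkhoff_sum \<psi> n \<omega>)"
    define q where "q = exp (- P * real n)"
    have E: "0 < E" and q: "0 < q" by (auto simp: E_def q_def)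
    have v: "\<omega> \<in> cylinder A v" "length v = n" "v \<noteq> []"
      using word_of_point[OF \<omega>] n by (auto simp: v_def)
    have w: "E \<le> wt v" "wt v \<le> K * E"
      using wt_lower[OF v(1)] wt_upper[OF v(1)] by (auto simp: v(2) E_def)
    have m: "wt v * q / c \<le> m" "m \<le> c * wt v * q"
      using gibbs_bounds_lower[OF assms v(3), of 0] gibbs_bounds_upper[OF assms v(3), of 0]
      by (auto simp: m_def q_def v(2) cylinder_eq_wcyl)
    have "exp (birkhoff_sum \<psi> n \<omega> - P * real n) = E * q" by (simp add: E_def q_def exp_add[symmetric])
    moreover have "inverse (c * K) * (E * q) \<le> m"
    proof -
      have "inverse (c * K) * (E * q) \<le> inverse c * (E * q)"
        using c K_ge_1 E q by (intro mult_right_mono le_imp_inverse_le) auto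
      also have "\<dots> \<le> inverse c * (wt v * q)" using c q w by (intro mult_left_mono mult_right_mono) auto
      also have "\<dots> \<le> m" using m(1) by (simp add: field_simps)
      finally show ?thesis .
    qed
    moreover have "m \<le> c * K * (E * q)"
    proof -
      have "c * wt v * q \<le> c * (K * E) * q" using c q w by (intro mult_left_mono mult_right_mono) auto
      then show ?thesis using m(2) by (simp add: mult_ac)
    qed
    ultimately show ?thesis
      using E q by (simp add: v_def[symmetric] m_def[symmetric] pos_le_divide_eq pos_divide_le_eq)
  qed
  moreover have "1 \<le> c * K" using c K_ge_1 by (rule mult_ge1_I)
  ultimately show ?thesis using gibbs_bounds_invariant[OF assms] unfolding gibbs_state_def by blast
qed

lemma wsum_measure_cylinder:
  assumes "invariant_prob A \<mu>"
  shows "wsum n (\<lambda>v. ennreal (measure \<mu> (cylinder A v))) = 1"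
proof -
  interpret prob_space \<mu> by (rule invariant_prob_space[OF assms])
  have "wsum n (\<lambda>w. emeasure \<mu> (space \<mu> \<inter> wcyl A 0 w)) = emeasure \<mu> (space \<mu>)"
    by (rule emeasure_split_words[OF invariant_sets[OF assms]]) simp
  moreover have "space \<mu> \<inter> wcyl A 0 w = cylinder A w" for w
    by (auto simp: invariant_space[OF assms] wcyl_def cylinder_def)
  ultimately show ?thesis by (simp add: emeasure_eq_measure prob_space)
qed

text \<open>The definition of a Gibbs state leaves the exponent p free. Summed over all words of
  length n, its bounds keep Z n * exp (- p n) between two positive constants, while Z n is
  comparable to exp (P n); growth in n then forces p = P.\<close>

lemma gibbs_state_imp_bounds:
  assumes "gibbs_state A \<psi> \<mu>"
  shows "\<exists>c. gibbs_bounds \<mu> c"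
proof -
  have inv: "invariant_prob A \<mu>" using assms by (simp add: gibbs_state_def)
  obtain C p where C: "1 \<le> C" and bd: "\<And>n \<omega>. 1 \<le> n \<Longrightarrow> \<omega> \<in> two_sided A \<Longrightarrow>
        inverse C \<le> measure \<mu> (cylinder A (map (\<lambda>j. \<omega> (int j)) [0..<n])) / exp (birkhoff_sum \<psi> n \<omega> - p * real n) \<and>
        measure \<mu> (cylinder A (map (\<lambda>j. \<omega> (int j)) [0..<n])) / exp (birkhoff_sum \<psi> n \<omega> - p * real n) \<le> C"
    using assms unfolding gibbs_state_def by blast
  have bounds: "wt v * exp (- p * real (length v)) \<le> C * K * measure \<mu> (cylinder A v) \<and>
      measure \<mu> (cylinder A v) \<le> C * K * (wt v * exp (- p * real (length v)))" if "v \<noteq> []" for v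
  proof (cases "admissible A v")
    case False
    then have "cylinder A v = {}" using cylinder_admissible by blast
    then show ?thesis using False by simp
  next
    case True
    then obtain \<omega> where \<omega>: "\<omega> \<in> cylinder A v" using cylinder_nonempty by blast
    then have v: "map (\<lambda>j. \<omega> (int j)) [0..<length v] = v" by (intro nth_equalityI) (auto simp: cylinder_def)
    define m where "m = measure \<mu> (cylinder A v)"
    define E where "E = exp (birkhoff_sum \<psi> (length v) \<omega>)"
    define q where "q = exp (- p * real (length v))"
    have E: "0 < E" and q: "0 < q" by (auto simp: E_def q_def)
    have w: "E \<le> wt v" "wt v \<le> K * E" using wt_lower[OF \<omega>] wt_upper[OF \<omega>] by (auto simp: E_def)
    have eq: "exp (birkhoff_sum \<psi> (length v) \<omega> - p * real (length v)) = E * q"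
      by (simp add: E_def q_def exp_add[symmetric])
    have "inverse C \<le> m / (E * q)" "m / (E * q) \<le> C"
      using bd[of "length v" \<omega>] that \<omega> unfolding v eq m_def[symmetric] by (auto simp: cylinder_def Suc_le_eq)
    then have m: "E * q \<le> C * m" "m \<le> C * (E * q)"
      using E q C by (auto simp: field_simps)
    have "wt v * q \<le> K * E * q" using w q by (intro mult_right_mono) auto
    also have "\<dots> \<le> K * (C * m)" using m K_ge_1 by simp
    finally have "wt v * q \<le> C * K * m" by (simp add: mult_ac)
    moreover have "m \<le> C * K * (wt v * q)"
    proof -
      have "E * q \<le> wt v * q" using w q by (intro mult_right_mono) auto
      also have "\<dots> \<le> K * (wt v * q)" using mult_right_mono[of 1 K "wt v * q"] K_ge_1 q by simp
      finally have "C * (E * q) \<le> C * (K * (wt v * q))" using C by (intro mult_left_mono) auto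
      then show ?thesis using m by (simp add: mult_ac)
    qed
    ultimately show ?thesis by (simp add: m_def q_def)
  qed
  have CK: "1 \<le> C * K" using C K_ge_1 by (rule mult_ge1_I)
  have sums: "Z n * exp (- p * real n) \<le> C * K \<and> 1 \<le> C * K * (Z n * exp (- p * real n))" if n: "1 \<le> n" for n
  proof
    have ne: "v \<noteq> []" if "length v = n" for v :: "'e list" using n that by auto
    have "ennreal (Z n * exp (- p * real n)) = wsum n (\<lambda>v. ewt v * ennreal (exp (- p * real n)))"
      by (simp add: wsum_multc Ze_def[symmetric] Ze_eq ennreal_mult)
    also have "\<dots> \<le> wsum n (\<lambda>v. ennreal (C * K) * ennreal (measure \<mu> (cylinder A v)))"
      using bounds ne CK by (intro wsum_mono) (force simp: ennreal_mult[symmetric] intro!: ennreal_leI)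
    also have "\<dots> = ennreal (C * K)" by (simp add: wsum_cmult wsum_measure_cylinder[OF inv])
    finally show "Z n * exp (- p * real n) \<le> C * K" using CK by simp
    have "1 = wsum n (\<lambda>v. ennreal (measure \<mu> (cylinder A v)))" by (simp add: wsum_measure_cylinder[OF inv])
    also have "\<dots> \<le> wsum n (\<lambda>v. ennreal (C * K) * (ewt v * ennreal (exp (- p * real n))))"
      using bounds ne CK by (intro wsum_mono) (force simp: ennreal_mult[symmetric] intro!: ennreal_leI)
    also have "\<dots> = ennreal (C * K * (Z n * exp (- p * real n)))"
      using C K_ge_1 by (simp add: wsum_cmult wsum_multc Ze_def[symmetric] Ze_eq ennreal_mult)
    finally show "1 \<le> C * K * (Z n * exp (- p * real n))"
      using CK by (simp del: ennreal_1 add: ennreal_1[symmetric])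
  qed
  have "P - p \<le> 0"
  proof (rule nonpos_of_exp_bounded)
    fix n :: nat assume "1 \<le> n"
    have "exp ((P - p) * real n) / Zc = exp (P * real n) / Zc * exp (- p * real n)"
      by (simp add: exp_add[symmetric] algebra_simps)
    also have "\<dots> \<le> Z n * exp (- p * real n)" by (intro mult_right_mono Z_pressure) auto
    also have "\<dots> \<le> C * K" using sums[OF \<open>1 \<le> n\<close>] by simp
    finally show "exp ((P - p) * real n) \<le> C * K * Zc" using Zc_ge_1 by (simp add: pos_divide_le_eq)
  qed
  moreover have "p - P \<le> 0"
  proof (rule nonpos_of_exp_bounded)
    fix n :: nat assume "1 \<le> n"
    have "1 \<le> C * K * (Z n * exp (- p * real n))" using sums[OF \<open>1 \<le> n\<close>] by simp
    also have "\<dots> \<le> C * K * (Zc * exp (P * real n) * exp (- p * real n))"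
      using CK by (intro mult_left_mono mult_right_mono Z_pressure) auto
    also have "\<dots> = C * K * Zc * (exp (P * real n) * exp (- p * real n))" by simp
    finally have "1 * exp ((p - P) * real n) \<le> C * K * Zc * (exp (P * real n) * exp (- p * real n)) * exp ((p - P) * real n)"
      by (intro mult_right_mono) auto
    also have "\<dots> = C * K * Zc * (exp (P * real n) * exp (- p * real n) * exp ((p - P) * real n))" by simp
    also have "exp (P * real n) * exp (- p * real n) * exp ((p - P) * real n) = 1"
      by (simp add: exp_add[symmetric] algebra_simps)
    finally show "exp ((p - P) * real n) \<le> C * K * Zc" by simp
  qed
  ultimately have "p = P" by simp
  have "gibbs_bounds \<mu> (C * K)"
    unfolding gibbs_bounds_def
    using inv CK bounds by (auto simp: \<open>p = P\<close> pos_divide_le_eq mult_ac)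
  then show ?thesis ..
qed

section \<open>Ergodicity and uniqueness\<close>

text \<open>A substitute for mixing: a single gap length may be impossible when \<open>A\<close> is periodic, but the
  sum over the connecting words is bounded below.\<close>

lemma mixing_words:
  assumes \<mu>: "gibbs_bounds \<mu> c"
  shows "\<exists>\<Phi> c'. finite (\<Phi> :: 'e list set) \<and> 0 \<le> c' \<and> (\<forall>u v g k. u \<noteq> [] \<longrightarrow> v \<noteq> [] \<longrightarrow> gap < g \<longrightarrow>
    emeasure \<mu> (wcyl A k u) * ennreal (measure \<mu> (cylinder A v)) \<le>
      ennreal c' * (\<Sum>\<gamma>\<in>\<Phi>. emeasure \<mu> (wcyl A k u \<inter> wcyl A (k + int (length u + g + length \<gamma>)) v)))"
proof -
  interpret prob_space \<mu> by (rule invariant_prob_space[OF gibbs_bounds_invariant[OF \<mu>]])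
  note s\<mu> = invariant_sets[OF gibbs_bounds_invariant[OF \<mu>]]
  note c = gibbs_bounds_const[OF \<mu>]
  obtain \<Phi> where \<Phi>: "finite \<Phi>" "\<And>\<gamma>. \<gamma> \<in> \<Phi> \<Longrightarrow> admissible A \<gamma>"
    "\<And>a b. \<exists>\<gamma>\<in>\<Phi>. admissible A (a # \<gamma> @ [b])" by (rule connecting_words) blast
  have "\<Phi> \<noteq> {}" using \<Phi>(3) by blast
  define q where "q n = exp (- P * real n)" for n :: nat
  have q_add: "q (m + n) = q m * q n" for m n by (simp add: q_def exp_add[symmetric] algebra_simps)
  have q_pos: "0 < q n" for n by (simp add: q_def)
  \<comment> \<open>A lower bound for the normalised weights of the connecting words; as there are
    finitely many, it is positive.\<close>
  define d where "d = Min ((\<lambda>\<gamma>. wt \<gamma> * q (length \<gamma>)) ` \<Phi>)"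
  have d: "0 < d" "\<And>\<gamma>. \<gamma> \<in> \<Phi> \<Longrightarrow> d \<le> wt \<gamma> * q (length \<gamma>)"
    using \<Phi>(1,2) \<open>\<Phi> \<noteq> {}\<close> q_pos by (auto simp: d_def)
  \<comment> \<open>\<open>c\<close> is the loss in the lower Gibbs bound, \<open>K ^ 3\<close> that
    of the three junctions in u x \<gamma> v.\<close>
  define e where "e = d / (c * K ^ 3)"
  have e: "0 < e" using d c K_ge_1 by (simp add: e_def)
  \<comment> \<open>\<open>c ^ 2\<close> bounds the two cylinder masses from above,
    \<open>Zc\<close> normalises \<open>Z g\<close>, and \<open>gap_const\<close> pays for
    restricting to words that can follow u.\<close>
  define c' where "c' = c ^ 2 * Zc * gap_const / e"
  have c': "0 \<le> c'" using c Zc_ge_1 gap_const_ge_1 e by (simp add: c'_def)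
  have "emeasure \<mu> (wcyl A k u) * ennreal (measure \<mu> (cylinder A v)) \<le>
      ennreal c' * (\<Sum>\<gamma>\<in>\<Phi>. emeasure \<mu> (wcyl A k u \<inter> wcyl A (k + int (length u + g + length \<gamma>)) v))"
    if ne: "u \<noteq> []" "v \<noteq> []" and g: "gap < g" for u v g k
  proof (cases "admissible A u \<and> admissible A v")
    case False
    then have "measure \<mu> (wcyl A k u) = 0 \<or> measure \<mu> (wcyl A 0 v) = 0"
      using gibbs_bounds_upper[OF \<mu> ne(1), of k] gibbs_bounds_upper[OF \<mu> ne(2), of 0]
      by (auto simp: measure_le_0_iff)
    then show ?thesis by (auto simp: emeasure_eq_measure cylinder_eq_wcyl)
  next
    case True
    let ?W = "\<lambda>\<gamma>. wcyl A k u \<inter> wcyl A (k + int (length u + g + length \<gamma>)) v"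
    let ?r = "e * (wt u * wt v * q (length u + g + length v))"
    have word: "?r * wt x \<le> measure \<mu> (wcyl A k (u @ x @ \<gamma> @ v))"
      if "\<gamma> \<in> \<Phi>" "length x = g" "admissible A (u @ x @ \<gamma> @ v)" for x \<gamma>
    proof -
      have a: "admissible A (x @ \<gamma> @ v)" "admissible A (\<gamma> @ v)"
        using that(3) by (auto simp: admissible_append)
      have "wt u * wt x * wt \<gamma> * wt v = wt u * (wt x * (wt \<gamma> * wt v))" by simp
      also have "\<dots> \<le> wt u * (wt x * (K * wt (\<gamma> @ v)))"
        by (intro mult_left_mono wt_append_ge a) auto
      also have "\<dots> = wt u * (K * (wt x * wt (\<gamma> @ v)))" by simp
      also have "\<dots> \<le> wt u * (K * (K * wt (x @ \<gamma> @ v)))"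
        using K_ge_1 by (intro mult_left_mono wt_append_ge a) auto
      also have "\<dots> = K ^ 2 * (wt u * wt (x @ \<gamma> @ v))" by (simp add: power2_eq_square)
      also have "\<dots> \<le> K ^ 2 * (K * wt (u @ x @ \<gamma> @ v))"
        by (intro mult_left_mono wt_append_ge that) auto
      also have "\<dots> = K ^ 3 * wt (u @ x @ \<gamma> @ v)" by (simp add: power2_eq_square power3_eq_cube)
      finally have *: "wt u * wt x * wt \<gamma> * wt v \<le> K ^ 3 * wt (u @ x @ \<gamma> @ v)" .
      have "?r * wt x = (wt u * wt x * wt v * q (length u + g + length v)) * d / (c * K ^ 3)"
        by (simp add: e_def)
      also have "\<dots> \<le> (wt u * wt x * wt v * q (length u + g + length v)) * (wt \<gamma> * q (length \<gamma>)) / (c * K ^ 3)"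
        using d(2)[OF that(1)] c K_ge_1 q_pos[of "length u + g + length v"]
        by (intro divide_right_mono mult_left_mono) auto
      also have "\<dots> = (wt u * wt x * wt \<gamma> * wt v) * q (length (u @ x @ \<gamma> @ v)) / (c * K ^ 3)"
        using that(2) by (simp add: q_add)
      also have "\<dots> \<le> (K ^ 3 * wt (u @ x @ \<gamma> @ v)) * q (length (u @ x @ \<gamma> @ v)) / (c * K ^ 3)"
        using * c K_ge_1 q_pos[of "length (u @ x @ \<gamma> @ v)"] by (intro divide_right_mono mult_right_mono) auto
      also have "\<dots> = wt (u @ x @ \<gamma> @ v) * q (length (u @ x @ \<gamma> @ v)) / c"
        using K_ge_1 by simp
      also have "\<dots> \<le> measure \<mu> (wcyl A k (u @ x @ \<gamma> @ v))"
        unfolding q_def using ne by (intro gibbs_bounds_lower[OF \<mu>]) simp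
      finally show ?thesis .
    qed
    have "Ze g \<le> ennreal gap_const * wsum g (\<lambda>x. if admissible A (last u # x) then ewt x else 0)"
      by (rule Ze_gap_from[OF g])
    then have "ennreal ?r * Ze g \<le> ennreal ?r * (ennreal gap_const * wsum g (\<lambda>x. if admissible A (last u # x) then ewt x else 0))"
      by (intro mult_left_mono) auto
    also have "\<dots> = ennreal gap_const * wsum g (\<lambda>x. ennreal ?r * (if admissible A (last u # x) then ewt x else 0))"
      by (simp add: wsum_cmult wsum_multc mult_ac)
    also have "\<dots> \<le> ennreal gap_const * wsum g (\<lambda>x. \<Sum>\<gamma>\<in>\<Phi>. emeasure \<mu> (?W \<gamma> \<inter> wcyl A (k + int (length u)) x))"
    proof (intro mult_left_mono wsum_mono)
      fix x :: "'e list" assume x: "length x = g"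
      then have "x \<noteq> []" using g by auto
      show "ennreal ?r * (if admissible A (last u # x) then ewt x else 0)
        \<le> (\<Sum>\<gamma>\<in>\<Phi>. emeasure \<mu> (?W \<gamma> \<inter> wcyl A (k + int (length u)) x))"
      proof (cases "admissible A (last u # x)")
        case adm: True
        \<comment> \<open>The connecting word depends on the last letter of x, so the bound must sum
          over all connecting words.\<close>
        obtain \<gamma> where \<gamma>: "\<gamma> \<in> \<Phi>" "admissible A (last x # \<gamma> @ [hd v])" using \<Phi>(3) by blast
        have "admissible A ((u @ x) @ \<gamma> @ v)"
        proof -
          have "admissible A (u @ x)" using True adm \<open>x \<noteq> []\<close> by (auto simp: admissible_append admissible_Cons)
          then show ?thesis using True \<gamma>(2) ne \<open>x \<noteq> []\<close> by (intro admissible_bridge) auto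
        qed
        then have "?r * wt x \<le> measure \<mu> (wcyl A k (u @ x @ \<gamma> @ v))" using \<gamma> x by (intro word) auto
        then have "ennreal ?r * ewt x \<le> emeasure \<mu> (wcyl A k (u @ x @ \<gamma> @ v))"
          using e q_pos[of "length u + g + length v"]
          by (simp add: emeasure_eq_measure ennreal_mult[symmetric] ennreal_leI)
        also have "wcyl A k (u @ x @ \<gamma> @ v) \<subseteq> ?W \<gamma> \<inter> wcyl A (k + int (length u)) x"
          by (auto simp: wcyl_append x add.assoc)
        then have "emeasure \<mu> (wcyl A k (u @ x @ \<gamma> @ v)) \<le> emeasure \<mu> (?W \<gamma> \<inter> wcyl A (k + int (length u)) x)"
          by (intro emeasure_mono) (auto simp: s\<mu>)
        also have "\<dots> \<le> (\<Sum>\<gamma>\<in>\<Phi>. emeasure \<mu> (?W \<gamma> \<inter> wcyl A (k + int (length u)) x))"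
          using \<gamma>(1) \<Phi>(1) by (intro member_le_sum) auto
        finally show ?thesis using adm by simp
      qed simp
    qed auto
    \<comment> \<open>The cylinders of the words x of length g partition the space, so the
      intermediate letters are summed out.\<close>
    also have "wsum g (\<lambda>x. \<Sum>\<gamma>\<in>\<Phi>. emeasure \<mu> (?W \<gamma> \<inter> wcyl A (k + int (length u)) x)) = (\<Sum>\<gamma>\<in>\<Phi>. emeasure \<mu> (?W \<gamma>))"
      unfolding wsum_sum[OF \<Phi>(1)] by (intro sum.cong refl emeasure_split_words[OF s\<mu>]) (auto simp: s\<mu>)
    finally have main: "ennreal ?r * Ze g \<le> ennreal gap_const * (\<Sum>\<gamma>\<in>\<Phi>. emeasure \<mu> (?W \<gamma>))" .
    have "measure \<mu> (wcyl A k u) * measure \<mu> (cylinder A v) \<le> (c * wt u * q (length u)) * (c * wt v * q (length v))"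
      unfolding q_def cylinder_eq_wcyl using c by (intro mult_mono gibbs_bounds_upper[OF \<mu>] ne) auto
    also have "\<dots> = c ^ 2 * (wt u * wt v * q (length u + length v))"
      by (simp add: q_add power2_eq_square)
    also have "\<dots> \<le> (c ^ 2 * Zc / e) * (?r * Z g)"
    proof -
      have "1 \<le> Zc * (q g * Z g)"
      proof -
        have "1 = q g * exp (P * real g)" by (simp add: q_def exp_add[symmetric])
        also have "\<dots> \<le> q g * (Zc * Z g)"
          using Z_pressure(1)[of g] Zc_ge_1 q_pos[of g] by (intro mult_left_mono) (auto simp: pos_divide_le_eq mult.commute)
        finally show ?thesis by (simp add: mult_ac)
      qed
      then have "c ^ 2 * (wt u * wt v * q (length u + length v)) * 1 \<le> c ^ 2 * (wt u * wt v * q (length u + length v)) * (Zc * (q g * Z g))"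
        using q_pos[of "length u + length v"] by (intro mult_left_mono) auto
      also have "\<dots> = (c ^ 2 * Zc / e) * (?r * Z g)" using e by (simp add: q_add mult_ac)
      finally show ?thesis by simp
    qed
    finally have "emeasure \<mu> (wcyl A k u) * ennreal (measure \<mu> (cylinder A v)) \<le> ennreal (c ^ 2 * Zc / e) * (ennreal ?r * Ze g)"
      using c Zc_ge_1 e q_pos[of "length u + g + length v"]
      by (simp add: emeasure_eq_measure Ze_eq ennreal_mult[symmetric] ennreal_leI)
    also have "\<dots> \<le> ennreal (c ^ 2 * Zc / e) * (ennreal gap_const * (\<Sum>\<gamma>\<in>\<Phi>. emeasure \<mu> (?W \<gamma>)))"
      using main by (intro mult_left_mono) auto
    also have "\<dots> = ennreal c' * (\<Sum>\<gamma>\<in>\<Phi>. emeasure \<mu> (?W \<gamma>))"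
    proof -
      have "ennreal c' = ennreal (c ^ 2 * Zc / e) * ennreal gap_const"
        using c Zc_ge_1 e gap_const_ge_1 by (simp add: c'_def ennreal_mult[symmetric])
      then show ?thesis by (simp add: mult.assoc)
    qed
    finally show ?thesis .
  qed
  then show ?thesis using \<Phi>(1) c' by blast
qed

end

section \<open>Invariance of densities\<close>

definition unshift :: "(int \<Rightarrow> 'e) \<Rightarrow> int \<Rightarrow> 'e" where
  "unshift \<omega> = (\<lambda>k. \<omega> (k - 1))"

lemma unshift_shift [simp]: "unshift (shift \<omega>) = \<omega>"
  by (auto simp: shift_def unshift_def)

lemma unshift_two_sided: "\<omega> \<in> two_sided A \<Longrightarrow> unshift \<omega> \<in> two_sided A"
  unfolding two_sided_def unshift_def mem_Collect_eq
  by (metis add.commute add_diff_eq diff_add_cancel)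

lemma unshift_measurable [measurable]:
  fixes A :: "'e::countable \<Rightarrow> 'e \<Rightarrow> bool"
  shows "unshift \<in> measurable (seq_borel (two_sided A)) (seq_borel (two_sided A))"
proof (rule measurable_seq_borel)
  show "(\<lambda>x. unshift x i) \<in> measurable (seq_borel (two_sided A)) (count_space UNIV)" for i
    unfolding unshift_def by measurable
qed (simp add: unshift_two_sided)

text \<open>Every measurable set is the shift preimage of its \<open>unshift\<close> preimage.
  Changing variables by invariance of \<mu>, and then using invariance of \<nu>, shows that f and
  its composition with the shift are densities of the same measure.\<close>

lemma invariant_density:
  fixes A :: "'e::countable \<Rightarrow> 'e \<Rightarrow> bool"
  assumes \<mu>: "invariant_prob A \<mu>" and \<nu>: "invariant_prob A \<nu>"
    and f: "f \<in> borel_measurable \<mu>" and d: "density \<mu> f = \<nu>"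
  shows "AE x in \<mu>. f (shift x) = f x"
proof -
  interpret \<mu>: prob_space \<mu> by (rule invariant_prob_space[OF \<mu>])
  note s\<mu> = invariant_sets[OF \<mu>] and s\<nu> = invariant_sets[OF \<nu>]
  note shm = invariant_shift_measurable[OF \<mu>]
  have fs: "(\<lambda>x. f (shift x)) \<in> borel_measurable \<mu>"
    by (rule measurable_compose[OF shm f])
  have um: "unshift \<in> measurable \<mu> \<mu>"
    by (subst measurable_cong_sets[OF s\<mu> s\<mu>]) (rule unshift_measurable)
  have "density \<mu> (\<lambda>x. f (shift x)) = density \<mu> f"
  proof (rule measure_eqI)
    fix D assume "D \<in> sets (density \<mu> (\<lambda>x. f (shift x)))"
    then have D: "D \<in> sets \<mu>" by simp
    define D' where "D' = unshift -` D \<inter> space \<mu>"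
    have D': "D' \<in> sets \<mu>" unfolding D'_def by (rule measurable_sets[OF um D])
    have ind: "indicator D x = (indicator D' (shift x) :: ennreal)" if "x \<in> space \<mu>" for x
      using that shift_two_sided[of x A] by (auto simp: D'_def invariant_space[OF \<mu>] split: split_indicator)
    have pre: "shift -` D' \<inter> two_sided A = D"
      using sets.sets_into_space[OF D] shift_two_sided[of _ A] by (auto simp: D'_def invariant_space[OF \<mu>])
    have fi: "(\<lambda>x. f x * indicator D' x) \<in> borel_measurable \<mu>" using f D' by measurable
    have "emeasure (density \<mu> (\<lambda>x. f (shift x))) D = (\<integral>\<^sup>+x. f (shift x) * indicator D x \<partial>\<mu>)"
      using fs D by (rule emeasure_density)
    also have "\<dots> = (\<integral>\<^sup>+x. (\<lambda>y. f y * indicator D' y) (shift x) \<partial>\<mu>)"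
      by (intro nn_integral_cong) (simp add: ind)
    also have "\<dots> = (\<integral>\<^sup>+y. f y * indicator D' y \<partial>distr \<mu> \<mu> shift)"
      by (rule nn_integral_distr[OF shm, symmetric]) (use fi in simp)
    also have "\<dots> = emeasure (density \<mu> f) D'"
      unfolding invariant_distr[OF \<mu>] using f D' by (rule emeasure_density[symmetric])
    also have "\<dots> = emeasure (density \<mu> f) D"
    proof -
      interpret \<nu>: prob_space \<nu> by (rule invariant_prob_space[OF \<nu>])
      have "D' \<in> sets \<nu>" using D' by (simp add: s\<mu> s\<nu>)
      from measure_shift_vimage[OF \<nu> this] show ?thesis
        unfolding d pre by (simp add: \<nu>.emeasure_eq_measure)
    qed
    finally show "emeasure (density \<mu> (\<lambda>x. f (shift x))) D = emeasure (density \<mu> f) D" .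
  qed simp
  then show ?thesis by (rule \<mu>.density_unique[OF fs f])
qed

context hoelder_shift
begin

text \<open>Mixing of words passes to an invariant set through approximation by finitely many
  coordinates. It gives \<mu>(B) \<mu>(V) \<le> b \<mu>(B \<inter> V), up to enlarging b, first for
  cylinders V and then for all measurable V. Taking the complement of B for V makes the right side
  0.\<close>

lemma gibbs_ergodic:
  assumes \<mu>: "gibbs_bounds \<mu> c" and B: "B \<in> sets \<mu>" and inv: "AE x in \<mu>. (shift x \<in> B) = (x \<in> B)"
  shows "measure \<mu> B = 0 \<or> measure \<mu> B = 1"
proof -
  note inv\<mu> = gibbs_bounds_invariant[OF \<mu>]
  interpret prob_space \<mu> by (rule invariant_prob_space[OF inv\<mu>])
  note s\<mu> = invariant_sets[OF inv\<mu>] and sp\<mu> = invariant_space[OF inv\<mu>]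
  have W: "wcyl A k w \<in> sets \<mu>" for k w by (simp add: s\<mu>)
  obtain \<Phi> :: "'e list set" and c' where \<Phi>: "finite \<Phi>" and c': "0 \<le> c'"
    and mix: "\<And>u v g k. u \<noteq> [] \<Longrightarrow> v \<noteq> [] \<Longrightarrow> gap < g \<Longrightarrow>
      emeasure \<mu> (wcyl A k u) * ennreal (measure \<mu> (cylinder A v)) \<le>
        ennreal c' * (\<Sum>\<gamma>\<in>\<Phi>. emeasure \<mu> (wcyl A k u \<inter> wcyl A (k + int (length u + g + length \<gamma>)) v))"
    using mixing_words[OF \<mu>] by blast
  \<comment> \<open>Each connecting word puts the cylinder at another position, but by invariance it
    contributes the same mass in B.\<close>
  define b where "b = c' * real (card \<Phi>)"
  have b: "0 \<le> b" using c' by (simp add: b_def)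
  have Bshift: "measure \<mu> (B \<inter> wcyl A (k + 1) v) = measure \<mu> (B \<inter> wcyl A k v)" for k v
  proof -
    have "measure \<mu> (B \<inter> wcyl A k v) = measure \<mu> (shift -` (B \<inter> wcyl A k v) \<inter> two_sided A)"
      using measure_shift_vimage[OF inv\<mu>, of "B \<inter> wcyl A k v"] B W by auto
    also have "\<dots> = measure \<mu> (B \<inter> wcyl A (k + 1) v)"
    proof (rule finite_measure_eq_AE)
      show "AE x in \<mu>. (x \<in> shift -` (B \<inter> wcyl A k v) \<inter> two_sided A) = (x \<in> B \<inter> wcyl A (k + 1) v)"
        using inv by eventually_elim (auto simp: shift_wcyl[symmetric])
      show "shift -` (B \<inter> wcyl A k v) \<inter> two_sided A \<in> sets \<mu>"
        using measurable_sets[OF invariant_shift_measurable[OF inv\<mu>], of "B \<inter> wcyl A k v"] B W by (auto simp: sp\<mu>)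
    qed (use B W in auto)
    finally show ?thesis by simp
  qed
  have Bwcyl: "measure \<mu> (B \<inter> wcyl A k v) = measure \<mu> (B \<inter> wcyl A 0 v)" for k v
  proof (induction k rule: int_induct[where k=0])
    case (step2 i)
    then show ?case using Bshift[of "i - 1"] by simp
  qed (simp_all add: Bshift)
  have key: "measure \<mu> B * measure \<mu> (wcyl A k v) \<le> b * measure \<mu> (B \<inter> wcyl A k v)" if v: "v \<noteq> []" for k v
  proof -
    let ?V = "wcyl A 0 v"
    have "measure \<mu> B * measure \<mu> ?V \<le> b * measure \<mu> (B \<inter> ?V) + \<epsilon>" if "0 < \<epsilon>" for \<epsilon>
    proof -
      \<comment> \<open>Replacing B by G0 costs at most \<delta> on the left and b * \<delta> on the
        right.\<close>
      define \<delta> where "\<delta> = \<epsilon> / (b + 1)"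
      have "\<delta> + b * \<delta> = (b + 1) * \<delta>" by (simp add: algebra_simps)
      then have \<delta>: "0 < \<delta>" "\<delta> + b * \<delta> = \<epsilon>" using b that by (auto simp: \<delta>_def)
      obtain G0 where G0: "G0 \<in> window_sets (two_sided A) two_window" "measure \<mu> (sym_diff B G0) < \<delta>"
        using algebra_approximation[OF algebra_window_sets[OF covering_two_window, of "two_sided A"] _ refl finite_measure_axioms finite_measure_axioms B \<delta>(1)]
          sets_seq_borel_window[OF covering_two_window, of "two_sided A"] s\<mu> by auto
      then obtain m0 S0 where m0: "G0 = {x \<in> two_sided A. map x (two_window m0) \<in> S0}" by (auto simp: window_sets_def)
      \<comment> \<open>The window is enlarged to make its words nonempty, as the mixing estimate
        requires.\<close>
      obtain S where "{x \<in> two_sided A. map x (two_window m0) \<in> S0} = {x \<in> two_sided A. map x (two_window (Suc m0)) \<in> S}"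
        using window_sets_refine[OF two_window_mono[of m0 "Suc m0"], of "two_sided A" S0] by auto
      then have GS: "G0 = {x \<in> two_sided A. map x (two_window (Suc m0)) \<in> S}" by (simp add: m0)
      define m where "m = Suc m0"
      have G0_sets: "G0 \<in> sets \<mu>" unfolding GS s\<mu> by (rule window_measurable)
      have piece: "G0 \<inter> wcyl A (- int m) u = (if u \<in> S then wcyl A (- int m) u else {})" if "length u = 2 * m" for u
      proof -
        have "wcyl A (- int m) u = {x \<in> two_sided A. map x (two_window m) = u}"
          using that by (simp add: two_window_eq_wcyl)
        then show ?thesis by (auto simp: GS m_def)
      qed
      \<comment> \<open>The window occupies 2 * m letters from -m on; \<open>Suc gap\<close> is the
        shortest gap that the mixing estimate allows.\<close>
      let ?k = "\<lambda>\<gamma> :: 'e list. - int m + int (2 * m + Suc gap + length \<gamma>)"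
      have "emeasure \<mu> G0 * ennreal (measure \<mu> (cylinder A v))
        = wsum (2 * m) (\<lambda>u. emeasure \<mu> (G0 \<inter> wcyl A (- int m) u) * ennreal (measure \<mu> (cylinder A v)))"
        by (simp add: wsum_multc emeasure_split_words[OF s\<mu> G0_sets])
      also have "\<dots> \<le> wsum (2 * m) (\<lambda>u. ennreal c' * (\<Sum>\<gamma>\<in>\<Phi>. emeasure \<mu> ((G0 \<inter> wcyl A (?k \<gamma>) v) \<inter> wcyl A (- int m) u)))"
      proof (rule wsum_mono)
        fix u :: "'e list" assume u: "length u = 2 * m"
        then have "u \<noteq> []" by (auto simp: m_def)
        show "emeasure \<mu> (G0 \<inter> wcyl A (- int m) u) * ennreal (measure \<mu> (cylinder A v))
          \<le> ennreal c' * (\<Sum>\<gamma>\<in>\<Phi>. emeasure \<mu> ((G0 \<inter> wcyl A (?k \<gamma>) v) \<inter> wcyl A (- int m) u))"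
        proof (cases "u \<in> S")
          case True
          have "(G0 \<inter> wcyl A (?k \<gamma>) v) \<inter> wcyl A (- int m) u = wcyl A (- int m) u \<inter> wcyl A (?k \<gamma>) v" for \<gamma>
            using piece[OF u] True by auto
          then show ?thesis
            using mix[OF \<open>u \<noteq> []\<close> v, of "Suc gap" "- int m"] piece[OF u] True u by simp
        next
          case False
          then show ?thesis using piece[OF u] by simp
        qed
      qed
      also have "\<dots> = ennreal c' * (\<Sum>\<gamma>\<in>\<Phi>. emeasure \<mu> (G0 \<inter> wcyl A (?k \<gamma>) v))"
      proof -
        have "wsum (2 * m) (\<lambda>u. emeasure \<mu> ((G0 \<inter> wcyl A (?k \<gamma>) v) \<inter> wcyl A (- int m) u)) = emeasure \<mu> (G0 \<inter> wcyl A (?k \<gamma>) v)" for \<gamma>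
          using G0_sets W by (intro emeasure_split_words[OF s\<mu>]) auto
        then show ?thesis by (simp add: wsum_cmult wsum_sum[OF \<Phi>])
      qed
      also have "\<dots> = ennreal (c' * (\<Sum>\<gamma>\<in>\<Phi>. measure \<mu> (G0 \<inter> wcyl A (?k \<gamma>) v)))"
        using c' by (simp add: emeasure_eq_measure sum_ennreal ennreal_mult[symmetric] sum_nonneg)
      finally have G0_mix: "measure \<mu> G0 * measure \<mu> ?V \<le> c' * (\<Sum>\<gamma>\<in>\<Phi>. measure \<mu> (G0 \<inter> wcyl A (?k \<gamma>) v))"
        using c' by (simp add: emeasure_eq_measure ennreal_mult[symmetric] cylinder_eq_wcyl sum_nonneg)
      have "measure \<mu> (G0 \<inter> wcyl A k v) \<le> measure \<mu> (B \<inter> ?V) + \<delta>" for k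
      proof -
        have "measure \<mu> (G0 \<inter> wcyl A k v) \<le> measure \<mu> ((B \<inter> wcyl A k v) \<union> sym_diff B G0)"
          using B G0_sets W by (intro finite_measure_mono) auto
        also have "\<dots> \<le> measure \<mu> (B \<inter> wcyl A k v) + measure \<mu> (sym_diff B G0)"
          using B G0_sets W by (intro measure_Un_le) auto
        finally show ?thesis using G0(2) Bwcyl[of k v] by simp
      qed
      then have "c' * (\<Sum>\<gamma>\<in>\<Phi>. measure \<mu> (G0 \<inter> wcyl A (?k \<gamma>) v)) \<le> c' * (\<Sum>\<gamma>\<in>\<Phi>. measure \<mu> (B \<inter> ?V) + \<delta>)"
        using c' by (intro mult_left_mono sum_mono) auto
      also have "\<dots> = b * (measure \<mu> (B \<inter> ?V) + \<delta>)" by (simp add: b_def)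
      finally have "measure \<mu> G0 * measure \<mu> ?V \<le> b * (measure \<mu> (B \<inter> ?V) + \<delta>)" using G0_mix by simp
      moreover have "measure \<mu> B * measure \<mu> ?V \<le> measure \<mu> G0 * measure \<mu> ?V + \<delta>"
      proof -
        have "measure \<mu> B \<le> measure \<mu> (G0 \<union> sym_diff B G0)"
          using B G0_sets by (intro finite_measure_mono) auto
        also have "\<dots> \<le> measure \<mu> G0 + measure \<mu> (sym_diff B G0)"
          using B G0_sets by (intro measure_Un_le) auto
        finally have "measure \<mu> B \<le> measure \<mu> G0 + \<delta>" using G0(2) by simp
        then have "measure \<mu> B * measure \<mu> ?V \<le> (measure \<mu> G0 + \<delta>) * measure \<mu> ?V" by (intro mult_right_mono) auto
        also have "\<dots> = measure \<mu> G0 * measure \<mu> ?V + \<delta> * measure \<mu> ?V" by (simp add: distrib_right)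
        also have "\<delta> * measure \<mu> ?V \<le> \<delta>" using \<delta>(1) by (simp add: mult_le_cancel_left1)
        finally show ?thesis by simp
      qed
      ultimately show ?thesis using \<delta>(2) by (simp add: distrib_left)
    qed
    then have "measure \<mu> B * measure \<mu> ?V \<le> b * measure \<mu> (B \<inter> ?V)" by (rule field_le_epsilon)
    then show ?thesis unfolding Bwcyl[of k v] measure_wcyl[OF inv\<mu>, of k v] cylinder_eq_wcyl .
  qed
  \<comment> \<open>The empty word, whose cylinder is the whole space, is not covered by
    \<open>key\<close>; a constant of at least 1 handles it.\<close>
  define b' where "b' = max b 1"
  define M where "M = density \<mu> (\<lambda>_. ennreal (measure \<mu> B))"
  define N where "N = density \<mu> (\<lambda>x. ennreal b' * indicator B x)"
  have mM: "measure M D = measure \<mu> B * measure \<mu> D" if "D \<in> sets \<mu>" for D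
    unfolding M_def using that by (simp add: measure_density_const)
  have eN: "emeasure N D = ennreal (b' * measure \<mu> (B \<inter> D))" if "D \<in> sets \<mu>" for D
  proof -
    have "emeasure N D = (\<integral>\<^sup>+x. (ennreal b' * indicator B x) * indicator D x \<partial>\<mu>)"
      unfolding N_def using B that by (intro emeasure_density) auto
    also have "\<dots> = (\<integral>\<^sup>+x. ennreal b' * indicator (B \<inter> D) x \<partial>\<mu>)"
      by (intro nn_integral_cong) (auto split: split_indicator)
    also have "\<dots> = ennreal b' * emeasure \<mu> (B \<inter> D)" using B that by (intro nn_integral_cmult_indicator) auto
    finally show ?thesis by (simp add: emeasure_eq_measure ennreal_mult b'_def)
  qed
  have mN: "measure N D = b' * measure \<mu> (B \<inter> D)" if "D \<in> sets \<mu>" for D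
    using eN[OF that] by (simp add: measure_def b'_def)
  have "measure M (two_sided A - B) \<le> measure N (two_sided A - B)"
  proof (rule measure_le_of_wcyl)
    show "finite_measure M"
      by (rule finite_measureI) (simp add: M_def emeasure_density_const emeasure_eq_measure ennreal_mult[symmetric])
    show "finite_measure N"
      by (rule finite_measureI) (use eN[of "space \<mu>"] in \<open>simp add: N_def\<close>)
    show "measure M (wcyl A k w) \<le> measure N (wcyl A k w)" for k w
    proof (cases "w = []")
      case True
      have "B \<inter> two_sided A = B" using sets.sets_into_space[OF B] sp\<mu> by auto
      moreover have "measure \<mu> (two_sided A) = 1" using prob_space sp\<mu> by simp
      moreover have "1 * measure \<mu> B \<le> b' * measure \<mu> B" by (intro mult_right_mono) (auto simp: b'_def)
      ultimately show ?thesis using True sets.top[of \<mu>] by (simp add: mM mN sp\<mu>)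
    next
      case False
      have "b * measure \<mu> (B \<inter> wcyl A k w) \<le> b' * measure \<mu> (B \<inter> wcyl A k w)"
        by (intro mult_right_mono) (auto simp: b'_def)
      then show ?thesis using key[OF False, of k] W by (simp add: mM mN)
    qed
    show "two_sided A - B \<in> sets M" using B sets.compl_sets[of B \<mu>] by (simp add: M_def sp\<mu>)
  qed (simp_all add: M_def N_def s\<mu>)
  then have "measure \<mu> B * measure \<mu> (two_sided A - B) \<le> 0"
    using B sets.compl_sets[of B \<mu>] by (simp add: mM mN sp\<mu>)
  then have "measure \<mu> B = 0 \<or> measure \<mu> (two_sided A - B) = 0"
    by (metis measure_nonneg mult_nonneg_nonneg antisym mult_eq_0_iff)
  then show ?thesis using prob_compl[OF B] by (auto simp: sp\<mu>)
qed

text \<open>With the lower bound for \<mu>, the hypothesis says that \<nu> is dominated by a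
  multiple of \<mu>, hence has an invariant density f. By ergodicity the level set where f > 1 is
  null or full, so f - 1 has a constant sign almost everywhere, and its integral is 0.\<close>

lemma gibbs_unique:
  assumes \<mu>: "gibbs_bounds \<mu> c" and \<nu>: "invariant_prob A \<nu>"
    and bd: "\<And>v. v \<noteq> [] \<Longrightarrow> measure \<nu> (cylinder A v) \<le> C * wt v * exp (- P * real (length v))"
  shows "\<nu> = \<mu>"
proof -
  note inv\<mu> = gibbs_bounds_invariant[OF \<mu>] and c = gibbs_bounds_const[OF \<mu>]
  interpret \<mu>: prob_space \<mu> by (rule invariant_prob_space[OF inv\<mu>])
  interpret \<nu>: prob_space \<nu> by (rule invariant_prob_space[OF \<nu>])
  note s\<mu> = invariant_sets[OF inv\<mu>] and sp\<mu> = invariant_space[OF inv\<mu>]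
  note s\<nu> = invariant_sets[OF \<nu>] and sp\<nu> = invariant_space[OF \<nu>]
  \<comment> \<open>\<open>max 1\<close> covers the cylinder of the empty word; the absolute value
    makes the factor nonnegative.\<close>
  define C' where "C' = max 1 (\<bar>C\<bar> * c)"
  have C': "1 \<le> C'" "\<bar>C\<bar> * c \<le> C'" by (auto simp: C'_def)
  define N where "N = density \<mu> (\<lambda>_. ennreal C')"
  have mN: "measure N D = C' * measure \<mu> D" if "D \<in> sets \<mu>" for D
    unfolding N_def using that C' by (simp add: measure_density_const)
  have le: "measure \<nu> D \<le> C' * measure \<mu> D" if D: "D \<in> sets \<mu>" for D
  proof -
    have "measure \<nu> D \<le> measure N D"
    proof (rule measure_le_of_wcyl[OF \<nu>.finite_measure_axioms _ s\<nu>])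
      show "finite_measure N"
        by (rule finite_measureI) (simp add: N_def emeasure_density_const \<mu>.emeasure_space_1)
      show "measure \<nu> (wcyl A k w) \<le> measure N (wcyl A k w)" for k w
      proof (cases "w = []")
        case True
        then show ?thesis
          using mN[of "two_sided A"] sets.top[of \<mu>] \<mu>.prob_space \<nu>.prob_space C' by (simp add: sp\<mu> sp\<nu>)
      next
        case False
        let ?q = "wt w * exp (- P * real (length w))"
        have "measure \<nu> (wcyl A k w) \<le> C * wt w * exp (- P * real (length w))"
          unfolding measure_wcyl[OF \<nu>] by (rule bd[OF False])
        also have "\<dots> \<le> \<bar>C\<bar> * ?q" by (simp add: mult.assoc mult_right_mono)
        also have "?q \<le> c * measure \<mu> (wcyl A k w)"
          using gibbs_bounds_lower[OF \<mu> False, of k] c by (simp add: pos_divide_le_eq mult.commute)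
        then have "\<bar>C\<bar> * ?q \<le> \<bar>C\<bar> * (c * measure \<mu> (wcyl A k w))" by (intro mult_left_mono) auto
        also have "\<dots> \<le> C' * measure \<mu> (wcyl A k w)"
          using C' by (simp add: mult.assoc[symmetric] mult_right_mono)
        finally show ?thesis by (simp add: mN s\<mu>)
      qed
    qed (simp_all add: N_def s\<mu> s\<nu> D[unfolded s\<mu>])
    then show ?thesis by (simp add: mN D)
  qed
  have "absolutely_continuous \<mu> \<nu>"
    unfolding absolutely_continuous_def
  proof
    fix D assume "D \<in> null_sets \<mu>"
    then have D: "D \<in> sets \<mu>" "measure \<mu> D = 0" by (auto simp: null_sets_def measure_def)
    then show "D \<in> null_sets \<nu>"
      using le[OF D(1)] by (auto simp: null_sets_def s\<mu> s\<nu> \<nu>.emeasure_eq_measure measure_le_0_iff)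
  qed
  then obtain f where f: "f \<in> borel_measurable \<mu>" "density \<mu> f = \<nu>"
    using \<mu>.Radon_Nikodym[of \<nu>] s\<mu> s\<nu> by auto
  have int_f: "(\<integral>\<^sup>+x. f x \<partial>\<mu>) = 1"
  proof -
    have "(\<integral>\<^sup>+x. f x \<partial>\<mu>) = emeasure (density \<mu> f) (space \<mu>)"
      using f(1) by (subst emeasure_density) (auto intro!: nn_integral_cong)
    then show ?thesis using f(2) \<nu>.emeasure_space_1 by (simp add: sp\<mu> sp\<nu>)
  qed
  have int_1: "(\<integral>\<^sup>+x. 1 \<partial>\<mu>) = 1" using \<mu>.emeasure_space_1 by simp
  define B where "B = {x \<in> space \<mu>. 1 < f x}"
  have B: "B \<in> sets \<mu>" unfolding B_def using f(1) by measurable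
  have "AE x in \<mu>. (shift x \<in> B) = (x \<in> B)"
    using invariant_density[OF inv\<mu> \<nu> f] AE_space
    by eventually_elim (use shift_two_sided[of _ A] in \<open>auto simp: B_def sp\<mu>\<close>)
  then have "measure \<mu> B = 0 \<or> measure \<mu> B = 1" by (rule gibbs_ergodic[OF \<mu> B])
  \<comment> \<open>Either alternative fixes the order in which f and 1 can be subtracted in
    \<open>ennreal\<close> without truncation.\<close>
  then have ord: "(AE x in \<mu>. f x \<le> 1) \<or> (AE x in \<mu>. 1 \<le> f x)"
  proof
    assume "measure \<mu> B = 0"
    then have "AE x in \<mu>. x \<notin> B" using B by (intro AE_not_in) (auto simp: null_sets_def \<mu>.emeasure_eq_measure)
    then have "AE x in \<mu>. f x \<le> 1" using AE_space by eventually_elim (auto simp: B_def)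
    then show ?thesis ..
  next
    assume "measure \<mu> B = 1"
    then have "AE x in \<mu>. x \<in> B" using B \<mu>.prob_eq_1 by blast
    then have "AE x in \<mu>. 1 \<le> f x" by eventually_elim (auto simp: B_def)
    then show ?thesis ..
  qed
  have "AE x in \<mu>. f x = 1"
    using ord
  proof
    assume le: "AE x in \<mu>. f x \<le> 1"
    have "(\<integral>\<^sup>+x. 1 - f x \<partial>\<mu>) = (\<integral>\<^sup>+x. 1 \<partial>\<mu>) - (\<integral>\<^sup>+x. f x \<partial>\<mu>)"
      using f(1) le int_f by (intro nn_integral_diff) auto
    then have "(\<integral>\<^sup>+x. 1 - f x \<partial>\<mu>) = 0" using int_f int_1 by simp
    then have "AE x in \<mu>. 1 - f x = 0" using f(1) by (subst (asm) nn_integral_0_iff_AE) auto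
    then show ?thesis using le by eventually_elim (auto dest: ennreal_minus_eq_0)
  next
    assume ge: "AE x in \<mu>. 1 \<le> f x"
    have "(\<integral>\<^sup>+x. f x - 1 \<partial>\<mu>) = (\<integral>\<^sup>+x. f x \<partial>\<mu>) - (\<integral>\<^sup>+x. 1 \<partial>\<mu>)"
      using f(1) ge int_1 by (intro nn_integral_diff) auto
    then have "(\<integral>\<^sup>+x. f x - 1 \<partial>\<mu>) = 0" using int_f int_1 by simp
    then have "AE x in \<mu>. f x - 1 = 0" using f(1) by (subst (asm) nn_integral_0_iff_AE) auto
    then show ?thesis using ge by eventually_elim (auto dest: ennreal_minus_eq_0)
  qed
  then have "density \<mu> f = density \<mu> (\<lambda>_. 1)" using f(1) by (intro density_cong) auto
  then show ?thesis using f(2) by (simp add: density_1)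
qed

lemma gibbs_bounds_eq_the_gibbs_state:
  assumes "gibbs_bounds \<mu> c"
  shows "the_gibbs_state A \<psi> = \<mu>"
  unfolding the_gibbs_state_def
proof (rule the_equality)
  show "gibbs_state A \<psi> \<mu>" by (rule gibbs_state_of_bounds[OF assms])
  fix \<nu> assume "gibbs_state A \<psi> \<nu>"
  then obtain d where d: "gibbs_bounds \<nu> d" using gibbs_state_imp_bounds by blast
  show "\<nu> = \<mu>"
    by (rule gibbs_unique[OF assms gibbs_bounds_invariant[OF d], of d])
      (use d in \<open>auto simp: gibbs_bounds_def\<close>)
qed

end

section \<open>Comparison of densities by integrals over sets\<close>

lemma AE_le_of_nn_integral_le:
  fixes f g :: "'a \<Rightarrow> ennreal"
  assumes f [measurable]: "f \<in> borel_measurable M" and g [measurable]: "g \<in> borel_measurable M"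
    and fin: "(\<integral>\<^sup>+x. g x \<partial>M) < \<infinity>"
    and le: "\<And>B. B \<in> sets M \<Longrightarrow> (\<integral>\<^sup>+x. f x * indicator B x \<partial>M) \<le> (\<integral>\<^sup>+x. g x * indicator B x \<partial>M)"
  shows "AE x in M. f x \<le> g x"
proof -
  \<comment> \<open>On this set the integral of f is at most that of g, so the positive difference
    integrates to 0; finiteness of the integral of g makes the subtraction legitimate.\<close>
  define B where "B = {x \<in> space M. g x < f x}"
  have B [measurable]: "B \<in> sets M" unfolding B_def by measurable
  have gB: "(\<integral>\<^sup>+x. g x * indicator B x \<partial>M) < \<infinity>"
    by (rule le_less_trans[OF nn_integral_mono fin]) (auto split: split_indicator)
  have "(\<integral>\<^sup>+x. f x * indicator B x - g x * indicator B x \<partial>M)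
    = (\<integral>\<^sup>+x. f x * indicator B x \<partial>M) - (\<integral>\<^sup>+x. g x * indicator B x \<partial>M)"
    using gB by (intro nn_integral_diff) (auto simp: B_def split: split_indicator)
  also have "\<dots> = 0" using le[OF B] le_less_trans[OF le[OF B] gB] by (simp add: diff_eq_0_iff_ennreal)
  finally have "AE x in M. f x * indicator B x - g x * indicator B x = 0"
    by (subst (asm) nn_integral_0_iff_AE) auto
  then show ?thesis
    using AE_space by eventually_elim (auto simp: B_def not_less dest: ennreal_minus_eq_0 split: split_indicator_asm)
qed

section \<open>One-sided cylinders and the future marginal\<close>

definition ocyl :: "('e \<Rightarrow> 'e \<Rightarrow> bool) \<Rightarrow> 'e list \<Rightarrow> (nat \<Rightarrow> 'e) set" where
  "ocyl A w = {\<omega> \<in> one_sided A. \<forall>j<length w. \<omega> j = w ! j}"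

text \<open>The windows are nonempty, so that the first letter is always visible.\<close>

definition one_window :: "nat \<Rightarrow> nat list" where
  "one_window m = [0..<Suc m]"

lemma covering_one_window: "covering one_window"
  unfolding covering_def
proof (intro allI impI)
  fix I :: "nat set" assume "finite I"
  then obtain m where "\<forall>i\<in>I. i < m" using finite_nat_set_iff_bounded by blast
  then show "\<exists>m. I \<subseteq> set (one_window m)" by (intro exI[of _ m]) (auto simp: one_window_def)
qed

lemma one_window_eq_ocyl:
  "{x \<in> one_sided A. map x (one_window m) = w} = (if length w = Suc m then ocyl A w else {})"
  unfolding list_eq_iff_nth_eq ocyl_def one_window_def by (auto simp del: upt_Suc)

lemma ocyl_measurable [measurable, simp]:
  fixes A :: "'e::countable \<Rightarrow> 'e \<Rightarrow> bool"
  shows "ocyl A w \<in> sets (seq_borel (one_sided A))"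
proof -
  have "ocyl A w = {\<omega> \<in> space (seq_borel (one_sided A)). \<forall>j<length w. \<omega> j = w ! j}" by (simp add: ocyl_def)
  also have "\<dots> \<in> sets (seq_borel (one_sided A))" by measurable
  finally show ?thesis .
qed

lemma proj0_one_sided: "\<omega> \<in> two_sided A \<Longrightarrow> proj0 \<omega> \<in> one_sided A"
  by (auto simp: two_sided_def one_sided_def proj0_def) (metis add.commute)

lemma proj0_measurable [measurable]:
  fixes A :: "'e::countable \<Rightarrow> 'e \<Rightarrow> bool"
  shows "proj0 \<in> measurable (seq_borel (two_sided A)) (seq_borel (one_sided A))"
proof (rule measurable_seq_borel)
  show "(\<lambda>x. proj0 x i) \<in> measurable (seq_borel (two_sided A)) (count_space UNIV)" for i
    unfolding proj0_def by measurable
qed (simp add: proj0_one_sided)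

lemma proj0_ocyl: "proj0 -` ocyl A w \<inter> two_sided A = wcyl A 0 w"
  using proj0_one_sided[of _ A] by (auto simp: ocyl_def wcyl_def proj0_def)

lemma sets_future_marginal [simp]: "sets (future_marginal A \<mu>) = sets (seq_borel (one_sided A))"
  by (simp add: future_marginal_def)

lemma space_future_marginal [simp]: "space (future_marginal A \<mu>) = one_sided A"
  by (simp add: future_marginal_def)

lemma
  fixes A :: "'e::countable \<Rightarrow> 'e \<Rightarrow> bool"
  assumes "invariant_prob A \<mu>"
  shows invariant_proj0_measurable: "proj0 \<in> measurable \<mu> (seq_borel (one_sided A))"
    and prob_space_future_marginal: "prob_space (future_marginal A \<mu>)"
proof -
  show m: "proj0 \<in> measurable \<mu> (seq_borel (one_sided A))"
    by (subst measurable_cong_sets[OF invariant_sets[OF assms] refl]) (rule proj0_measurable)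
  interpret prob_space \<mu> by (rule invariant_prob_space[OF assms])
  show "prob_space (future_marginal A \<mu>)"
    unfolding future_marginal_def by (rule prob_space_distr[OF m])
qed

text \<open>The first factor does not depend on \<omega>, so it is a single set to which the
  disintegration can be applied; the second has full measure for a conditional measure over
  \<omega>.\<close>

lemma past_cylinder_eq: "past_cylinder A \<tau> \<omega> = wcyl A (- int (length \<tau>)) \<tau> \<inter> fibre A \<omega>"
proof (intro set_eqI iffI)
  fix \<gamma> assume "\<gamma> \<in> past_cylinder A \<tau> \<omega>"
  then have g: "\<gamma> \<in> two_sided A" "\<And>k. - int (length \<tau>) \<le> k \<Longrightarrow> \<gamma> k = concat_past \<tau> \<omega> k"
    by (auto simp: past_cylinder_def)
  show "\<gamma> \<in> wcyl A (- int (length \<tau>)) \<tau> \<inter> fibre A \<omega>"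
    using g by (auto simp: wcyl_def fibre_def concat_past_def)
next
  fix \<gamma> assume g: "\<gamma> \<in> wcyl A (- int (length \<tau>)) \<tau> \<inter> fibre A \<omega>"
  have "\<gamma> k = concat_past \<tau> \<omega> k" if "- int (length \<tau>) \<le> k" for k
  proof (cases "k < 0")
    case True
    define j where "j = nat (k + int (length \<tau>))"
    have j: "j < length \<tau>" "- int (length \<tau>) + int j = k" using that True by (auto simp: j_def)
    have "\<gamma> (- int (length \<tau>) + int j) = \<tau> ! j" using g j(1) unfolding wcyl_def by blast
    then show ?thesis using True unfolding j(2) by (simp add: concat_past_def j_def)
  next
    case False
    have "\<gamma> (int (nat k)) = \<omega> (nat k)" using g unfolding fibre_def by blast
    then show ?thesis using False by (simp add: concat_past_def)
  qed
  then show "\<gamma> \<in> past_cylinder A \<tau> \<omega>" using g by (auto simp: past_cylinder_def fibre_def)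
qed

lemma shifted_past_cylinder_subset: "shifted_past_cylinder A \<tau> \<omega> \<subseteq> cylinder A \<tau>"
  by (auto simp: shifted_past_cylinder_def cylinder_def concat_past_def)

text \<open>A past cylinder of positive measure is nonempty, and this provides a point \<rho> at
  which a conditional bound can be read.\<close>

lemma shifted_past_cylinder_of_past:
  assumes "\<gamma> \<in> past_cylinder A \<tau> \<omega>"
  shows "\<exists>\<rho>. \<rho> \<in> shifted_past_cylinder A \<tau> \<omega>"
proof -
  define \<rho> where "\<rho> k = \<gamma> (k - int (length \<tau>))" for k
  have "A (\<gamma> (k - int (length \<tau>))) (\<gamma> (k - int (length \<tau>) + 1))" for k
    using assms by (auto simp: past_cylinder_def two_sided_def)
  then have "\<rho> \<in> two_sided A" unfolding two_sided_def \<rho>_def by (simp add: algebra_simps)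
  then show ?thesis using assms by (intro exI[of _ \<rho>]) (auto simp: shifted_past_cylinder_def \<rho>_def past_cylinder_def)
qed

lemma past_cylinder_pasts:
  assumes "\<gamma> \<in> past_cylinder A \<tau> \<omega>" "\<tau> \<noteq> []"
  shows "\<tau> \<in> pasts A (length \<tau>) \<omega>"
proof -
  have g: "\<gamma> \<in> wcyl A (- int (length \<tau>)) \<tau>" "\<gamma> \<in> fibre A \<omega>" using assms(1) by (auto simp: past_cylinder_eq)
  have AA: "A (\<gamma> k) (\<gamma> (k + 1))" for k using g by (auto simp: fibre_def two_sided_def)
  have nth: "\<gamma> (- int (length \<tau>) + int j) = \<tau> ! j" if "j < length \<tau>" for j using g(1) that by (auto simp: wcyl_def)
  have "A (\<tau> ! j) (\<tau> ! Suc j)" if "Suc j < length \<tau>" for j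
  proof -
    have "- int (length \<tau>) + int (Suc j) = - int (length \<tau>) + int j + 1" by simp
    then show ?thesis using AA[of "- int (length \<tau>) + int j"] nth[of j] nth[of "Suc j"] that by (metis Suc_lessD)
  qed
  then have "admissible A \<tau>" by (simp add: admissible_nth)
  moreover have "A (last \<tau>) (\<omega> 0)"
  proof -
    have "last \<tau> = \<tau> ! (length \<tau> - 1)" by (rule last_conv_nth[OF assms(2)])
    also have "\<dots> = \<gamma> (- 1)"
      using nth[of "length \<tau> - 1"] assms(2) by (simp add: of_nat_diff Suc_le_eq)
    finally have "last \<tau> = \<gamma> (- 1)" .
    moreover have "\<omega> 0 = \<gamma> 0" using g(2) by (auto simp: fibre_def dest: spec[of _ 0])
    ultimately show ?thesis using AA[of "- 1"] by simp
  qed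
  ultimately show ?thesis by (simp add: pasts_def)
qed

lemma measure_Int_fibre:
  fixes A :: "'e::countable \<Rightarrow> 'e \<Rightarrow> bool"
  assumes M: "borel_prob_on_fibre A \<omega> M" and W: "W \<in> sets (seq_borel (two_sided A))"
  shows "measure M (W \<inter> fibre A \<omega>) = measure M W"
proof -
  interpret prob_space M using M by (simp add: borel_prob_on_fibre_def)
  have s: "sets M = sets (seq_borel (two_sided A))" using M by (simp add: borel_prob_on_fibre_def)
  have F: "fibre A \<omega> \<in> sets M"
  proof -
    have "fibre A \<omega> = {\<gamma> \<in> space (seq_borel (two_sided A)). \<forall>j. \<gamma> (int j) = \<omega> j}" by (simp add: fibre_def)
    also have "\<dots> \<in> sets (seq_borel (two_sided A))" by measurable
    finally show ?thesis by (simp add: s)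
  qed
  have "AE \<gamma> in M. \<gamma> \<in> fibre A \<omega>"
    using M F prob_eq_1 by (auto simp: borel_prob_on_fibre_def)
  then show ?thesis
    using W F by (intro finite_measure_eq_AE) (auto simp: s)
qed

text \<open>The conditional measures are constrained only almost everywhere, so measurability comes
  with the integral of the indicator rather than with \<open>measure (m \<omega>) W\<close>. On the
  fibre over \<omega>, the event that the future lies in B is decided by \<omega> alone, and its
  indicator comes out of the inner integral.\<close>

lemma disintegrates_set:
  fixes A :: "'e::countable \<Rightarrow> 'e \<Rightarrow> bool"
  assumes \<mu>: "invariant_prob A \<mu>" and cs: "conditional_system A \<mu> m"
    and W: "W \<in> sets (seq_borel (two_sided A))" and B: "B \<in> sets (seq_borel (one_sided A))"
  shows "(\<lambda>\<omega>. \<integral>\<gamma>. indicator W \<gamma> \<partial>m \<omega> :: real) \<in> borel_measurable (future_marginal A \<mu>)"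
    and "AE \<omega> in future_marginal A \<mu>. (\<integral>\<gamma>. indicator W \<gamma> \<partial>m \<omega>) = measure (m \<omega>) W"
    and "(\<integral>\<^sup>+\<omega>. ennreal (\<integral>\<gamma>. indicator W \<gamma> \<partial>m \<omega>) * indicator B \<omega> \<partial>future_marginal A \<mu>)
      = emeasure \<mu> (W \<inter> (proj0 -` B \<inter> two_sided A))"
proof -
  interpret \<mu>: prob_space \<mu> by (rule invariant_prob_space[OF \<mu>])
  note s\<mu> = invariant_sets[OF \<mu>] and sp\<mu> = invariant_space[OF \<mu>]
  have dis: "has_bochner_integral (future_marginal A \<mu>) (\<lambda>\<omega>. \<integral>\<gamma>. indicator D \<gamma> \<partial>m \<omega> :: real) (measure \<mu> D)"
    if "D \<in> sets \<mu>" for D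
  proof -
    have "integrable \<mu> (indicator D :: _ \<Rightarrow> real)"
      using that \<mu>.emeasure_finite[of D] by (intro integrable_real_indicator) (simp_all add: less_top[symmetric])
    then have "has_bochner_integral (future_marginal A \<mu>) (\<lambda>\<omega>. \<integral>\<gamma>. indicator D \<gamma> \<partial>m \<omega> :: real) (\<integral>\<gamma>. indicator D \<gamma> \<partial>\<mu>)"
      using cs unfolding conditional_system_def disintegrates_def by blast
    moreover have "(\<integral>\<gamma>. indicator D \<gamma> \<partial>\<mu>) = measure \<mu> D"
      using sets.sets_into_space[OF that] by (simp add: Int_absorb2)
    ultimately show ?thesis by simp
  qed
  have ae: "AE \<omega> in future_marginal A \<mu>. borel_prob_on_fibre A \<omega> (m \<omega>)"
    using cs by (simp add: conditional_system_def)
  have int_ind: "(\<integral>\<gamma>. indicator D \<gamma> \<partial>m \<omega>) = measure (m \<omega>) D"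
    if "D \<in> sets (seq_borel (two_sided A))" "borel_prob_on_fibre A \<omega> (m \<omega>)" for D \<omega>
    using that sets.sets_into_space[of D "m \<omega>"] by (simp add: borel_prob_on_fibre_def Int_absorb2)
  have WB: "W \<inter> (proj0 -` B \<inter> two_sided A) \<in> sets \<mu>"
    using W measurable_sets[OF invariant_proj0_measurable[OF \<mu>] B] by (simp add: s\<mu> sp\<mu>)
  show meas: "(\<lambda>\<omega>. \<integral>\<gamma>. indicator W \<gamma> \<partial>m \<omega> :: real) \<in> borel_measurable (future_marginal A \<mu>)"
    using dis[of W] W by (auto simp: s\<mu> has_bochner_integral_iff)
  show "AE \<omega> in future_marginal A \<mu>. (\<integral>\<gamma>. indicator W \<gamma> \<partial>m \<omega>) = measure (m \<omega>) W"
    using ae by eventually_elim (rule int_ind[OF W])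
  have "(\<integral>\<^sup>+\<omega>. ennreal (\<integral>\<gamma>. indicator W \<gamma> \<partial>m \<omega>) * indicator B \<omega> \<partial>future_marginal A \<mu>)
    = (\<integral>\<^sup>+\<omega>. ennreal (\<integral>\<gamma>. indicator (W \<inter> (proj0 -` B \<inter> two_sided A)) \<gamma> \<partial>m \<omega>) \<partial>future_marginal A \<mu>)"
  proof (rule nn_integral_cong_AE, use ae in eventually_elim)
    fix \<omega> assume m\<omega>: "borel_prob_on_fibre A \<omega> (m \<omega>)"
    have WB': "W \<inter> (proj0 -` B \<inter> two_sided A) \<in> sets (seq_borel (two_sided A))" using WB by (simp add: s\<mu>)
    have eq: "W \<inter> (proj0 -` B \<inter> two_sided A) \<inter> fibre A \<omega> = (if \<omega> \<in> B then W \<inter> fibre A \<omega> else {})"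
    proof -
      have "proj0 \<gamma> = \<omega>" if "\<gamma> \<in> fibre A \<omega>" for \<gamma> using that by (auto simp: fibre_def proj0_def)
      then show ?thesis by (auto simp: fibre_def)
    qed
    show "ennreal (\<integral>\<gamma>. indicator W \<gamma> \<partial>m \<omega>) * indicator B \<omega>
      = ennreal (\<integral>\<gamma>. indicator (W \<inter> (proj0 -` B \<inter> two_sided A)) \<gamma> \<partial>m \<omega>)"
      unfolding int_ind[OF W m\<omega>] int_ind[OF WB' m\<omega>]
        measure_Int_fibre[OF m\<omega> W, symmetric] measure_Int_fibre[OF m\<omega> WB', symmetric] eq
      by simp
  qed
  also have "\<dots> = ennreal (measure \<mu> (W \<inter> (proj0 -` B \<inter> two_sided A)))"
    using dis[OF WB] by (subst nn_integral_eq_integral) (auto simp: has_bochner_integral_iff)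
  finally show "(\<integral>\<^sup>+\<omega>. ennreal (\<integral>\<gamma>. indicator W \<gamma> \<partial>m \<omega>) * indicator B \<omega> \<partial>future_marginal A \<mu>)
      = emeasure \<mu> (W \<inter> (proj0 -` B \<inter> two_sided A))"
    by (simp add: \<mu>.emeasure_eq_measure)
qed

context hoelder_shift
begin

section \<open>Conditional measures of Gibbs states\<close>

definition past_weight :: "'e list \<Rightarrow> real" where
  "past_weight \<tau> = wt \<tau> * exp (- P * real (length \<tau>))"

lemma past_weight_nonneg [simp]: "0 \<le> past_weight \<tau>"
  by (simp add: past_weight_def)

lemma past_weight_birkhoff:
  assumes "\<rho> \<in> cylinder A \<tau>"
  shows "exp (birkhoff_sum \<psi> (length \<tau>) \<rho> - P * real (length \<tau>)) \<le> past_weight \<tau>"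
    and "past_weight \<tau> \<le> K * exp (birkhoff_sum \<psi> (length \<tau>) \<rho> - P * real (length \<tau>))"
proof -
  have e: "exp (birkhoff_sum \<psi> (length \<tau>) \<rho> - P * real (length \<tau>))
    = exp (birkhoff_sum \<psi> (length \<tau>) \<rho>) * exp (- P * real (length \<tau>))" by (simp add: exp_add[symmetric])
  show "exp (birkhoff_sum \<psi> (length \<tau>) \<rho> - P * real (length \<tau>)) \<le> past_weight \<tau>"
    unfolding e past_weight_def by (intro mult_right_mono wt_lower[OF assms]) auto
  have "past_weight \<tau> \<le> (K * exp (birkhoff_sum \<psi> (length \<tau>) \<rho>)) * exp (- P * real (length \<tau>))"
    unfolding past_weight_def by (intro mult_right_mono wt_upper[OF assms]) auto
  then show "past_weight \<tau> \<le> K * exp (birkhoff_sum \<psi> (length \<tau>) \<rho> - P * real (length \<tau>))"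
    unfolding e by (simp add: mult.assoc)
qed

abbreviation past_set :: "'e list \<Rightarrow> (int \<Rightarrow> 'e) set" where
  "past_set \<tau> \<equiv> wcyl A (- int (length \<tau>)) \<tau>"

definition follow :: "'e list \<Rightarrow> (nat \<Rightarrow> 'e) set" where
  "follow \<tau> = {\<omega> \<in> one_sided A. A (last \<tau>) (\<omega> 0)}"

lemma follow_measurable [measurable, simp]: "follow \<tau> \<in> sets (seq_borel (one_sided A))"
proof -
  have "(\<lambda>\<omega>. \<omega> 0) -` {b. A (last \<tau>) b} \<inter> space (seq_borel (one_sided A)) \<in> sets (seq_borel (one_sided A))"
    by (rule measurable_sets[OF coordinate_measurable]) simp
  moreover have "(\<lambda>\<omega>. \<omega> 0) -` {b. A (last \<tau>) b} \<inter> space (seq_borel (one_sided A)) = follow \<tau>"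
    by (auto simp: follow_def)
  ultimately show ?thesis by simp
qed

text \<open>The unnormalised law of the future on the event that the past ends in \<tau>; its
  density with respect to \<open>future_marginal A \<mu>\<close> is the conditional probability of
  that past.\<close>

definition joint :: "(int \<Rightarrow> 'e) measure \<Rightarrow> 'e list \<Rightarrow> (nat \<Rightarrow> 'e) measure" where
  "joint \<mu> \<tau> = distr (density \<mu> (indicator (past_set \<tau>))) (seq_borel (one_sided A)) proj0"

lemma emeasure_joint:
  assumes \<mu>: "invariant_prob A \<mu>" and B: "B \<in> sets (seq_borel (one_sided A))"
  shows "emeasure (joint \<mu> \<tau>) B = emeasure \<mu> (past_set \<tau> \<inter> (proj0 -` B \<inter> two_sided A))"
proof -
  have m: "proj0 \<in> measurable (density \<mu> (indicator (past_set \<tau>))) (seq_borel (one_sided A))"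
    using invariant_proj0_measurable[OF \<mu>] by (simp add: measurable_def)
  have W: "past_set \<tau> \<in> sets \<mu>" by (simp add: invariant_sets[OF \<mu>])
  have pB: "proj0 -` B \<inter> two_sided A \<in> sets \<mu>"
    using measurable_sets[OF invariant_proj0_measurable[OF \<mu>] B] by (simp add: invariant_space[OF \<mu>])
  show ?thesis
    unfolding joint_def using W pB
    by (simp add: emeasure_distr[OF m B] invariant_space[OF \<mu>] emeasure_density indicator_inter_arith[symmetric])
qed

lemma sets_joint [simp]: "sets (joint \<mu> \<tau>) = sets (seq_borel (one_sided A))"
  by (simp add: joint_def)

text \<open>On the one-sided cylinder of w, the joint law is the mass of \<tau>w. One Gibbs
  inequality for \<tau>w and one for w give \<open>c ^ 2\<close>, the junction gives K, and the
  window comparison extends the bounds to Borel sets.\<close>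

lemma joint_bounds:
  assumes \<mu>: "gibbs_bounds \<mu> c" and \<tau>: "\<tau> \<noteq> []" and B: "B \<in> sets (seq_borel (one_sided A))"
  shows "emeasure (joint \<mu> \<tau>) B \<le> ennreal (c ^ 2 * K * past_weight \<tau>) * emeasure (future_marginal A \<mu>) (follow \<tau> \<inter> B)"
    and "ennreal (past_weight \<tau> / (c ^ 2 * K)) * emeasure (future_marginal A \<mu>) (follow \<tau> \<inter> B) \<le> emeasure (joint \<mu> \<tau>) B"
proof -
  note inv = gibbs_bounds_invariant[OF \<mu>] and c = gibbs_bounds_const[OF \<mu>]
  interpret \<mu>: prob_space \<mu> by (rule invariant_prob_space[OF inv])
  interpret \<nu>: prob_space "future_marginal A \<mu>" by (rule prob_space_future_marginal[OF inv])
  let ?\<nu> = "future_marginal A \<mu>"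
  define q where "q n = exp (- P * real n)" for n :: nat
  have q_add: "q (m + n) = q m * q n" for m n by (simp add: q_def exp_add[symmetric] algebra_simps)
  have q_pos: "0 < q n" for n by (simp add: q_def)
  have mass: "emeasure (joint \<mu> \<tau>) (one_sided A) \<noteq> \<infinity>"
    unfolding emeasure_joint[OF inv sets.top[of "seq_borel (one_sided A)", simplified]] by simp
  have fin_joint: "finite_measure (joint \<mu> \<tau>)"
    by (rule finite_measureI) (use mass in \<open>simp add: joint_def\<close>)
  interpret J: finite_measure "joint \<mu> \<tau>" by (rule fin_joint)
  \<comment> \<open>The right-hand side of the comparison is made into a measure, so that comparing
    it on windows is enough.\<close>
  define N where "N t = density ?\<nu> (\<lambda>\<omega>. ennreal t * indicator (follow \<tau>) \<omega>)" for t
  have eN: "emeasure (N t) D = ennreal t * emeasure ?\<nu> (follow \<tau> \<inter> D)" if "D \<in> sets (seq_borel (one_sided A))" for t D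
  proof -
    have "emeasure (N t) D = (\<integral>\<^sup>+\<omega>. ennreal t * indicator (follow \<tau> \<inter> D) \<omega> \<partial>?\<nu>)"
      unfolding N_def using that
      by (subst emeasure_density) (auto intro!: nn_integral_cong borel_measurable_times_ennreal borel_measurable_indicator split: split_indicator)
    then show ?thesis using that by (simp add: nn_integral_cmult_indicator)
  qed
  have fin_N: "finite_measure (N t)" for t
    by (rule finite_measureI) (use eN[of "one_sided A" t] sets.top[of "seq_borel (one_sided A)"] in
      \<open>simp add: N_def \<nu>.emeasure_eq_measure ennreal_mult_eq_top_iff\<close>)
  have sN: "sets (N t) = sets (seq_borel (one_sided A))" for t by (simp add: N_def)
  have mN: "measure (N t) D = t * measure ?\<nu> (follow \<tau> \<inter> D)" if "D \<in> sets (seq_borel (one_sided A))" "0 \<le> t" for t D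
    using eN[OF that(1), of t] that(2) by (simp add: measure_def enn2real_mult)
  have cyl_joint: "measure (joint \<mu> \<tau>) (ocyl A w) = measure \<mu> (wcyl A (- int (length \<tau>)) (\<tau> @ w))" for w
    unfolding measure_def emeasure_joint[OF inv ocyl_measurable] proj0_ocyl wcyl_append by simp
  have cyl_\<nu>: "measure ?\<nu> (follow \<tau> \<inter> ocyl A w) = (if A (last \<tau>) (hd w) then measure \<mu> (wcyl A 0 w) else 0)"
    if w: "w \<noteq> []" for w
  proof -
    have "follow \<tau> \<inter> ocyl A w = (if A (last \<tau>) (hd w) then ocyl A w else {})"
      using w by (auto simp: follow_def ocyl_def hd_conv_nth)
    moreover have "measure ?\<nu> (ocyl A w) = measure \<mu> (wcyl A 0 w)"
      unfolding future_marginal_def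
      by (subst measure_distr[OF invariant_proj0_measurable[OF inv]])
        (simp_all add: invariant_space[OF inv] proj0_ocyl)
    ultimately show ?thesis by simp
  qed
  \<comment> \<open>The word w must be nonempty, since its first letter decides whether \<tau> may
    precede it.\<close>
  have main: "measure (joint \<mu> \<tau>) (ocyl A w) \<le> (c ^ 2 * K * past_weight \<tau>) * measure ?\<nu> (follow \<tau> \<inter> ocyl A w) \<and>
    (past_weight \<tau> / (c ^ 2 * K)) * measure ?\<nu> (follow \<tau> \<inter> ocyl A w) \<le> measure (joint \<mu> \<tau>) (ocyl A w)" if w: "w \<noteq> []" for w
  proof (cases "admissible A (\<tau> @ w)")
    case False
    \<comment> \<open>When \<tau>w is inadmissible, the fault lies in \<tau>, in w or at the
      junction, and in each case a factor of the comparison measure vanishes as well.\<close>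
    have "wt \<tau> * measure ?\<nu> (follow \<tau> \<inter> ocyl A w) = 0"
    proof (cases "admissible A \<tau> \<and> admissible A w")
      case True
      then have "\<not> A (last \<tau>) (hd w)" using False \<tau> w by (auto simp: admissible_append)
      then show ?thesis by (simp add: cyl_\<nu>[OF w])
    next
      case no: False
      have "wt w = 0 \<Longrightarrow> measure \<mu> (wcyl A 0 w) = 0" using gibbs_bounds_upper[OF \<mu> w, of 0] by (simp add: measure_le_0_iff)
      then show ?thesis using no by (auto simp: cyl_\<nu>[OF w])
    qed
    moreover have "measure (joint \<mu> \<tau>) (ocyl A w) = 0"
      using gibbs_bounds_upper[OF \<mu>, of "\<tau> @ w"] False w by (simp add: cyl_joint measure_le_0_iff)
    ultimately show ?thesis by (auto simp: past_weight_def)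
  next
    case True
    then have adm: "A (last \<tau>) (hd w)" using \<tau> w by (auto simp: admissible_append)
    let ?m = "measure \<mu> (wcyl A 0 w)" and ?j = "measure (joint \<mu> \<tau>) (ocyl A w)"
    have m: "wt w * q (length w) / c \<le> ?m" "?m \<le> c * wt w * q (length w)"
      using gibbs_bounds_lower[OF \<mu> w] gibbs_bounds_upper[OF \<mu> w] by (auto simp: q_def)
    have j: "wt (\<tau> @ w) * q (length \<tau> + length w) / c \<le> ?j" "?j \<le> c * wt (\<tau> @ w) * q (length \<tau> + length w)"
      using gibbs_bounds_lower[OF \<mu>, of "\<tau> @ w"] gibbs_bounds_upper[OF \<mu>, of "\<tau> @ w"] w by (auto simp: q_def cyl_joint)
    have pw: "past_weight \<tau> = wt \<tau> * q (length \<tau>)" by (simp add: past_weight_def q_def)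
    have "?j \<le> c * (wt \<tau> * wt w) * (q (length \<tau>) * q (length w))"
      using j(2) c q_pos wt_append_le[of \<tau> w]
      by (elim order_trans) (auto intro!: mult_mono simp: q_add less_imp_le)
    also have "\<dots> = c * past_weight \<tau> * (wt w * q (length w))" by (simp add: pw)
    also have "\<dots> \<le> c * past_weight \<tau> * (c * ?m)"
      using m(1) c by (intro mult_left_mono) (auto simp: pos_divide_le_eq mult.commute)
    also have "\<dots> = 1 * (c ^ 2 * past_weight \<tau> * ?m)" by (simp add: power2_eq_square)
    \<comment> \<open>The upper estimate does not cost K; it is weakened so that both bounds share
      one constant.\<close>
    also have "\<dots> \<le> K * (c ^ 2 * past_weight \<tau> * ?m)" using K_ge_1 by (intro mult_right_mono) auto
    finally have up: "?j \<le> (c ^ 2 * K * past_weight \<tau>) * ?m" by (simp add: mult_ac)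
    have "past_weight \<tau> * ?m \<le> past_weight \<tau> * (c * wt w * q (length w))" using m(2) by (intro mult_left_mono) auto
    also have "\<dots> = c * (wt \<tau> * wt w) * q (length \<tau> + length w)" by (simp add: pw q_add)
    also have "\<dots> \<le> c * (K * wt (\<tau> @ w)) * q (length \<tau> + length w)"
      using c q_pos[of "length \<tau> + length w"] by (intro mult_left_mono mult_right_mono wt_append_ge[OF True]) auto
    also have "\<dots> = c * K * (wt (\<tau> @ w) * q (length \<tau> + length w))" by simp
    also have "\<dots> \<le> c * K * (c * ?j)"
      using j(1) c K_ge_1 by (intro mult_left_mono) (auto simp: pos_divide_le_eq mult.commute)
    also have "\<dots> = c ^ 2 * K * ?j" by (simp add: power2_eq_square)
    finally have "past_weight \<tau> / (c ^ 2 * K) * ?m \<le> ?j" using c K_ge_1 by (simp add: pos_divide_le_eq mult_ac)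
    with up show ?thesis using adm by (simp add: cyl_\<nu>[OF w])
  qed
  have t: "0 \<le> c ^ 2 * K * past_weight \<tau>" "0 \<le> past_weight \<tau> / (c ^ 2 * K)" using c K_ge_1 by auto
  have "measure (joint \<mu> \<tau>) B \<le> measure (N (c ^ 2 * K * past_weight \<tau>)) B"
  proof (rule measure_le_of_windows[OF covering_one_window fin_joint fin_N sets_joint sN])
    show "measure (joint \<mu> \<tau>) {x \<in> one_sided A. map x (one_window m) = w}
      \<le> measure (N (c ^ 2 * K * past_weight \<tau>)) {x \<in> one_sided A. map x (one_window m) = w}" for m w
      unfolding one_window_eq_ocyl using main[of w] t by (cases "w = []") (auto simp: mN)
  qed (simp add: B)
  then have "emeasure (joint \<mu> \<tau>) B \<le> emeasure (N (c ^ 2 * K * past_weight \<tau>)) B"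
    by (simp add: J.emeasure_eq_measure finite_measure.emeasure_eq_measure[OF fin_N])
  then show "emeasure (joint \<mu> \<tau>) B \<le> ennreal (c ^ 2 * K * past_weight \<tau>) * emeasure ?\<nu> (follow \<tau> \<inter> B)"
    by (simp add: eN[OF B])
  have "measure (N (past_weight \<tau> / (c ^ 2 * K))) B \<le> measure (joint \<mu> \<tau>) B"
  proof (rule measure_le_of_windows[OF covering_one_window fin_N fin_joint sN sets_joint])
    show "measure (N (past_weight \<tau> / (c ^ 2 * K))) {x \<in> one_sided A. map x (one_window m) = w}
      \<le> measure (joint \<mu> \<tau>) {x \<in> one_sided A. map x (one_window m) = w}" for m w
      unfolding one_window_eq_ocyl using main[of w] t by (cases "w = []") (auto simp: mN)
  qed (simp add: B sN)
  then have "emeasure (N (past_weight \<tau> / (c ^ 2 * K))) B \<le> emeasure (joint \<mu> \<tau>) B"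
    by (simp add: J.emeasure_eq_measure finite_measure.emeasure_eq_measure[OF fin_N])
  then show "ennreal (past_weight \<tau> / (c ^ 2 * K)) * emeasure ?\<nu> (follow \<tau> \<inter> B) \<le> emeasure (joint \<mu> \<tau>) B"
    by (simp add: eN[OF B])
qed

text \<open>Stated for any density f of the joint law: it serves both the conditional probabilities
  of a given system and the Radon-Nikodym densities from which a global system is built.\<close>

lemma past_density_bounds:
  assumes \<mu>: "gibbs_bounds \<mu> c" and \<tau>: "\<tau> \<noteq> []"
    and f: "f \<in> borel_measurable (future_marginal A \<mu>)"
    and joint: "\<And>B. B \<in> sets (seq_borel (one_sided A)) \<Longrightarrow>
      (\<integral>\<^sup>+\<omega>. f \<omega> * indicator B \<omega> \<partial>future_marginal A \<mu>) = emeasure (joint \<mu> \<tau>) B"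
  shows "AE \<omega> in future_marginal A \<mu>. f \<omega> \<le> ennreal (c ^ 2 * K * past_weight \<tau>) * indicator (follow \<tau>) \<omega> \<and>
    ennreal (past_weight \<tau> / (c ^ 2 * K)) * indicator (follow \<tau>) \<omega> \<le> f \<omega>"
proof -
  note inv = gibbs_bounds_invariant[OF \<mu>]
  interpret \<nu>: prob_space "future_marginal A \<mu>" by (rule prob_space_future_marginal[OF inv])
  interpret \<mu>: prob_space \<mu> by (rule invariant_prob_space[OF inv])
  let ?\<nu> = "future_marginal A \<mu>"
  have const: "(\<integral>\<^sup>+\<omega>. (ennreal t * indicator (follow \<tau>) \<omega>) * indicator B \<omega> \<partial>?\<nu>) = ennreal t * emeasure ?\<nu> (follow \<tau> \<inter> B)"
    if "B \<in> sets (seq_borel (one_sided A))" for t B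
  proof -
    have "(\<integral>\<^sup>+\<omega>. (ennreal t * indicator (follow \<tau>) \<omega>) * indicator B \<omega> \<partial>?\<nu>)
      = (\<integral>\<^sup>+\<omega>. ennreal t * indicator (follow \<tau> \<inter> B) \<omega> \<partial>?\<nu>)"
      by (intro nn_integral_cong) (auto split: split_indicator)
    then show ?thesis using that by (simp add: nn_integral_cmult_indicator)
  qed
  have cm: "(\<lambda>\<omega>. ennreal t * indicator (follow \<tau>) \<omega>) \<in> borel_measurable ?\<nu>" for t
    by (intro borel_measurable_times_ennreal borel_measurable_indicator) auto
  have "AE \<omega> in ?\<nu>. f \<omega> \<le> ennreal (c ^ 2 * K * past_weight \<tau>) * indicator (follow \<tau>) \<omega>"
  proof (rule AE_le_of_nn_integral_le[OF f cm])
    show "(\<integral>\<^sup>+\<omega>. ennreal (c ^ 2 * K * past_weight \<tau>) * indicator (follow \<tau>) \<omega> \<partial>?\<nu>) < \<infinity>"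
      by (simp add: nn_integral_cmult_indicator \<nu>.emeasure_eq_measure ennreal_mult_less_top)
  qed (use joint const joint_bounds(1)[OF \<mu> \<tau>] in simp)
  moreover have "AE \<omega> in ?\<nu>. ennreal (past_weight \<tau> / (c ^ 2 * K)) * indicator (follow \<tau>) \<omega> \<le> f \<omega>"
  proof (rule AE_le_of_nn_integral_le[OF cm f])
    have "(\<integral>\<^sup>+\<omega>. f \<omega> \<partial>?\<nu>) = (\<integral>\<^sup>+\<omega>. f \<omega> * indicator (one_sided A) \<omega> \<partial>?\<nu>)"
      by (intro nn_integral_cong) simp
    also have "\<dots> = emeasure (joint \<mu> \<tau>) (one_sided A)"
      using joint sets.top[of "seq_borel (one_sided A)"] by simp
    also have "\<dots> < \<infinity>"
      unfolding emeasure_joint[OF inv sets.top[of "seq_borel (one_sided A)", simplified]]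
      by (simp add: less_top[symmetric])
    finally show "(\<integral>\<^sup>+\<omega>. f \<omega> \<partial>?\<nu>) < \<infinity>" .
  qed (use joint const joint_bounds(2)[OF \<mu> \<tau>] in simp)
  ultimately show ?thesis by eventually_elim simp
qed

lemma conditional_bounds:
  assumes \<mu>: "gibbs_bounds \<mu> c" and cs: "conditional_system A \<mu> m" and \<tau>: "\<tau> \<noteq> []"
  shows "AE \<omega> in future_marginal A \<mu>. \<tau> \<in> pasts A (length \<tau>) \<omega> \<longrightarrow>
    measure (m \<omega>) (past_cylinder A \<tau> \<omega>) \<le> c ^ 2 * K * past_weight \<tau> \<and>
    past_weight \<tau> / (c ^ 2 * K) \<le> measure (m \<omega>) (past_cylinder A \<tau> \<omega>)"
proof -
  note inv = gibbs_bounds_invariant[OF \<mu>] and c = gibbs_bounds_const[OF \<mu>]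
  let ?\<nu> = "future_marginal A \<mu>"
  have W: "past_set \<tau> \<in> sets (seq_borel (two_sided A))" by simp
  have "AE \<omega> in ?\<nu>. ennreal (\<integral>\<gamma>. indicator (past_set \<tau>) \<gamma> \<partial>m \<omega>) \<le> ennreal (c ^ 2 * K * past_weight \<tau>) * indicator (follow \<tau>) \<omega> \<and>
    ennreal (past_weight \<tau> / (c ^ 2 * K)) * indicator (follow \<tau>) \<omega> \<le> ennreal (\<integral>\<gamma>. indicator (past_set \<tau>) \<gamma> \<partial>m \<omega>)"
  proof (rule past_density_bounds[OF \<mu> \<tau>])
    show "(\<lambda>\<omega>. ennreal (\<integral>\<gamma>. indicator (past_set \<tau>) \<gamma> \<partial>m \<omega>)) \<in> borel_measurable ?\<nu>"
      using disintegrates_set(1)[OF inv cs W sets.top] by measurable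
  qed (simp only: emeasure_joint[OF inv] disintegrates_set(3)[OF inv cs W])
  moreover have "AE \<omega> in ?\<nu>. borel_prob_on_fibre A \<omega> (m \<omega>)" using cs by (simp add: conditional_system_def)
  moreover note disintegrates_set(2)[OF inv cs W sets.top]
  ultimately show ?thesis
    using AE_space
  proof eventually_elim
    case (elim \<omega>)
    have eq: "measure (m \<omega>) (past_cylinder A \<tau> \<omega>) = measure (m \<omega>) (past_set \<tau>)"
      unfolding past_cylinder_eq by (rule measure_Int_fibre[OF elim(2) W])
    show ?case
    proof
      assume "\<tau> \<in> pasts A (length \<tau>) \<omega>"
      then have "\<omega> \<in> follow \<tau>" using elim(4) by (simp add: pasts_def follow_def)
      then show "measure (m \<omega>) (past_cylinder A \<tau> \<omega>) \<le> c ^ 2 * K * past_weight \<tau> \<and>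
        past_weight \<tau> / (c ^ 2 * K) \<le> measure (m \<omega>) (past_cylinder A \<tau> \<omega>)"
        using elim(1) c K_ge_1 unfolding eq elim(3) by simp
    qed
  qed
qed

text \<open>The mass of \<tau> is the integral over the futures of its conditional mass, and by
  invariance the position of \<tau> in the past does not matter. Where the conditional mass is 0 the
  bound is trivial; elsewhere \<tau> is an admissible past and the hypothesis applies at some
  \<rho>.\<close>

lemma gibbs_bounds_of_conditional:
  assumes inv: "invariant_prob A \<mu>" and cs: "conditional_system A \<mu> m" and D: "1 \<le> D"
    and bd: "\<And>n. 1 \<le> n \<Longrightarrow> AE \<omega> in future_marginal A \<mu>.
       \<forall>\<tau>\<in>pasts A n \<omega>. measure (m \<omega>) (past_cylinder A \<tau> \<omega>) > 0 \<longrightarrow>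
         (\<forall>\<rho>\<in>shifted_past_cylinder A \<tau> \<omega>.
            measure (m \<omega>) (past_cylinder A \<tau> \<omega>) / exp (birkhoff_sum \<psi> n \<rho> - P * real n) \<le> D)"
    and \<tau>: "\<tau> \<noteq> []"
  shows "measure \<mu> (cylinder A \<tau>) \<le> D * wt \<tau> * exp (- P * real (length \<tau>))"
proof -
  let ?\<nu> = "future_marginal A \<mu>"
  interpret \<mu>: prob_space \<mu> by (rule invariant_prob_space[OF inv])
  interpret \<nu>: prob_space ?\<nu> by (rule prob_space_future_marginal[OF inv])
  have W: "past_set \<tau> \<in> sets (seq_borel (two_sided A))" by simp
  have "AE \<omega> in ?\<nu>. borel_prob_on_fibre A \<omega> (m \<omega>)" using cs by (simp add: conditional_system_def)
  moreover have "1 \<le> length \<tau>" using \<tau> by (simp add: Suc_le_eq)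
  note bd[OF this]
  moreover note disintegrates_set(2)[OF inv cs W sets.top]
  ultimately have le: "AE \<omega> in ?\<nu>. ennreal (\<integral>\<gamma>. indicator (past_set \<tau>) \<gamma> \<partial>m \<omega>) \<le> ennreal (D * past_weight \<tau>)"
  proof eventually_elim
    case (elim \<omega>)
    have eq: "measure (m \<omega>) (past_cylinder A \<tau> \<omega>) = measure (m \<omega>) (past_set \<tau>)"
      unfolding past_cylinder_eq by (rule measure_Int_fibre[OF elim(1) W])
    have "measure (m \<omega>) (past_cylinder A \<tau> \<omega>) \<le> D * past_weight \<tau>"
    proof (cases "measure (m \<omega>) (past_cylinder A \<tau> \<omega>) > 0")
      case False
      have "0 \<le> D * past_weight \<tau>" using D by simp
      with False show ?thesis by linarith
    next
      case True
      then have "past_cylinder A \<tau> \<omega> \<noteq> {}" by auto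
      then obtain \<gamma> where \<gamma>: "\<gamma> \<in> past_cylinder A \<tau> \<omega>" by blast
      then obtain \<rho> where \<rho>: "\<rho> \<in> shifted_past_cylinder A \<tau> \<omega>" using shifted_past_cylinder_of_past by blast
      have "measure (m \<omega>) (past_cylinder A \<tau> \<omega>) / exp (birkhoff_sum \<psi> (length \<tau>) \<rho> - P * real (length \<tau>)) \<le> D"
        using elim(2) past_cylinder_pasts[OF \<gamma> \<tau>] True \<rho> by blast
      then have "measure (m \<omega>) (past_cylinder A \<tau> \<omega>) \<le> D * exp (birkhoff_sum \<psi> (length \<tau>) \<rho> - P * real (length \<tau>))"
        by (simp add: pos_divide_le_eq)
      also have "\<dots> \<le> D * past_weight \<tau>"
        using D \<rho> shifted_past_cylinder_subset by (intro mult_left_mono past_weight_birkhoff(1)) auto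
      finally show ?thesis .
    qed
    then show ?case unfolding eq elim(3) by (rule ennreal_leI)
  qed
  have "emeasure \<mu> (past_set \<tau>) = emeasure \<mu> (past_set \<tau> \<inter> (proj0 -` one_sided A \<inter> two_sided A))"
    using proj0_one_sided by (intro arg_cong[where f="emeasure \<mu>"]) (auto simp: wcyl_def)
  also have "\<dots> = (\<integral>\<^sup>+\<omega>. ennreal (\<integral>\<gamma>. indicator (past_set \<tau>) \<gamma> \<partial>m \<omega>) * indicator (one_sided A) \<omega> \<partial>?\<nu>)"
    using disintegrates_set(3)[OF inv cs W, of "one_sided A"] sets.top[of "seq_borel (one_sided A)"] by simp
  also have "\<dots> \<le> (\<integral>\<^sup>+\<omega>. ennreal (D * past_weight \<tau>) \<partial>?\<nu>)"
    by (intro nn_integral_mono_AE, use le in eventually_elim) (auto split: split_indicator)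
  also have "\<dots> = ennreal (D * past_weight \<tau>)" using \<nu>.emeasure_space_1 by simp
  finally have "measure \<mu> (past_set \<tau>) \<le> D * past_weight \<tau>"
    using D by (simp add: \<mu>.emeasure_eq_measure)
  then show ?thesis unfolding measure_wcyl[OF inv] by (simp add: past_weight_def mult.assoc)
qed

end

section \<open>Measurable kernels and disintegrations\<close>

lemma has_bochner_integral_bind:
  fixes g :: "'b \<Rightarrow> real"
  assumes K: "m \<in> measurable M (subprob_algebra S)" and ne: "space M \<noteq> {}"
    and int: "integrable (M \<bind> m) g"
  shows "has_bochner_integral M (\<lambda>\<omega>. \<integral>\<gamma>. g \<gamma> \<partial>m \<omega>) (\<integral>\<gamma>. g \<gamma> \<partial>(M \<bind> m))"
proof -
  have sb: "sets (M \<bind> m) = sets S" using K ne by (rule sets_bind_measurable)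
  have g [measurable]: "g \<in> borel_measurable S"
    using int measurable_cong_sets[OF sb refl] by blast
  \<comment> \<open>The positive and the negative part of g are integrated separately by the formula
    for \<open>bind\<close>; the inner integrals can be infinite only on a null set, where
    \<open>enn2real\<close> returns 0.\<close>
  have half: "has_bochner_integral M (\<lambda>\<omega>. enn2real (\<integral>\<^sup>+\<gamma>. ennreal (f \<gamma>) \<partial>m \<omega>)) (enn2real (\<integral>\<^sup>+\<gamma>. ennreal (f \<gamma>) \<partial>(M \<bind> m))) \<and>
      (AE \<omega> in M. (\<integral>\<^sup>+\<gamma>. ennreal (f \<gamma>) \<partial>m \<omega>) < \<infinity>)"
    if f [measurable]: "f \<in> borel_measurable S" and fin: "(\<integral>\<^sup>+\<gamma>. ennreal (f \<gamma>) \<partial>(M \<bind> m)) < \<infinity>" for f :: "'b \<Rightarrow> real"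
  proof -
    let ?h = "\<lambda>\<omega>. \<integral>\<^sup>+\<gamma>. ennreal (f \<gamma>) \<partial>m \<omega>"
    have h [measurable]: "?h \<in> borel_measurable M"
      by (rule measurable_compose[OF K nn_integral_measurable_subprob_algebra]) measurable
    have eq: "(\<integral>\<^sup>+\<omega>. ?h \<omega> \<partial>M) = (\<integral>\<^sup>+\<gamma>. ennreal (f \<gamma>) \<partial>(M \<bind> m))"
      by (rule nn_integral_bind[symmetric, OF _ K]) measurable
    have ae: "AE \<omega> in M. ?h \<omega> < \<infinity>"
      using nn_integral_noteq_infinite[OF h] eq fin by (auto simp: less_top)
    have "(\<integral>\<^sup>+\<omega>. ennreal (enn2real (?h \<omega>)) \<partial>M) = (\<integral>\<^sup>+\<omega>. ?h \<omega> \<partial>M)"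
      by (intro nn_integral_cong_AE, use ae in eventually_elim) simp
    then have "(\<integral>\<^sup>+\<omega>. ennreal (enn2real (?h \<omega>)) \<partial>M) = ennreal (enn2real (\<integral>\<^sup>+\<gamma>. ennreal (f \<gamma>) \<partial>(M \<bind> m)))"
      using eq fin by simp
    then show ?thesis using ae by (intro conjI has_bochner_integral_nn_integral) auto
  qed
  have fin: "(\<integral>\<^sup>+\<gamma>. ennreal (g \<gamma>) \<partial>(M \<bind> m)) < \<infinity>" "(\<integral>\<^sup>+\<gamma>. ennreal (- g \<gamma>) \<partial>(M \<bind> m)) < \<infinity>"
    using int by (auto simp: real_integrable_def less_top)
  note p = half[OF g fin(1)] and n = half[OF borel_measurable_uminus[OF g] fin(2)]
  have "has_bochner_integral M (\<lambda>\<omega>. enn2real (\<integral>\<^sup>+\<gamma>. ennreal (g \<gamma>) \<partial>m \<omega>) - enn2real (\<integral>\<^sup>+\<gamma>. ennreal (- g \<gamma>) \<partial>m \<omega>))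
    (\<integral>\<gamma>. g \<gamma> \<partial>(M \<bind> m))"
    unfolding real_lebesgue_integral_def[OF int] using p n by (intro has_bochner_integral_diff) auto
  moreover have "AE \<omega> in M. (\<integral>\<gamma>. g \<gamma> \<partial>m \<omega>) =
      enn2real (\<integral>\<^sup>+\<gamma>. ennreal (g \<gamma>) \<partial>m \<omega>) - enn2real (\<integral>\<^sup>+\<gamma>. ennreal (- g \<gamma>) \<partial>m \<omega>)"
    using p[THEN conjunct2] n[THEN conjunct2] AE_space
  proof eventually_elim
    case (elim \<omega>)
    have "g \<in> borel_measurable (m \<omega>)"
      using g measurable_cong_sets[OF subprob_measurableD(2)[OF K elim(3)] refl] by blast
    then have "integrable (m \<omega>) g" using elim by (auto simp: real_integrable_def less_top)
    then show ?case by (rule real_lebesgue_integral_def)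
  qed
  moreover have "(\<lambda>\<omega>. \<integral>\<gamma>. g \<gamma> \<partial>m \<omega>) \<in> borel_measurable M"
    by (rule measurable_compose[OF K integral_measurable_subprob_algebra[OF g]])
  ultimately show ?thesis
    by (subst has_bochner_integral_cong_AE) (auto simp: has_bochner_integral_iff)
qed

text \<open>Single words instead of sets of words: an intersection-stable generator on which the
  measurability of a kernel can be checked.\<close>

definition window_cylinders :: "('e \<Rightarrow> 'e \<Rightarrow> bool) \<Rightarrow> (int \<Rightarrow> 'e) set set" where
  "window_cylinders A = {{x \<in> two_sided A. map x (two_window m) = w} | m w. True}"

lemma Int_stable_window_cylinders: "Int_stable (window_cylinders A)"
proof (rule Int_stableI)
  have *: "{x \<in> two_sided A. map x (two_window m) = v} \<inter> {x \<in> two_sided A. map x (two_window n) = w} \<in> window_cylinders A"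
    if "m \<le> n" for m n v w
  proof (cases "{x \<in> two_sided A. map x (two_window m) = v} \<inter> {x \<in> two_sided A. map x (two_window n) = w} = {}")
    case True
    \<comment> \<open>A word of the wrong length exhibits the empty set as a member of the
      family.\<close>
    have "{x \<in> two_sided A. map x (two_window 0) = [undefined]} = {}" by (simp add: two_window_def)
    then have "{} \<in> window_cylinders A" unfolding window_cylinders_def by blast
    with True show ?thesis by simp
  next
    case False
    then obtain x where x: "map x (two_window m) = v" "map x (two_window n) = w" by blast
    have "map y (two_window m) = v" if "map y (two_window n) = w" for y
      using that x two_window_mono[OF \<open>m \<le> n\<close>] by (auto simp: map_eq_conv subset_eq)
    then have "{x \<in> two_sided A. map x (two_window m) = v} \<inter> {x \<in> two_sided A. map x (two_window n) = w}
      = {x \<in> two_sided A. map x (two_window n) = w}" by blast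
    then show ?thesis unfolding window_cylinders_def by blast
  qed
  fix a b assume "a \<in> window_cylinders A" "b \<in> window_cylinders A"
  then obtain m v n w where ab: "a = {x \<in> two_sided A. map x (two_window m) = v}" "b = {x \<in> two_sided A. map x (two_window n) = w}"
    unfolding window_cylinders_def by blast
  show "a \<inter> b \<in> window_cylinders A"
    using *[of m n v w] *[of n m w v] unfolding ab by (cases "m \<le> n") (auto simp: Int_commute)
qed

lemma sets_seq_borel_window_cylinders:
  fixes A :: "'e::countable \<Rightarrow> 'e \<Rightarrow> bool"
  shows "sets (seq_borel (two_sided A)) = sigma_sets (two_sided A) (window_cylinders A)"
  unfolding sets_seq_borel_window[OF covering_two_window]
proof (rule sigma_sets_eqI)
  fix a assume "a \<in> window_sets (two_sided A) two_window"
  then obtain m S where "a = {x \<in> two_sided A. map x (two_window m) \<in> S}" by (auto simp: window_sets_def)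
  then have "a = (\<Union>w\<in>S. {x \<in> two_sided A. map x (two_window m) = w})" by blast
  also have "\<dots> \<in> sigma_sets (two_sided A) (window_cylinders A)"
    by (intro sigma_sets_UNION) (auto simp: window_cylinders_def intro!: sigma_sets.Basic)
  finally show "a \<in> sigma_sets (two_sided A) (window_cylinders A)" .
next
  fix b assume "b \<in> window_cylinders A"
  then obtain m w where "b = {x \<in> two_sided A. map x (two_window m) \<in> {w}}" by (auto simp: window_cylinders_def)
  then show "b \<in> sigma_sets (two_sided A) (window_sets (two_sided A) two_window)"
    unfolding window_sets_def by (intro sigma_sets.Basic) blast
qed

definition glue :: "(nat \<Rightarrow> 'e) \<Rightarrow> (nat \<Rightarrow> 'e) \<Rightarrow> int \<Rightarrow> 'e" where
  "glue \<omega> x k = (if 0 \<le> k then \<omega> (nat k) else x (nat (- k - 1)))"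

lemma glue_past: "glue \<omega> x (- int (Suc i)) = x i"
  by (simp add: glue_def)

lemma glue_words:
  "(\<forall>j<length \<tau>. glue \<omega> x (- int (length \<tau>) + int j) = \<tau> ! j) \<longleftrightarrow> map x [0..<length \<tau>] = rev \<tau>"
proof -
  have "glue \<omega> x (- int (length \<tau>) + int j) = x (length \<tau> - Suc j)" if "j < length \<tau>" for j
  proof -
    have "- int (length \<tau>) + int j = - int (Suc (length \<tau> - Suc j))" using that by simp
    then show ?thesis by (simp only: glue_past)
  qed
  then have "(\<forall>j<length \<tau>. glue \<omega> x (- int (length \<tau>) + int j) = \<tau> ! j) \<longleftrightarrow>
    (\<forall>j<length \<tau>. x (length \<tau> - Suc j) = \<tau> ! j)" by simp
  also have "\<dots> \<longleftrightarrow> (\<forall>i<length \<tau>. x i = \<tau> ! (length \<tau> - Suc i))"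
  proof
    assume *: "\<forall>j<length \<tau>. x (length \<tau> - Suc j) = \<tau> ! j"
    show "\<forall>i<length \<tau>. x i = \<tau> ! (length \<tau> - Suc i)"
    proof (intro allI impI)
      fix i assume "i < length \<tau>"
      then have "length \<tau> - Suc i < length \<tau>" "length \<tau> - Suc (length \<tau> - Suc i) = i" by auto
      then show "x i = \<tau> ! (length \<tau> - Suc i)" using * by metis
    qed
  next
    assume *: "\<forall>i<length \<tau>. x i = \<tau> ! (length \<tau> - Suc i)"
    show "\<forall>j<length \<tau>. x (length \<tau> - Suc j) = \<tau> ! j"
    proof (intro allI impI)
      fix i assume "i < length \<tau>"
      then have "length \<tau> - Suc i < length \<tau>" "length \<tau> - Suc (length \<tau> - Suc i) = i" by auto
      then show "x (length \<tau> - Suc i) = \<tau> ! i" using * by metis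
    qed
  qed
  also have "\<dots> \<longleftrightarrow> map x [0..<length \<tau>] = rev \<tau>"
    unfolding list_eq_iff_nth_eq by (auto simp: rev_nth)
  finally show ?thesis .
qed

lemma fibre_measurable [simp]:
  fixes A :: "'e::countable \<Rightarrow> 'e \<Rightarrow> bool"
  shows "fibre A \<omega> \<in> sets (seq_borel (two_sided A))"
proof -
  have "fibre A \<omega> = {\<gamma> \<in> space (seq_borel (two_sided A)). \<forall>j. \<gamma> (int j) = \<omega> j}" by (simp add: fibre_def)
  also have "\<dots> \<in> sets (seq_borel (two_sided A))" by measurable
  finally show ?thesis .
qed

section \<open>Conditional measures over every future\<close>

context hoelder_shift
begin

text \<open>Read backwards from -1, the past is a one-sided sequence: prepending a letter to \<tau>
  becomes appending one to \<open>rev \<tau>\<close>, and \<open>word_measure_exists\<close>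
  applies. Almost surely all finite pasts have positive mass, which makes the glued sequence
  admissible.\<close>

lemma fibre_measure_exists:
  assumes \<omega>: "\<omega> \<in> one_sided A"
    and s: "s [] = 1" "\<And>\<tau>. 0 \<le> s \<tau>" "\<And>\<tau>. (\<integral>\<^sup>+e. ennreal (s (e # \<tau>)) \<partial>count_space UNIV) = ennreal (s \<tau>)"
    and adm: "\<And>\<tau>. \<tau> \<noteq> [] \<Longrightarrow> s \<tau> \<noteq> 0 \<Longrightarrow> \<tau> \<in> pasts A (length \<tau>) \<omega>"
  shows "\<exists>M. borel_prob_on_fibre A \<omega> M \<and>
    (\<forall>\<tau> w. measure M (wcyl A (- int (length \<tau>)) (\<tau> @ w)) = s \<tau> * indicator (ocyl A w) \<omega>)"
proof -
  have "\<exists>M. prob_space M \<and> sets M = sets (seq_borel (UNIV :: (nat \<Rightarrow> 'e) set)) \<and>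
    (\<forall>u. measure M {x. map x [0..<length u] = u} = s (rev u))"
    by (rule word_measure_exists) (simp_all add: s)
  then obtain M where M: "prob_space M" "sets M = sets (seq_borel (UNIV :: (nat \<Rightarrow> 'e) set))"
    and Ms: "\<And>u. measure M {x. map x [0..<length u] = u} = s (rev u)" by blast
  interpret M: prob_space M by fact
  have spM: "space M = UNIV" using sets_eq_imp_space_eq[OF M(2)] by simp
  have coord [measurable]: "(\<lambda>x. x i) \<in> measurable M (count_space UNIV)" for i
    by (subst measurable_cong_sets[OF M(2) refl]) (rule coordinate_measurable)
  have word_set: "{x. map x [0..<n] = u} \<in> sets M" for n u
    using window_measurable[of UNIV "\<lambda>v. v = u" "[0..<n]"] by (simp add: M(2))
  have gm [measurable]: "(\<lambda>x. glue \<omega> x k) \<in> measurable M (count_space UNIV)" for k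
    unfolding glue_def by (cases "0 \<le> k") auto
  have "AE x in M. \<forall>n. s (rev (map x [0..<n])) \<noteq> 0"
    unfolding AE_all_countable
  proof
    fix n
    have "AE x in M. \<forall>u\<in>{u. length u = n \<and> s (rev u) = 0}. x \<notin> {x. map x [0..<length u] = u}"
    proof (subst AE_ball_countable)
      show "\<forall>u\<in>{u. length u = n \<and> s (rev u) = 0}. AE x in M. x \<notin> {x. map x [0..<length u] = u}"
        using Ms word_set by (intro ballI AE_not_in) (auto simp: null_sets_def M.emeasure_eq_measure simp del: mem_Collect_eq)
    qed auto
    then show "AE x in M. s (rev (map x [0..<n])) \<noteq> 0"
    proof eventually_elim
      case (elim x)
      show ?case
      proof
        assume "s (rev (map x [0..<n])) = 0"
        then show False using elim[THEN bspec, of "map x [0..<n]"] by simp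
      qed
    qed
  qed
  \<comment> \<open>Transitions are checked in three ranges: inside the future, at the junction, and
    inside the past.\<close>
  then have ae: "AE x in M. glue \<omega> x \<in> two_sided A"
  proof eventually_elim
    case (elim x)
    have p: "rev (map x [0..<Suc n]) \<in> pasts A (Suc n) \<omega>" for n
      using adm[OF _ elim[rule_format, of "Suc n"]] by simp
    have "A (glue \<omega> x k) (glue \<omega> x (k + 1))" for k
    proof -
      consider "0 \<le> k" | "k = - 1" | i where "k = - int (Suc (Suc i))"
      proof -
        have "k = - int (Suc (Suc (nat (- k - 2))))" if "\<not> 0 \<le> k" "k \<noteq> - 1" using that by simp
        then show thesis using that by blast
      qed
      then show ?thesis
      proof cases
        case 1
        then have "nat (k + 1) = Suc (nat k)" by simp
        then show ?thesis using 1 \<omega> by (simp add: glue_def one_sided_def)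
      next
        case 2
        have "A (x 0) (\<omega> 0)" using p[of 0] by (simp add: pasts_def)
        then show ?thesis using 2 by (simp add: glue_def)
      next
        case (3 i)
        have "admissible A (rev (map x [0..<Suc (Suc i)]))" using p[of "Suc i"] by (simp add: pasts_def)
        then have "A (x (Suc i)) (x i)" by (simp add: admissible_Cons)
        moreover have "k + 1 = - int (Suc i)" using 3 by simp
        ultimately show ?thesis unfolding \<open>k + 1 = - int (Suc i)\<close> unfolding 3 glue_past by simp
      qed
    qed
    then show ?case by (simp add: two_sided_def)
  qed
  obtain y where y: "y \<in> two_sided A" "\<And>j. y (int j) = \<omega> j" using extend_past[OF \<omega>] by blast
  \<comment> \<open>Falling back to y, an admissible extension of \<omega>, keeps every value in the
    fibre and not only almost every one.\<close>
  define \<Psi> where "\<Psi> x = (if glue \<omega> x \<in> two_sided A then glue \<omega> x else y)" for x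
  have \<Psi>_fibre: "\<Psi> x \<in> fibre A \<omega>" for x using y by (simp add: \<Psi>_def fibre_def glue_def)
  have [measurable]: "Measurable.pred M (\<lambda>x. glue \<omega> x \<in> two_sided A)"
    unfolding two_sided_def mem_Collect_eq
    by (intro pred_intros_countable measurable_compose[OF gm] measurable_compose_countable[where f="\<lambda>a x. A a (glue \<omega> x _)"]) simp_all
  have \<Psi> [measurable]: "\<Psi> \<in> measurable M (seq_borel (two_sided A))"
  proof (rule measurable_seq_borel)
    show "(\<lambda>x. \<Psi> x i) \<in> measurable M (count_space UNIV)" for i
      unfolding \<Psi>_def if_distrib[of "\<lambda>f. f i"] by measurable
  qed (use \<Psi>_fibre in \<open>auto simp: fibre_def\<close>)
  define L where "L = distr M (seq_borel (two_sided A)) \<Psi>"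
  have L: "prob_space L" unfolding L_def by (rule M.prob_space_distr[OF \<Psi>])
  have mL: "measure L D = measure M (\<Psi> -` D)" if "D \<in> sets (seq_borel (two_sided A))" for D
    unfolding L_def using that by (simp add: measure_distr[OF \<Psi>] spM)
  have "\<Psi> -` fibre A \<omega> = space M" using \<Psi>_fibre by (auto simp: spM)
  then have "measure L (fibre A \<omega>) = 1" by (simp add: mL M.prob_space)
  then have "borel_prob_on_fibre A \<omega> L" using L by (simp add: borel_prob_on_fibre_def L_def)
  moreover have "measure L (wcyl A (- int (length \<tau>)) (\<tau> @ w)) = s \<tau> * indicator (ocyl A w) \<omega>" for \<tau> w
  proof -
    have "measure L (wcyl A (- int (length \<tau>)) (\<tau> @ w)) = measure M (\<Psi> -` wcyl A (- int (length \<tau>)) (\<tau> @ w))"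
      by (rule mL) simp
    also have "\<dots> = measure M (if \<omega> \<in> ocyl A w then {x. map x [0..<length \<tau>] = rev \<tau>} else {})"
    proof (rule M.finite_measure_eq_AE)
      have w: "(\<forall>j<length w. glue \<omega> x (int j) = w ! j) \<longleftrightarrow> \<omega> \<in> ocyl A w" for x
        using \<omega> by (simp add: glue_def ocyl_def)
      show "AE x in M. (x \<in> \<Psi> -` wcyl A (- int (length \<tau>)) (\<tau> @ w)) =
        (x \<in> (if \<omega> \<in> ocyl A w then {x. map x [0..<length \<tau>] = rev \<tau>} else {}))"
        using ae
      proof eventually_elim
        case (elim x)
        have "\<Psi> x \<in> wcyl A (- int (length \<tau>)) (\<tau> @ w) \<longleftrightarrow>
          (\<forall>j<length \<tau>. glue \<omega> x (- int (length \<tau>) + int j) = \<tau> ! j) \<and> (\<forall>j<length w. glue \<omega> x (int j) = w ! j)"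
          unfolding wcyl_append using elim by (simp add: wcyl_def \<Psi>_def)
        then show ?case unfolding glue_words w by auto
      qed
      show "\<Psi> -` wcyl A (- int (length \<tau>)) (\<tau> @ w) \<in> sets M"
        using measurable_sets[OF \<Psi>, of "wcyl A (- int (length \<tau>)) (\<tau> @ w)"] by (simp add: spM)
    qed (use word_set in auto)
    also have "\<dots> = s \<tau> * indicator (ocyl A w) \<omega>" using Ms[of "rev \<tau>"] by simp
    finally show ?thesis .
  qed
  ultimately show ?thesis by blast
qed

text \<open>A Radon-Nikodym version of the conditional probabilities of the pasts satisfies the required
  identities and bounds off a null set. On the null set, \<open>\<omega>\<close> inherits the past of one good point
  with the same zeroth letter, which is a measurable choice and changes the Gibbs bounds by no
  more than bounded distortion.\<close>

lemma past_densities_exist: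
  assumes \<mu>: "gibbs_bounds \<mu> c"
  shows "\<exists>s. (\<forall>\<tau>. s \<tau> \<in> borel_measurable (future_marginal A \<mu>)) \<and>
    (\<forall>\<omega>\<in>one_sided A. s [] \<omega> = 1 \<and> (\<forall>\<tau>. 0 \<le> s \<tau> \<omega>) \<and>
      (\<forall>\<tau>. (\<integral>\<^sup>+e. ennreal (s (e # \<tau>) \<omega>) \<partial>count_space UNIV) = ennreal (s \<tau> \<omega>)) \<and>
      (\<forall>\<tau>. \<tau> \<noteq> [] \<longrightarrow> s \<tau> \<omega> \<le> c ^ 2 * K * past_weight \<tau> * indicator (follow \<tau>) \<omega> \<and>
        past_weight \<tau> / (c ^ 2 * K) * indicator (follow \<tau>) \<omega> \<le> s \<tau> \<omega>)) \<and>
    (\<forall>\<tau> B. B \<in> sets (seq_borel (one_sided A)) \<longrightarrow>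
      (\<integral>\<^sup>+\<omega>. ennreal (s \<tau> \<omega>) * indicator B \<omega> \<partial>future_marginal A \<mu>) = emeasure (joint \<mu> \<tau>) B)"
proof -
  note inv = gibbs_bounds_invariant[OF \<mu>] and c = gibbs_bounds_const[OF \<mu>]
  define \<nu> where "\<nu> = future_marginal A \<mu>"
  interpret \<mu>: prob_space \<mu> by (rule invariant_prob_space[OF inv])
  interpret \<nu>: prob_space \<nu> unfolding \<nu>_def by (rule prob_space_future_marginal[OF inv])
  note s\<mu> = invariant_sets[OF inv] and sp\<mu> = invariant_space[OF inv]
  have s\<nu> [measurable_cong]: "sets \<nu> = sets (seq_borel (one_sided A))" and sp\<nu>: "space \<nu> = one_sided A"
    by (simp_all add: \<nu>_def)
  have \<nu>_eq: "emeasure \<nu> B = emeasure \<mu> (proj0 -` B \<inter> two_sided A)" if "B \<in> sets \<nu>" for B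
    using that unfolding \<nu>_def future_marginal_def
    by (subst emeasure_distr[OF invariant_proj0_measurable[OF inv]]) (simp_all add: sp\<mu>)
  have pB: "proj0 -` B \<inter> two_sided A \<in> sets \<mu>" if "B \<in> sets \<nu>" for B
    using measurable_sets[OF invariant_proj0_measurable[OF inv], of B] that by (simp add: sp\<mu> s\<nu>)
  have "\<exists>F\<in>borel_measurable \<nu>. density \<nu> F = joint \<mu> \<tau>" for \<tau>
  proof (rule \<nu>.Radon_Nikodym)
    show "absolutely_continuous \<nu> (joint \<mu> \<tau>)"
      unfolding absolutely_continuous_def
    proof
      fix B assume "B \<in> null_sets \<nu>"
      then have B: "B \<in> sets \<nu>" "emeasure \<nu> B = 0" by auto
      have "emeasure (joint \<mu> \<tau>) B \<le> emeasure \<nu> B"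
        unfolding emeasure_joint[OF inv B(1)[unfolded s\<nu>]] \<nu>_eq[OF B(1)]
        using pB[OF B(1)] by (intro emeasure_mono) auto
      then show "B \<in> null_sets (joint \<mu> \<tau>)" using B by (auto simp: null_sets_def s\<nu>)
    qed
  qed (simp add: s\<nu>)
  then obtain F where F [measurable]: "\<And>\<tau>. F \<tau> \<in> borel_measurable \<nu>" and dF: "\<And>\<tau>. density \<nu> (F \<tau>) = joint \<mu> \<tau>"
    by metis
  have F_int: "(\<integral>\<^sup>+\<omega>. F \<tau> \<omega> * indicator B \<omega> \<partial>\<nu>) = emeasure (joint \<mu> \<tau>) B" if "B \<in> sets \<nu>" for \<tau> B
    using emeasure_density[OF F that] by (simp add: dF)
  have F_Nil: "AE \<omega> in \<nu>. F [] \<omega> = 1"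
  proof (rule \<nu>.density_unique)
    show "density \<nu> (F []) = density \<nu> (\<lambda>_. 1)"
    proof (rule measure_eqI)
      fix B assume "B \<in> sets (density \<nu> (F []))"
      then have B: "B \<in> sets \<nu>" by simp
      have "two_sided A \<inter> (proj0 -` B \<inter> two_sided A) = proj0 -` B \<inter> two_sided A" by auto
      then show "emeasure (density \<nu> (F [])) B = emeasure (density \<nu> (\<lambda>_. 1)) B"
        using B by (simp add: dF emeasure_joint[OF inv] s\<nu>[symmetric] \<nu>_eq density_1)
    qed simp
  qed auto
  have F_sum: "AE \<omega> in \<nu>. (\<integral>\<^sup>+e. F (e # \<tau>) \<omega> \<partial>count_space UNIV) = F \<tau> \<omega>" for \<tau>
  proof (rule AE_symmetric, rule \<nu>.density_unique)
    show m: "(\<lambda>\<omega>. \<integral>\<^sup>+e. F (e # \<tau>) \<omega> \<partial>count_space UNIV) \<in> borel_measurable \<nu>"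
    proof -
      interpret C: sigma_finite_measure "count_space (UNIV :: 'e set)"
        by (rule sigma_finite_measure_count_space_countable) simp
      have "(\<lambda>(e, \<omega>). F (e # \<tau>) \<omega>) \<in> borel_measurable (count_space (UNIV :: 'e set) \<Otimes>\<^sub>M \<nu>)"
        by (rule measurable_pair_measure_countable1) auto
      then have "(\<lambda>(\<omega>, e). F (e # \<tau>) \<omega>) \<in> borel_measurable (\<nu> \<Otimes>\<^sub>M count_space UNIV)"
        using measurable_pair_swap by fastforce
      then show ?thesis by (rule C.borel_measurable_nn_integral)
    qed
    show "density \<nu> (F \<tau>) = density \<nu> (\<lambda>\<omega>. \<integral>\<^sup>+e. F (e # \<tau>) \<omega> \<partial>count_space UNIV)"
    proof (rule measure_eqI)
      fix B assume "B \<in> sets (density \<nu> (F \<tau>))"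
      then have B: "B \<in> sets \<nu>" by simp
      have "emeasure (density \<nu> (\<lambda>\<omega>. \<integral>\<^sup>+e. F (e # \<tau>) \<omega> \<partial>count_space UNIV)) B
        = (\<integral>\<^sup>+\<omega>. (\<integral>\<^sup>+e. F (e # \<tau>) \<omega> \<partial>count_space UNIV) * indicator B \<omega> \<partial>\<nu>)"
        by (rule emeasure_density[OF m B])
      also have "\<dots> = (\<integral>\<^sup>+\<omega>. (\<integral>\<^sup>+e. F (e # \<tau>) \<omega> * indicator B \<omega> \<partial>count_space UNIV) \<partial>\<nu>)"
        by (simp add: nn_integral_multc)
      also have "\<dots> = (\<integral>\<^sup>+e. (\<integral>\<^sup>+\<omega>. F (e # \<tau>) \<omega> * indicator B \<omega> \<partial>\<nu>) \<partial>count_space UNIV)"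
        using B by (intro nn_integral_count_space_nn_integral) auto
      \<comment> \<open>The letter e occupies the coordinate just left of \<tau>, and summing over e
        removes the condition on that coordinate.\<close>
      also have "\<dots> = (\<integral>\<^sup>+e. emeasure \<mu> ((past_set \<tau> \<inter> (proj0 -` B \<inter> two_sided A)) \<inter> wcyl A (- int (length \<tau>) - 1) [e]) \<partial>count_space UNIV)"
      proof (intro nn_integral_cong)
        fix e
        have k: "- int (length (e # \<tau>)) = - int (length \<tau>) - 1" by simp
        have "past_set (e # \<tau>) = past_set \<tau> \<inter> wcyl A (- int (length \<tau>) - 1) [e]"
          unfolding k using wcyl_append[of A "- int (length \<tau>) - 1" "[e]" \<tau>] by (simp add: Int_commute)
        then have "past_set (e # \<tau>) \<inter> (proj0 -` B \<inter> two_sided A)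
          = (past_set \<tau> \<inter> (proj0 -` B \<inter> two_sided A)) \<inter> wcyl A (- int (length \<tau>) - 1) [e]" by blast
        then show "(\<integral>\<^sup>+\<omega>. F (e # \<tau>) \<omega> * indicator B \<omega> \<partial>\<nu>)
          = emeasure \<mu> ((past_set \<tau> \<inter> (proj0 -` B \<inter> two_sided A)) \<inter> wcyl A (- int (length \<tau>) - 1) [e])"
          unfolding F_int[OF B] emeasure_joint[OF inv B[unfolded s\<nu>]] by simp
      qed
      also have "\<dots> = emeasure \<mu> (past_set \<tau> \<inter> (proj0 -` B \<inter> two_sided A))"
        using emeasure_split_words[OF s\<mu>, of "past_set \<tau> \<inter> (proj0 -` B \<inter> two_sided A)" "Suc 0"] pB[OF B]
        by (simp add: s\<mu>)
      also have "\<dots> = emeasure (density \<nu> (F \<tau>)) B"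
        unfolding dF emeasure_joint[OF inv B[unfolded s\<nu>]] ..
      finally show "emeasure (density \<nu> (F \<tau>)) B = emeasure (density \<nu> (\<lambda>\<omega>. \<integral>\<^sup>+e. F (e # \<tau>) \<omega> \<partial>count_space UNIV)) B" ..
    qed simp
  qed auto
  have F_bounds: "AE \<omega> in \<nu>. F \<tau> \<omega> \<le> ennreal (c ^ 2 * K * past_weight \<tau>) * indicator (follow \<tau>) \<omega> \<and>
    ennreal (past_weight \<tau> / (c ^ 2 * K)) * indicator (follow \<tau>) \<omega> \<le> F \<tau> \<omega>" if "\<tau> \<noteq> []" for \<tau>
    unfolding \<nu>_def using F F_int that by (intro past_density_bounds[OF \<mu>]) (auto simp: \<nu>_def)
  define good where "good \<omega> \<longleftrightarrow> F [] \<omega> = 1 \<and> (\<forall>\<tau>. (\<integral>\<^sup>+e. F (e # \<tau>) \<omega> \<partial>count_space UNIV) = F \<tau> \<omega>) \<and>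
    (\<forall>\<tau>\<in>{\<tau>. \<tau> \<noteq> []}. F \<tau> \<omega> \<le> ennreal (c ^ 2 * K * past_weight \<tau>) * indicator (follow \<tau>) \<omega> \<and>
      ennreal (past_weight \<tau> / (c ^ 2 * K)) * indicator (follow \<tau>) \<omega> \<le> F \<tau> \<omega>)" for \<omega>
  have "AE \<omega> in \<nu>. \<forall>\<tau>. (\<integral>\<^sup>+e. F (e # \<tau>) \<omega> \<partial>count_space UNIV) = F \<tau> \<omega>"
    unfolding AE_all_countable using F_sum by blast
  moreover have "AE \<omega> in \<nu>. \<forall>\<tau>\<in>{\<tau>. \<tau> \<noteq> []}. F \<tau> \<omega> \<le> ennreal (c ^ 2 * K * past_weight \<tau>) * indicator (follow \<tau>) \<omega> \<and>
      ennreal (past_weight \<tau> / (c ^ 2 * K)) * indicator (follow \<tau>) \<omega> \<le> F \<tau> \<omega>"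
    using F_bounds by (subst AE_ball_countable) auto
  ultimately have "AE \<omega> in \<nu>. good \<omega>"
    using F_Nil by eventually_elim (simp add: good_def)
  then obtain N where N: "N \<in> null_sets \<nu>" "{\<omega> \<in> space \<nu>. \<not> good \<omega>} \<subseteq> N"
    unfolding eventually_ae_filter by blast
  define T where "T = space \<nu> - N"
  have T [measurable]: "T \<in> sets \<nu>" using N(1) by (auto simp: T_def)
  have T_good: "\<omega> \<in> one_sided A" "good \<omega>" if "\<omega> \<in> T" for \<omega> using that N(2) by (auto simp: T_def sp\<nu>)
  have AE_T: "AE \<omega> in \<nu>. \<omega> \<in> T" using AE_not_in[OF N(1)] AE_space by eventually_elim (simp add: T_def)
  \<comment> \<open>Each one-letter cylinder has positive mass by the lower Gibbs bound, so it
    cannot lie in a null set.\<close>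
  have "\<exists>\<omega>. \<omega> \<in> T \<and> \<omega> 0 = b" for b
  proof (rule ccontr)
    assume "\<not> (\<exists>\<omega>. \<omega> \<in> T \<and> \<omega> 0 = b)"
    then have "ocyl A [b] \<subseteq> N" by (auto simp: T_def ocyl_def sp\<nu>)
    then have "emeasure \<nu> (ocyl A [b]) \<le> emeasure \<nu> N" using N(1) by (intro emeasure_mono) auto
    then have "emeasure \<nu> (ocyl A [b]) = 0" using N(1) by auto
    then have "measure \<mu> (wcyl A 0 [b]) = 0" by (simp add: \<nu>_eq s\<nu> proj0_ocyl \<mu>.emeasure_eq_measure)
    moreover have "0 < wt [b] * exp (- P * real (length [b])) / c" using c by simp
    ultimately show False using gibbs_bounds_lower[OF \<mu>, of "[b]" 0] by simp
  qed
  then obtain g where g: "\<And>b. g b \<in> T" "\<And>b. g b 0 = b" by metis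
  \<comment> \<open>The replacement keeps the zeroth letter, and whether \<tau> may precede \<omega>
    depends on nothing else; so the bounds in terms of \<open>past_weight\<close> hold at \<omega>
    with the same constants.\<close>
  define R where "R \<omega> = (if \<omega> \<in> T then \<omega> else g (\<omega> 0))" for \<omega>
  have R: "R \<omega> \<in> T" "R \<omega> 0 = \<omega> 0" for \<omega> using g by (auto simp: R_def)
  have R_follow: "R \<omega> \<in> follow \<tau> \<longleftrightarrow> \<omega> \<in> follow \<tau>" if "\<omega> \<in> one_sided A" for \<omega> \<tau>
    using that R[of \<omega>] T_good(1)[OF R(1)] by (simp add: follow_def)
  define s where "s \<tau> \<omega> = enn2real (F \<tau> (R \<omega>))" for \<tau> \<omega>
  have FR [measurable]: "(\<lambda>\<omega>. F \<tau> (R \<omega>)) \<in> borel_measurable \<nu>" for \<tau>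
  proof -
    \<comment> \<open>The choice g is arbitrary, but the composition is a function of one letter and
      thus measurable.\<close>
    have "(\<lambda>\<omega>. F \<tau> (g (\<omega> 0))) \<in> borel_measurable \<nu>"
      by (rule measurable_compose[of "\<lambda>\<omega>. \<omega> 0" _ "count_space UNIV"])
        (simp_all add: measurable_cong_sets[OF s\<nu> refl, of "count_space UNIV"])
    then have "(\<lambda>\<omega>. if \<omega> \<in> T then F \<tau> \<omega> else F \<tau> (g (\<omega> 0))) \<in> borel_measurable \<nu>" by measurable
    then show ?thesis by (simp add: R_def if_distrib)
  qed
  \<comment> \<open>At good points the upper bound makes the \<open>ennreal\<close> densities
    finite, so nothing is lost in passing to real values.\<close>
  have Ffin: "F \<tau> \<omega> < \<infinity>" if "good \<omega>" for \<tau> \<omega>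
  proof (cases "\<tau> = []")
    case False
    then have "F \<tau> \<omega> \<le> ennreal (c ^ 2 * K * past_weight \<tau>) * indicator (follow \<tau>) \<omega>" using that by (simp add: good_def)
    also have "\<dots> < \<infinity>" by (simp add: ennreal_mult_less_top split: split_indicator)
    finally show ?thesis .
  qed (use that in \<open>simp add: good_def\<close>)
  have s_F: "ennreal (s \<tau> \<omega>) = F \<tau> (R \<omega>)" for \<tau> \<omega>
    using Ffin[OF T_good(2)[OF R(1)]] by (simp add: s_def)
  have s_int: "(\<integral>\<^sup>+\<omega>. ennreal (s \<tau> \<omega>) * indicator B \<omega> \<partial>\<nu>) = emeasure (joint \<mu> \<tau>) B" if "B \<in> sets \<nu>" for \<tau> B
  proof -
    have "(\<integral>\<^sup>+\<omega>. ennreal (s \<tau> \<omega>) * indicator B \<omega> \<partial>\<nu>) = (\<integral>\<^sup>+\<omega>. F \<tau> \<omega> * indicator B \<omega> \<partial>\<nu>)"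
      by (intro nn_integral_cong_AE, use AE_T in eventually_elim) (simp add: s_F R_def)
    then show ?thesis by (simp add: F_int[OF that])
  qed
  have "s [] \<omega> = 1 \<and> (\<forall>\<tau>. 0 \<le> s \<tau> \<omega>) \<and>
      (\<forall>\<tau>. (\<integral>\<^sup>+e. ennreal (s (e # \<tau>) \<omega>) \<partial>count_space UNIV) = ennreal (s \<tau> \<omega>)) \<and>
      (\<forall>\<tau>. \<tau> \<noteq> [] \<longrightarrow> s \<tau> \<omega> \<le> c ^ 2 * K * past_weight \<tau> * indicator (follow \<tau>) \<omega> \<and>
        past_weight \<tau> / (c ^ 2 * K) * indicator (follow \<tau>) \<omega> \<le> s \<tau> \<omega>)" if \<omega>: "\<omega> \<in> one_sided A" for \<omega>
  proof (intro conjI allI impI)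
    note gd = T_good(2)[OF R(1), of \<omega>]
    show "s [] \<omega> = 1" using gd by (simp add: s_def good_def)
    show "0 \<le> s \<tau> \<omega>" for \<tau> by (simp add: s_def)
    show "(\<integral>\<^sup>+e. ennreal (s (e # \<tau>) \<omega>) \<partial>count_space UNIV) = ennreal (s \<tau> \<omega>)" for \<tau>
      unfolding s_F using gd by (simp add: good_def)
    fix \<tau> :: "'e list" assume \<tau>: "\<tau> \<noteq> []"
    have b: "ennreal (s \<tau> \<omega>) \<le> ennreal (c ^ 2 * K * past_weight \<tau>) * indicator (follow \<tau>) \<omega>"
      "ennreal (past_weight \<tau> / (c ^ 2 * K)) * indicator (follow \<tau>) \<omega> \<le> ennreal (s \<tau> \<omega>)"
      using gd \<tau> R_follow[OF \<omega>, of \<tau>] unfolding s_F good_def by (auto simp: indicator_def)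
    have n: "0 \<le> c ^ 2 * K * past_weight \<tau>" "0 \<le> past_weight \<tau> / (c ^ 2 * K)" "0 \<le> s \<tau> \<omega>"
      using c K_ge_1 by (auto simp: s_def)
    show "s \<tau> \<omega> \<le> c ^ 2 * K * past_weight \<tau> * indicator (follow \<tau>) \<omega>"
      using b(1) n by (cases "\<omega> \<in> follow \<tau>") (auto simp: ennreal_eq_0_iff)
    show "past_weight \<tau> / (c ^ 2 * K) * indicator (follow \<tau>) \<omega> \<le> s \<tau> \<omega>"
      using b(2) n by (cases "\<omega> \<in> follow \<tau>") auto
  qed
  moreover have "s \<tau> \<in> borel_measurable \<nu>" for \<tau> unfolding s_def by measurable
  ultimately show ?thesis
    using s_int unfolding \<nu>_def[symmetric] s\<nu> by (intro exI[of _ s]) blast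
qed

text \<open>The fibre measures form a measurable kernel because on a window cut at 0 they are a
  density in \<omega> times an indicator of the future. Integrating the kernel gives back \<mu> on
  these windows, hence everywhere, and the disintegration follows from the integral formula for
  \<open>bind\<close>.\<close>

lemma global_system_exists:
  assumes \<mu>: "gibbs_bounds \<mu> c"
  shows "\<exists>m. global_conditional_system A \<mu> m \<and>
    (\<forall>\<omega>\<in>one_sided A. \<forall>\<tau>. \<tau> \<noteq> [] \<longrightarrow> \<tau> \<in> pasts A (length \<tau>) \<omega> \<longrightarrow>
      measure (m \<omega>) (past_cylinder A \<tau> \<omega>) \<le> c ^ 2 * K * past_weight \<tau> \<and>
      past_weight \<tau> / (c ^ 2 * K) \<le> measure (m \<omega>) (past_cylinder A \<tau> \<omega>))"
proof -
  note inv = gibbs_bounds_invariant[OF \<mu>] and c = gibbs_bounds_const[OF \<mu>]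
  define \<nu> where "\<nu> = future_marginal A \<mu>"
  interpret \<mu>: prob_space \<mu> by (rule invariant_prob_space[OF inv])
  interpret \<nu>: prob_space \<nu> unfolding \<nu>_def by (rule prob_space_future_marginal[OF inv])
  note s\<mu> = invariant_sets[OF inv]
  let ?S = "seq_borel (two_sided A)"
  have s\<nu>: "sets \<nu> = sets (seq_borel (one_sided A))" and sp\<nu>: "space \<nu> = one_sided A"
    by (simp_all add: \<nu>_def)
  obtain s where s: "(\<forall>\<tau>. s \<tau> \<in> borel_measurable \<nu>) \<and>
    (\<forall>\<omega>\<in>one_sided A. s [] \<omega> = 1 \<and> (\<forall>\<tau>. 0 \<le> s \<tau> \<omega>) \<and>
      (\<forall>\<tau>. (\<integral>\<^sup>+e. ennreal (s (e # \<tau>) \<omega>) \<partial>count_space UNIV) = ennreal (s \<tau> \<omega>)) \<and>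
      (\<forall>\<tau>. \<tau> \<noteq> [] \<longrightarrow> s \<tau> \<omega> \<le> c ^ 2 * K * past_weight \<tau> * indicator (follow \<tau>) \<omega> \<and>
        past_weight \<tau> / (c ^ 2 * K) * indicator (follow \<tau>) \<omega> \<le> s \<tau> \<omega>)) \<and>
    (\<forall>\<tau> B. B \<in> sets (seq_borel (one_sided A)) \<longrightarrow>
      (\<integral>\<^sup>+\<omega>. ennreal (s \<tau> \<omega>) * indicator B \<omega> \<partial>\<nu>) = emeasure (joint \<mu> \<tau>) B)"
    using past_densities_exist[OF \<mu>] unfolding \<nu>_def by (elim exE)
  note s_meas = s[THEN conjunct1, rule_format]
    and s_point = s[THEN conjunct2, THEN conjunct1, THEN bspec]
    and s_int = s[THEN conjunct2, THEN conjunct2, rule_format]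
  note s_Nil = s_point[THEN conjunct1]
    and s_nonneg = s_point[THEN conjunct2, THEN conjunct1, rule_format]
    and s_sum = s_point[THEN conjunct2, THEN conjunct2, THEN conjunct1, rule_format]
    and s_bounds = s_point[THEN conjunct2, THEN conjunct2, THEN conjunct2, rule_format]
  have s_pasts: "\<tau> \<in> pasts A (length \<tau>) \<omega>" if "\<omega> \<in> one_sided A" "\<tau> \<noteq> []" "s \<tau> \<omega> \<noteq> 0" for \<omega> \<tau>
  proof -
    have "0 < s \<tau> \<omega>" using that s_nonneg[of \<omega> \<tau>] by simp
    then have "0 < c ^ 2 * K * past_weight \<tau> * indicator (follow \<tau>) \<omega>" using s_bounds[OF that(1,2)] by linarith
    then have "past_weight \<tau> \<noteq> 0" "\<omega> \<in> follow \<tau>" by (auto split: split_indicator_asm)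
    then show ?thesis by (auto simp: pasts_def follow_def past_weight_def) (metis wt_eq_0)
  qed
  have "\<exists>M. borel_prob_on_fibre A \<omega> M \<and>
    (\<forall>\<tau> w. measure M (wcyl A (- int (length \<tau>)) (\<tau> @ w)) = s \<tau> \<omega> * indicator (ocyl A w) \<omega>)"
    if "\<omega> \<in> one_sided A" for \<omega>
    using that s_Nil s_nonneg s_sum s_pasts by (intro fibre_measure_exists) auto
  then obtain m where m: "\<And>\<omega>. \<omega> \<in> one_sided A \<Longrightarrow> borel_prob_on_fibre A \<omega> (m \<omega>)"
    and m_cyl: "\<And>\<omega> \<tau> w. \<omega> \<in> one_sided A \<Longrightarrow>
      measure (m \<omega>) (wcyl A (- int (length \<tau>)) (\<tau> @ w)) = s \<tau> \<omega> * indicator (ocyl A w) \<omega>"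
    by metis
  have m_prob: "prob_space (m \<omega>)" and m_sets: "sets (m \<omega>) = sets ?S" if "\<omega> \<in> one_sided A" for \<omega>
    using m[OF that] by (auto simp: borel_prob_on_fibre_def)
  have m_ecyl: "emeasure (m \<omega>) (wcyl A (- int (length \<tau>)) (\<tau> @ w)) = ennreal (s \<tau> \<omega>) * indicator (ocyl A w) \<omega>"
    if "\<omega> \<in> one_sided A" for \<omega> \<tau> w
  proof -
    interpret prob_space "m \<omega>" by (rule m_prob[OF that])
    show ?thesis by (simp add: emeasure_eq_measure m_cyl[OF that] split: split_indicator)
  qed
  have window: "{x \<in> two_sided A. map x (two_window n) = w} =
      (if length w = 2 * n then wcyl A (- int (length (take n w))) (take n w @ drop n w) else {})" for n w
    by (simp add: two_window_eq_wcyl)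
  have K1: "m \<in> measurable \<nu> (prob_algebra ?S)"
  proof (rule measurable_prob_algebra_generated[OF sets_seq_borel_window_cylinders Int_stable_window_cylinders])
    show "window_cylinders A \<subseteq> Pow (two_sided A)" by (auto simp: window_cylinders_def)
    fix a assume "a \<in> window_cylinders A"
    then obtain n w where a: "a = {x \<in> two_sided A. map x (two_window n) = w}" by (auto simp: window_cylinders_def)
    show "(\<lambda>\<omega>. emeasure (m \<omega>) a) \<in> borel_measurable \<nu>"
    proof (cases "length w = 2 * n")
      case True
      have "(\<lambda>\<omega>. ennreal (s (take n w) \<omega>) * indicator (ocyl A (drop n w)) \<omega>) \<in> borel_measurable \<nu>"
        using s_meas by (intro borel_measurable_times_ennreal borel_measurable_indicator measurable_compose[OF s_meas measurable_ennreal]) (simp add: s\<nu>)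
      moreover have "emeasure (m \<omega>) a = ennreal (s (take n w) \<omega>) * indicator (ocyl A (drop n w)) \<omega>"
        if "\<omega> \<in> space \<nu>" for \<omega>
        unfolding a window if_P[OF True] by (rule m_ecyl[OF that[unfolded sp\<nu>]])
      ultimately show ?thesis by (rule measurable_cong[THEN iffD2, rotated])
    qed (simp add: a window)
  qed (use m_prob m_sets in \<open>auto simp: sp\<nu>\<close>)
  then have K: "m \<in> measurable \<nu> (subprob_algebra ?S)" by (rule measurable_prob_algebraD)
  have bind: "\<nu> \<bind> m = \<mu>"
  proof (rule measure_eq_of_windows[OF covering_two_window])
    have "prob_space (\<nu> \<bind> m)"
      using m_prob by (intro \<nu>.prob_space_bind[OF _ K] AE_I2) (auto simp: sp\<nu>)
    then show "finite_measure (\<nu> \<bind> m)" by (rule prob_space.finite_measure)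
    show "finite_measure \<mu>" by (rule \<mu>.finite_measure_axioms)
    show "sets (\<nu> \<bind> m) = sets ?S" by (rule sets_bind_measurable[OF K \<nu>.not_empty])
    show "sets \<mu> = sets ?S" by (rule s\<mu>)
    fix n w
    show "measure (\<nu> \<bind> m) {x \<in> two_sided A. map x (two_window n) = w} = measure \<mu> {x \<in> two_sided A. map x (two_window n) = w}"
    proof (cases "length w = 2 * n")
      case True
      define \<tau> where "\<tau> = take n w"
      define u where "u = drop n w"
      have eq: "{x \<in> two_sided A. map x (two_window n) = w} = wcyl A (- int (length \<tau>)) (\<tau> @ u)"
        unfolding window \<tau>_def u_def using True by simp
      have "emeasure (\<nu> \<bind> m) (wcyl A (- int (length \<tau>)) (\<tau> @ u)) = (\<integral>\<^sup>+\<omega>. emeasure (m \<omega>) (wcyl A (- int (length \<tau>)) (\<tau> @ u)) \<partial>\<nu>)"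
        by (rule emeasure_bind[OF \<nu>.not_empty K]) simp
      also have "\<dots> = (\<integral>\<^sup>+\<omega>. ennreal (s \<tau> \<omega>) * indicator (ocyl A u) \<omega> \<partial>\<nu>)"
        by (intro nn_integral_cong m_ecyl) (simp add: sp\<nu>)
      also have "\<dots> = emeasure \<mu> (past_set \<tau> \<inter> wcyl A 0 u)"
        by (simp add: s_int emeasure_joint[OF inv] proj0_ocyl)
      also have "past_set \<tau> \<inter> wcyl A 0 u = wcyl A (- int (length \<tau>)) (\<tau> @ u)"
        by (simp add: wcyl_append)
      finally show ?thesis unfolding eq by (simp add: measure_def)
    qed (simp add: window)
  qed
  have "has_bochner_integral \<nu> (\<lambda>\<omega>. \<integral>\<gamma>. g \<gamma> \<partial>m \<omega>) (\<integral>\<gamma>. g \<gamma> \<partial>\<mu>)" if "integrable \<mu> g" for g :: "(int \<Rightarrow> 'e) \<Rightarrow> real"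
    using has_bochner_integral_bind[OF K \<nu>.not_empty, of g] that by (simp add: bind)
  then have "global_conditional_system A \<mu> m"
    using m unfolding global_conditional_system_def disintegrates_def \<nu>_def by blast
  moreover have "measure (m \<omega>) (past_cylinder A \<tau> \<omega>) \<le> c ^ 2 * K * past_weight \<tau> \<and>
      past_weight \<tau> / (c ^ 2 * K) \<le> measure (m \<omega>) (past_cylinder A \<tau> \<omega>)"
    if \<omega>: "\<omega> \<in> one_sided A" and \<tau>: "\<tau> \<noteq> []" "\<tau> \<in> pasts A (length \<tau>) \<omega>" for \<omega> \<tau>
  proof -
    have "measure (m \<omega>) (past_cylinder A \<tau> \<omega>) = measure (m \<omega>) (wcyl A (- int (length \<tau>)) (\<tau> @ []))"
      unfolding past_cylinder_eq by (simp add: measure_Int_fibre[OF m[OF \<omega>]])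
    also have "\<dots> = s \<tau> \<omega>" unfolding m_cyl[OF \<omega>] using \<omega> by (simp add: ocyl_def)
    finally have "measure (m \<omega>) (past_cylinder A \<tau> \<omega>) = s \<tau> \<omega>" .
    moreover have "\<omega> \<in> follow \<tau>" using \<tau>(2) \<omega> by (simp add: pasts_def follow_def)
    ultimately show ?thesis using s_bounds[OF \<omega> \<tau>(1)] by simp
  qed
  ultimately show ?thesis by blast
qed

text \<open>The second factor K is the price for replacing the supremum over the cylinder of \<tau>
  by the Birkhoff sum at the point \<rho>.\<close>

lemma ratio_bounds:
  assumes c: "1 \<le> c" and \<rho>: "\<rho> \<in> shifted_past_cylinder A \<tau> \<omega>"
    and x: "x \<le> c ^ 2 * K * past_weight \<tau>" "past_weight \<tau> / (c ^ 2 * K) \<le> x"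
  shows "inverse (c ^ 2 * K ^ 2) \<le> x / exp (birkhoff_sum \<psi> (length \<tau>) \<rho> - P * real (length \<tau>))"
    and "x / exp (birkhoff_sum \<psi> (length \<tau>) \<rho> - P * real (length \<tau>)) \<le> c ^ 2 * K ^ 2"
proof -
  define E where "E = exp (birkhoff_sum \<psi> (length \<tau>) \<rho> - P * real (length \<tau>))"
  have E: "0 < E" by (simp add: E_def)
  have p: "E \<le> past_weight \<tau>" "past_weight \<tau> \<le> K * E"
    using past_weight_birkhoff \<rho> shifted_past_cylinder_subset unfolding E_def by blast+
  have "c ^ 2 * K * past_weight \<tau> \<le> c ^ 2 * K * (K * E)" using p K_ge_1 by (intro mult_left_mono) auto
  with x(1) have "x \<le> c ^ 2 * K ^ 2 * E" by (simp add: power2_eq_square mult_ac)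
  then show "x / E \<le> c ^ 2 * K ^ 2" using E by (simp add: pos_divide_le_eq)
  have ck: "0 < c ^ 2 * K" "0 < c ^ 2 * K ^ 2" using c K_ge_1 by auto
  have "c ^ 2 * K * 1 \<le> c ^ 2 * K * K" using K_ge_1 ck(1) by (intro mult_left_mono) auto
  then have "c ^ 2 * K \<le> c ^ 2 * K ^ 2" by (simp add: power2_eq_square mult.assoc)
  then have "E / (c ^ 2 * K ^ 2) \<le> past_weight \<tau> / (c ^ 2 * K)" using p(1) ck E by (intro frac_le) auto
  with x(2) have "E / (c ^ 2 * K ^ 2) \<le> x" by simp
  then show "inverse (c ^ 2 * K ^ 2) \<le> x / E" using E ck by (simp add: field_simps)
qed

end

theorem theorem3p11:
  fixes A :: "'e::countable \<Rightarrow> 'e \<Rightarrow> bool" and \<psi> :: "(int \<Rightarrow> 'e) \<Rightarrow> real"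
  assumes "finitely_irreducible A"
    and "hoelder_potential A \<psi>"
    and "summable_potential A \<psi>"
  shows "(\<forall>\<mu> m. invariant_prob A \<mu> \<longrightarrow> conditional_system A \<mu> m \<longrightarrow>
            (\<mu> = the_gibbs_state A \<psi> \<longleftrightarrow>
             (\<exists>D\<ge>1. \<forall>n\<ge>1. AE \<omega> in future_marginal A \<mu>.
                \<forall>\<tau>\<in>pasts A n \<omega>. measure (m \<omega>) (past_cylinder A \<tau> \<omega>) > 0 \<longrightarrow>
                  (\<forall>\<rho>\<in>shifted_past_cylinder A \<tau> \<omega>.
                     inverse D \<le> measure (m \<omega>) (past_cylinder A \<tau> \<omega>)
                                  / exp (birkhoff_sum \<psi> n \<rho> - pressure A \<psi> * real n) \<and>
                     measure (m \<omega>) (past_cylinder A \<tau> \<omega>)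
                       / exp (birkhoff_sum \<psi> n \<rho> - pressure A \<psi> * real n) \<le> D))))
       \<and> (\<exists>D\<ge>1. \<exists>m. global_conditional_system A (the_gibbs_state A \<psi>) m \<and>
            (\<forall>\<omega>\<in>one_sided A. \<forall>n\<ge>1. \<forall>\<tau>\<in>pasts A n \<omega>. \<forall>\<rho>\<in>shifted_past_cylinder A \<tau> \<omega>.
               inverse D \<le> measure (m \<omega>) (past_cylinder A \<tau> \<omega>)
                            / exp (birkhoff_sum \<psi> n \<rho> - pressure A \<psi> * real n) \<and>
               measure (m \<omega>) (past_cylinder A \<tau> \<omega>)
                 / exp (birkhoff_sum \<psi> n \<rho> - pressure A \<psi> * real n) \<le> D))"
proof -
  interpret hoelder_shift A \<psi> using assms by unfold_locales
  obtain \<mu>\<^sub>0 where \<mu>\<^sub>0: "gibbs_bounds \<mu>\<^sub>0 G" using gibbs_bounds_exists by blast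
  have the_gibbs: "the_gibbs_state A \<psi> = \<mu>\<^sub>0" by (rule gibbs_bounds_eq_the_gibbs_state[OF \<mu>\<^sub>0])
  define D where "D = G ^ 2 * K ^ 2"
  have D: "1 \<le> D" unfolding D_def using G_ge_1 K_ge_1 by (intro mult_ge1_I one_le_power) auto
  let ?R = "\<lambda>D m \<omega> n \<tau>. \<forall>\<rho>\<in>shifted_past_cylinder A \<tau> \<omega>.
    inverse D \<le> measure (m \<omega>) (past_cylinder A \<tau> \<omega>) / exp (birkhoff_sum \<psi> n \<rho> - P * real n) \<and>
    measure (m \<omega>) (past_cylinder A \<tau> \<omega>) / exp (birkhoff_sum \<psi> n \<rho> - P * real n) \<le> D"
  have R: "?R D m \<omega> n \<tau>" if n: "1 \<le> n" and \<tau>: "\<tau> \<in> pasts A n \<omega>"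
    and bd: "\<tau> \<noteq> [] \<Longrightarrow> \<tau> \<in> pasts A (length \<tau>) \<omega> \<Longrightarrow>
      measure (m \<omega>) (past_cylinder A \<tau> \<omega>) \<le> G ^ 2 * K * past_weight \<tau> \<and>
      past_weight \<tau> / (G ^ 2 * K) \<le> measure (m \<omega>) (past_cylinder A \<tau> \<omega>)" for m \<omega> n \<tau>
  proof -
    have len: "length \<tau> = n" using \<tau> by (simp add: pasts_def)
    then have "\<tau> \<noteq> []" "\<tau> \<in> pasts A (length \<tau>) \<omega>" using n \<tau> by auto
    note b = bd[OF this]
    show ?thesis
      using ratio_bounds[OF G_ge_1 _ b[THEN conjunct1] b[THEN conjunct2]] unfolding D_def len by blast
  qed
  show ?thesis
  proof (intro conjI allI impI)
    fix \<mu> m assume inv: "invariant_prob A \<mu>" and cs: "conditional_system A \<mu> m"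
    let ?M = "\<lambda>\<omega> \<tau>. measure (m \<omega>) (past_cylinder A \<tau> \<omega>)"
    show "\<mu> = the_gibbs_state A \<psi> \<longleftrightarrow> (\<exists>D\<ge>1. \<forall>n\<ge>1. AE \<omega> in future_marginal A \<mu>.
        \<forall>\<tau>\<in>pasts A n \<omega>. ?M \<omega> \<tau> > 0 \<longrightarrow> ?R D m \<omega> n \<tau>)" (is "_ \<longleftrightarrow> ?bounded")
    proof
      assume "\<mu> = the_gibbs_state A \<psi>"
      then have \<mu>: "gibbs_bounds \<mu> G" using \<mu>\<^sub>0 by (simp add: the_gibbs)
      \<comment> \<open>There are only countably many words, so one null set serves all of
        them.\<close>
      have "AE \<omega> in future_marginal A \<mu>. \<forall>\<tau>\<in>{\<tau>. \<tau> \<noteq> []}. \<tau> \<in> pasts A (length \<tau>) \<omega> \<longrightarrow>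
          ?M \<omega> \<tau> \<le> G ^ 2 * K * past_weight \<tau> \<and> past_weight \<tau> / (G ^ 2 * K) \<le> ?M \<omega> \<tau>"
        using conditional_bounds[OF \<mu> cs] by (subst AE_ball_countable) auto
      then have "AE \<omega> in future_marginal A \<mu>. \<forall>\<tau>\<in>pasts A n \<omega>. ?M \<omega> \<tau> > 0 \<longrightarrow> ?R D m \<omega> n \<tau>" if n: "1 \<le> n" for n
      proof eventually_elim
        case (elim \<omega>)
        show ?case
        proof (intro ballI[of "pasts A n \<omega>"] impI)
          fix \<tau> assume "\<tau> \<in> pasts A n \<omega>"
          then show "?R D m \<omega> n \<tau>" by (rule R[OF n]) (use elim in simp)
        qed
      qed
      then show ?bounded using D by blast
    next
      assume ?bounded
      then obtain D where D: "1 \<le> D" and bd: "\<And>n. 1 \<le> n \<Longrightarrow> AE \<omega> in future_marginal A \<mu>.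
          \<forall>\<tau>\<in>pasts A n \<omega>. ?M \<omega> \<tau> > 0 \<longrightarrow> ?R D m \<omega> n \<tau>" by blast
      \<comment> \<open>The upper half of the conditional bound produces the domination required by
        \<open>gibbs_unique\<close>.\<close>
      have "measure \<mu> (cylinder A \<tau>) \<le> D * wt \<tau> * exp (- P * real (length \<tau>))" if "\<tau> \<noteq> []" for \<tau>
      proof (rule gibbs_bounds_of_conditional[OF inv cs D _ that])
        fix n :: nat assume "1 \<le> n"
        from bd[OF this] show "AE \<omega> in future_marginal A \<mu>. \<forall>\<tau>\<in>pasts A n \<omega>. ?M \<omega> \<tau> > 0 \<longrightarrow>
            (\<forall>\<rho>\<in>shifted_past_cylinder A \<tau> \<omega>. ?M \<omega> \<tau> / exp (birkhoff_sum \<psi> n \<rho> - P * real n) \<le> D)"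
          by eventually_elim blast
      qed
      then show "\<mu> = the_gibbs_state A \<psi>"
        unfolding the_gibbs by (rule gibbs_unique[OF \<mu>\<^sub>0 inv])
    qed
  next
    obtain m where m: "global_conditional_system A \<mu>\<^sub>0 m"
      and bd: "\<And>\<omega> \<tau>. \<omega> \<in> one_sided A \<Longrightarrow> \<tau> \<noteq> [] \<Longrightarrow> \<tau> \<in> pasts A (length \<tau>) \<omega> \<Longrightarrow>
        measure (m \<omega>) (past_cylinder A \<tau> \<omega>) \<le> G ^ 2 * K * past_weight \<tau> \<and>
        past_weight \<tau> / (G ^ 2 * K) \<le> measure (m \<omega>) (past_cylinder A \<tau> \<omega>)"
      using global_system_exists[OF \<mu>\<^sub>0] by blast
    have "?R D m \<omega> n \<tau>" if "\<omega> \<in> one_sided A" "1 \<le> n" "\<tau> \<in> pasts A n \<omega>" for \<omega> n \<tau>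
      using that by (intro R bd)
    then show "\<exists>D\<ge>1. \<exists>m. global_conditional_system A (the_gibbs_state A \<psi>) m \<and>
        (\<forall>\<omega>\<in>one_sided A. \<forall>n\<ge>1. \<forall>\<tau>\<in>pasts A n \<omega>. ?R D m \<omega> n \<tau>)"
      using m D unfolding the_gibbs by blast
  qed
qed

end
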